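(* Let $f\in\mathscr F^n$ and $g\in C^0(\overline I\times\mathbb R^n\times\mathbb R;\mathbb R)$. Consider $E\in C^2(\mathbb R;\mathbb R)$ such that $E''$ is a tempered distribution and the support of its Fourier transform $\widehat{E''}$ admits a cluster point. For any $u_o,v_o\in L^\infty(\mathbb R^n;\mathbb R)$ consider the Cauchy problems $$\begin{cases}\partial_tu+\operatorname{div}_xf(t,x,u)=g(t,x,u) \\ {} u(0,x)=u_o(x)\end{cases}\qquad\text{and}\qquad\begin{cases}\partial_tv+\operatorname{div}_xf(t,x,v)=g(t,x,v) \\ {} v(0,x)=v_o(x).\end{cases}$$ For any distributional solutions $u,v\in L^\infty(I\times\mathbb R^n;\mathbb R)$ to these problems (respectively), let $\mathcal M^{u_o}_u$ and $\mathcal M^{v_o}_v$ be the corresponding entropy production functionals. With $(\mathcal T_kE)(w)=E(w-k)$, $$\Big(\forall k\in\mathbb R\quad\mathcal M^{u_o}_u(\mathcal T_kE)=\mathcal M^{v_o}_v(\mathcal T_kE)\Big)\implies\mathcal M^{u_o}_u=\mathcal M^{v_o}_v .$$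
   Context: Let $n\ge1$ be an integer and let $I=[0,+\infty)$ or $I=[0,T)$ for some $T>0$, with closure $\overline I$. $\nabla_x$ and $\operatorname{div}_x$ applied to functions of $(t,x,u)$ denote derivatives with respect to $x$ only, with $t$ and $u$ fixed. Test functions are $\varphi\in\mathcal D(I\times\mathbb R^n;\mathbb C)=C_c^\infty(I\times\mathbb R^n;\mathbb C)$, where compact support means that the support is a compact subset of $I\times\mathbb R^n$ (so $\varphi(0,\cdot)$ need not vanish), and $\mathcal D'(I\times\mathbb R^n;\mathbb C)$ is the corresponding space of distributions. $\mathscr F$ is the set of $\zeta\in C^1(\overline I\times\mathbb R^n\times\mathbb R;\mathbb R)$, with variables $(t,x,u)$, such that $\partial^2_{tu}\zeta$ and $\nabla_x\partial_u\zeta$ are continuous on $\overline I\times\mathbb R^n\times\mathbb R$; $\mathscr F^n$ is the analogous space of $\mathbb R^n$-valued functions. Distributional solution (with datum $u_o$): for all $\varphi\in C^1_c(I\times\mathbb R^n;\mathbb R)$, $$\int_I\int_{\mathbb R^n}\big(u\,\partial_t\varphi+f(t,x,u)\cdot\nabla_x\varphi\big)dx\,dt+\int_I\int_{\mathbb R^n}g(t,x,u)\,\varphi\,dx\,dt+\int_{\mathbb R^n}u_o(x)\varphi(0,x)\,dx=0 .$$ Entropy production: for $E\in C^1(\mathbb R;\mathbb C)$ let $F\in\mathscr F^n+i\mathscr F^n$ be any function with $\partial_uF(t,x,u)=E'(u)\,\partial_uf(t,x,u)$ (the choice is irrelevant; e.g. $F=\int_0^uE'(w)\partial_uf(t,x,w)dw$);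 then $$(\mathcal M^{u_o}_u(E))(\varphi)=\int_I\int_{\mathbb R^n}\big(E(u)\,\partial_t\varphi+F(t,x,u)\cdot\nabla_x\varphi\big)dx\,dt-\int_I\int_{\mathbb R^n}E'(u)\,(\operatorname{div}_xf)(t,x,u)\,\varphi\,dx\,dt$$ $$+\int_I\int_{\mathbb R^n}(\operatorname{div}_xF)(t,x,u)\,\varphi\,dx\,dt+\int_I\int_{\mathbb R^n}E'(u)\,g(t,x,u)\,\varphi\,dx\,dt+\int_{\mathbb R^n}E(u_o(x))\,\varphi(0,x)\,dx ,$$ with $u=u(t,x)$, $\varphi=\varphi(t,x)$. Thus $\mathcal M^{u_o}_u$ is a map from $C^1$ entropies to distributions, and $\mathcal M^{u_o}_u=\mathcal M^{v_o}_v$ means equality on all $C^1$ entropies. *)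

theory Defs
  imports "HOL-Analysis.Analysis"
begin

section \<open>Differentiability classes and test functions\<close>

text \<open>
  Derivatives are taken within \<open>S\<close>. In all uses \<open>S\<close> is convex with nonempty interior, so
  the derivative within \<open>S\<close> is unique, and at boundary points it is the one-sided derivative.
  Values outside \<open>S\<close> play no role.
\<close>

primrec C_k_on ::
  "nat \<Rightarrow> 'a::euclidean_space set \<Rightarrow> ('a \<Rightarrow> 'b::real_normed_vector) \<Rightarrow> bool" where
  "C_k_on 0 S h \<longleftrightarrow> continuous_on S h"
| "C_k_on (Suc k) S h \<longleftrightarrow>
     (\<exists>h'. (\<forall>z\<in>S. (h has_derivative h' z) (at z within S)) \<and> (\<forall>v. C_k_on k S (\<lambda>z. h' z v)))"

text \<open>
  The support is required to be a compact subset of \<open>S\<close>. For \<open>S = I \<times> \<real>\<^sup>n\<close> with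
  \<open>0 \<in> I\<close>, a test function need not vanish at time \<open>0\<close>.
\<close>

definition Cc_k ::
  "nat \<Rightarrow> 'a::euclidean_space set \<Rightarrow> ('a \<Rightarrow> 'b::real_normed_vector) set" where
  "Cc_k k S = {\<phi>. C_k_on k S \<phi> \<and>
     compact (closure (support_on S \<phi>)) \<and> closure (support_on S \<phi>) \<subseteq> S}"

definition test_functions ::
  "'a::euclidean_space set \<Rightarrow> ('a \<Rightarrow> 'b::real_normed_vector) set" where
  "test_functions S = (\<Inter>k. Cc_k k S)"

definition L_inf :: "'a::euclidean_space set \<Rightarrow> ('a \<Rightarrow> real) set" where
  "L_inf S = {h \<in> borel_measurable (lebesgue_on S). \<exists>C. AE z in lebesgue_on S. \<bar>h z\<bar> \<le> C}"


section \<open>Partial derivatives\<close>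

text \<open>
  In \<open>dt J\<close> the remaining variables are collected in the second component of the argument, so
  that it applies to functions of \<open>(t, x)\<close> and of \<open>(t, x, u)\<close>. The time derivative is taken
  within \<open>J\<close>.
\<close>

definition dt :: "real set \<Rightarrow> (real \<times> 'a \<Rightarrow> 'b::real_normed_vector) \<Rightarrow> real \<times> 'a \<Rightarrow> 'b" where
  "dt J h = (\<lambda>(t, y). vector_derivative (\<lambda>s. h (s, y)) (at t within J))"

definition dx :: "'n::finite \<Rightarrow> (real^'n \<Rightarrow> 'b::real_normed_vector) \<Rightarrow> real^'n \<Rightarrow> 'b" where
  "dx i h x = vector_derivative (\<lambda>s. h (x + s *\<^sub>R axis i 1)) (at 0)"

definition du ::
  "(real \<times> (real^'n) \<times> real \<Rightarrow> 'b::real_normed_vector) \<Rightarrow> real \<times> (real^'n) \<times> real \<Rightarrow> 'b" where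
  "du h = (\<lambda>(t, x, u). vector_derivative (\<lambda>w. h (t, x, w)) (at u))"

definition divx ::
  "(real \<times> (real^'n) \<times> real \<Rightarrow> ('b::real_normed_vector)^'n) \<Rightarrow> real \<times> (real^'n) \<times> real \<Rightarrow> 'b" where
  "divx h = (\<lambda>(t, x, u). \<Sum>i\<in>UNIV. dx i (\<lambda>y. h (t, y, u) $ i) x)"

text \<open>The bilinear product \<open>a \<cdot> \<nabla>\<^sub>x \<phi>\<close> (no complex conjugation).\<close>

definition dot_gradx ::
  "('b::real_normed_algebra)^'n \<Rightarrow> (real \<times> (real^'n) \<Rightarrow> 'b) \<Rightarrow> real \<times> (real^'n) \<Rightarrow> 'b" where
  "dot_gradx a \<phi> = (\<lambda>(t, x). \<Sum>i\<in>UNIV. a $ i * dx i (\<lambda>y. \<phi> (t, y)) x)"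


section \<open>Fluxes, distributional solutions and entropy production\<close>

text \<open>
  The value type \<open>'b\<close> is \<open>real\<close> for \<open>\<F>\<close>, \<open>real^'n\<close> for \<open>\<F>\<^sup>n\<close> and
  \<open>complex^'n\<close> for \<open>\<F>\<^sup>n + \<i>\<F>\<^sup>n\<close>.
\<close>

definition F_class ::
  "real set \<Rightarrow> (real \<times> (real^'n) \<times> real \<Rightarrow> 'b::real_normed_vector) set" where
  "F_class I = {\<zeta>.
     C_k_on 1 (closure I \<times> UNIV) \<zeta> \<and>
     (\<forall>t\<in>closure I. \<forall>x u. (\<lambda>s. du \<zeta> (s, x, u)) differentiable (at t within closure I)) \<and>
     continuous_on (closure I \<times> UNIV) (dt (closure I) (du \<zeta>)) \<and>
     (\<forall>i. (\<forall>t\<in>closure I. \<forall>x u. (\<lambda>s. du \<zeta> (t, x + s *\<^sub>R axis i 1, u)) differentiable (at 0)) \<and>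
          continuous_on (closure I \<times> UNIV) (\<lambda>(t, x, u). dx i (\<lambda>y. du \<zeta> (t, y, u)) x))}"

definition distributional_solution ::
  "real set \<Rightarrow> (real \<times> (real^'n) \<times> real \<Rightarrow> real^'n) \<Rightarrow> (real \<times> (real^'n) \<times> real \<Rightarrow> real)
     \<Rightarrow> (real^'n \<Rightarrow> real) \<Rightarrow> (real \<times> (real^'n) \<Rightarrow> real) \<Rightarrow> bool" where
  "distributional_solution I f g uo u \<longleftrightarrow>
     (\<forall>\<phi> \<in> Cc_k 1 (I \<times> UNIV).
        (LINT (t, x)|lebesgue_on (I \<times> UNIV).
           u (t, x) * dt I \<phi> (t, x) + dot_gradx (f (t, x, u (t, x))) \<phi> (t, x))
      + (LINT (t, x)|lebesgue_on (I \<times> UNIV). g (t, x, u (t, x)) * \<phi> (t, x))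
      + (LINT x|lebesgue. uo x * \<phi> (0, x)) = 0)"

definition entropy_flux ::
  "real set \<Rightarrow> (real \<times> (real^'n) \<times> real \<Rightarrow> real^'n) \<Rightarrow> (real \<Rightarrow> complex)
     \<Rightarrow> (real \<times> (real^'n) \<times> real \<Rightarrow> complex^'n) \<Rightarrow> bool" where
  "entropy_flux I f E F \<longleftrightarrow> F \<in> F_class I \<and>
     (\<forall>t\<in>closure I. \<forall>x u i.
        du F (t, x, u) $ i = vector_derivative E (at u) * of_real (du f (t, x, u) $ i))"

text \<open>
  The functional below does not depend on the choice of the entropy flux \<open>F\<close>: two fluxes for
  the same entropy differ by a \<open>C\<^sup>1\<close> function of \<open>(t, x)\<close> alone, whose contribution vanishes
  upon integration by parts. One flux is \<open>F (t, x, u) = \<integral>\<^sub>0\<^sup>u E' w \<partial>\<^sub>u f (t, x, w) dw\<close>. The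
  flux selected is a function of \<open>I\<close>, \<open>f\<close> and \<open>E\<close> only.
\<close>

definition entropy_production ::
  "real set \<Rightarrow> (real \<times> (real^'n) \<times> real \<Rightarrow> real^'n) \<Rightarrow> (real \<times> (real^'n) \<times> real \<Rightarrow> real)
     \<Rightarrow> (real^'n \<Rightarrow> real) \<Rightarrow> (real \<times> (real^'n) \<Rightarrow> real)
     \<Rightarrow> (real \<Rightarrow> complex) \<Rightarrow> (real \<times> (real^'n) \<Rightarrow> complex) \<Rightarrow> complex" where
  "entropy_production I f g uo u E \<phi> =
     (let F = (SOME F. entropy_flux I f E F); E' = (\<lambda>w. vector_derivative E (at w)) in
        (LINT (t, x)|lebesgue_on (I \<times> UNIV).
           E (u (t, x)) * dt I \<phi> (t, x) + dot_gradx (F (t, x, u (t, x))) \<phi> (t, x))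
      - (LINT (t, x)|lebesgue_on (I \<times> UNIV).
           E' (u (t, x)) * of_real (divx f (t, x, u (t, x))) * \<phi> (t, x))
      + (LINT (t, x)|lebesgue_on (I \<times> UNIV). divx F (t, x, u (t, x)) * \<phi> (t, x))
      + (LINT (t, x)|lebesgue_on (I \<times> UNIV).
           E' (u (t, x)) * of_real (g (t, x, u (t, x))) * \<phi> (t, x))
      + (LINT x|lebesgue. E (uo x) * \<phi> (0, x)))"


section \<open>Tempered distributions on the real line\<close>

definition higher_vderiv :: "nat \<Rightarrow> (real \<Rightarrow> complex) \<Rightarrow> real \<Rightarrow> complex" where
  "higher_vderiv k = ((\<lambda>h x. vector_derivative h (at x)) ^^ k)"

definition schwartz :: "(real \<Rightarrow> complex) set" where
  "schwartz = {\<phi>. (\<forall>k. C_k_on k UNIV \<phi>) \<and>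
     (\<forall>j k. bounded (range (\<lambda>x. of_real (x ^ j) * higher_vderiv k \<phi> x)))}"

definition schwartz_seminorm :: "nat \<Rightarrow> nat \<Rightarrow> (real \<Rightarrow> complex) \<Rightarrow> real" where
  "schwartz_seminorm j k \<phi> = (SUP x. norm (of_real (x ^ j) * higher_vderiv k \<phi> x))"

text \<open>
  Functionals are total on \<open>real \<Rightarrow> complex\<close>, but only their values on \<^const>\<open>schwartz\<close> matter.
  The third conjunct is continuity for the topology generated by the Schwartz seminorms.
\<close>

definition tempered_distribution :: "((real \<Rightarrow> complex) \<Rightarrow> complex) \<Rightarrow> bool" where
  "tempered_distribution \<Lambda> \<longleftrightarrow>
     (\<forall>\<phi>\<in>schwartz. \<forall>\<psi>\<in>schwartz. \<Lambda> (\<lambda>x. \<phi> x + \<psi> x) = \<Lambda> \<phi> + \<Lambda> \<psi>) \<and>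
     (\<forall>c. \<forall>\<phi>\<in>schwartz. \<Lambda> (\<lambda>x. c * \<phi> x) = c * \<Lambda> \<phi>) \<and>
     (\<forall>\<phi>\<in>schwartz. \<forall>\<epsilon>>0. \<exists>N. \<exists>\<delta>>0. \<forall>\<psi>\<in>schwartz.
        (\<forall>j\<le>N. \<forall>k\<le>N. schwartz_seminorm j k (\<lambda>x. \<psi> x - \<phi> x) < \<delta>) \<longrightarrow> norm (\<Lambda> \<psi> - \<Lambda> \<phi>) < \<epsilon>)"

text \<open>
  The locally integrable function \<open>h\<close>, regarded as a distribution on \<open>\<real>\<close>, extends to the
  tempered distribution \<open>\<Lambda>\<close>. Such an extension is unique on \<^const>\<open>schwartz\<close> by density of the
  test functions. Note that \<open>h\<close> need not have polynomial growth.
\<close>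

definition represents_tempered ::
  "(real \<Rightarrow> real) \<Rightarrow> ((real \<Rightarrow> complex) \<Rightarrow> complex) \<Rightarrow> bool" where
  "represents_tempered h \<Lambda> \<longleftrightarrow> tempered_distribution \<Lambda> \<and>
     (\<forall>\<phi>\<in>test_functions UNIV. \<Lambda> \<phi> = (LINT x|lebesgue. of_real (h x) * \<phi> x))"

definition fourier :: "(real \<Rightarrow> complex) \<Rightarrow> real \<Rightarrow> complex" where
  "fourier \<phi> \<xi> = (LINT x|lebesgue. cis (- (\<xi> * x)) * \<phi> x)"

definition fourier_distr ::
  "((real \<Rightarrow> complex) \<Rightarrow> complex) \<Rightarrow> (real \<Rightarrow> complex) \<Rightarrow> complex" where
  "fourier_distr \<Lambda> \<phi> = \<Lambda> (fourier \<phi>)"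

definition distr_support :: "((real \<Rightarrow> complex) \<Rightarrow> complex) \<Rightarrow> real set" where
  "distr_support \<Lambda> = - \<Union>{U. open U \<and>
     (\<forall>\<phi>\<in>test_functions UNIV. closure (support_on UNIV \<phi>) \<subseteq> U \<longrightarrow> \<Lambda> \<phi> = 0)}"

end

theory Submission
  imports Defs "HOL-Complex_Analysis.Cauchy_Integral_Formula"
begin

text \<open>
  Fix a test function \<open>\<phi>\<close> and let \<open>R\<close> bound the two solutions and the two data.

  The entropy \<open>H\<close> enters its production through \<open>H' = e\<close> on \<open>[-R, R]\<close>, up to a term that is
  the same for both solutions. Indeed \<open>H u = H 0 + \<integral>\<^sub>0\<^sup>u e\<close>, and every entropy flux satisfies
  \<open>F (t, x, u) = F (t, x, 0) + \<integral>\<^sub>0\<^sup>u e w \<partial>\<^sub>u f (t, x, w) dw\<close>; the divergence of \<open>F\<close> has the same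
  form. Hence the production at \<open>\<phi>\<close> is \<open>c H + L e\<close>, where \<open>c H\<close> involves \<open>H 0\<close> and
  \<open>F (\<sqdot>, 0)\<close> but not the solution, and where \<open>L\<close> is a linear functional, continuous for the
  supremum norm on \<open>[-R, R]\<close> (lemma \<open>entropy_production_representation\<close>). In the difference of
  the two productions \<open>c H\<close> cancels, and the theorem becomes a statement on one functional \<open>L\<close>,
  the difference of the two: if \<open>L\<close> annihilates all translates of \<open>E'\<close>, then \<open>L = 0\<close>
  (lemma \<open>translates_annihilated_imp_zero\<close>).

  That statement is Fourier analysis. Think of \<open>L\<close> as a complex measure on \<open>[-R, R]\<close>. Its symbol
  \<open>N \<xi> = L (\<lambda>w. exp (\<i> \<xi> w))\<close> is the restriction to the real line of an entire function.
  Differentiation in the translation parameter shows that \<open>L\<close> annihilates the translates of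
  \<open>E''\<close> too; this is a convolution equation, whose Fourier transform says that \<open>N\<close> times the
  transform of \<open>E''\<close> is zero. So \<open>N\<close> vanishes on the support of that transform
  (lemma \<open>symbol_zero_on_support\<close>). At a cluster point of the support all Taylor coefficients of
  \<open>N\<close> vanish, that is, \<open>L\<close> annihilates all \<open>w\<^sup>n exp (\<i> \<xi> w)\<close>; by the Weierstrass theorem these
  span a dense subspace of the continuous functions on \<open>[-R, R]\<close>, so \<open>L = 0\<close>
  (lemma \<open>C0_functional_vanishes\<close>).

  Two points need work. First, \<open>E''\<close> may grow faster than every polynomial, so the tempered
  distribution that extends it is an integral on compactly supported functions only. A test
  function \<open>\<psi>\<close> supported where \<open>N \<noteq> 0\<close> has as Fourier transform the convolution of \<open>L\<close> with
  the transform of \<open>\<psi> / N\<close>; that transform is approximated by compactly supported functions in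
  the Schwartz topology (lemma \<open>tempered_vanishes_on_conv\<close>). Second, the production is defined
  through a chosen entropy flux, so a flux must exist for every \<open>C\<^sup>1\<close> entropy. The integral
  formula gives one; its continuous differentiability comes from continuous partial derivatives
  (lemmas \<open>C_k_on_1_box\<close> and \<open>flux_of_F_class\<close>).
\<close>

section \<open>Functionals on continuous functions over an interval\<close>

text \<open>
  The complex measures on \<open>[-R, R]\<close>, seen as functionals on continuous functions on the whole
  line. With functions on the line, translates need no extension or restriction.
\<close>

definition C0_functional :: "real \<Rightarrow> ((real \<Rightarrow> complex) \<Rightarrow> complex) \<Rightarrow> bool" where
  "C0_functional R L \<longleftrightarrow>
     (\<forall>e1 e2. continuous_on UNIV e1 \<longrightarrow> continuous_on UNIV e2 \<longrightarrow>
        L (\<lambda>w. e1 w + e2 w) = L e1 + L e2) \<and>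
     (\<forall>c e. continuous_on UNIV e \<longrightarrow> L (\<lambda>w. c * e w) = c * L e) \<and>
     (\<exists>C\<ge>0. \<forall>e B. continuous_on UNIV e \<longrightarrow> (\<forall>w\<in>{-R..R}. norm (e w) \<le> B) \<longrightarrow> norm (L e) \<le> C * B)"

lemma C0_functionalI:
  assumes "\<And>e1 e2. continuous_on UNIV e1 \<Longrightarrow> continuous_on UNIV e2 \<Longrightarrow>
      L (\<lambda>w. e1 w + e2 w) = L e1 + L e2"
    and "\<And>c e. continuous_on UNIV e \<Longrightarrow> L (\<lambda>w. c * e w) = c * L e"
    and "C \<ge> 0"
    and "\<And>e B. continuous_on UNIV e \<Longrightarrow> (\<And>w. w \<in> {-R..R} \<Longrightarrow> norm (e w) \<le> B) \<Longrightarrow>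
      norm (L e) \<le> C * B"
  shows "C0_functional R L"
  unfolding C0_functional_def
proof (intro conjI allI impI exI[of _ C])
  fix e :: "real \<Rightarrow> complex" and B assume "continuous_on UNIV e" "\<forall>w\<in>{-R..R}. norm (e w) \<le> B"
  then show "norm (L e) \<le> C * B" using assms(4) by blast
qed (use assms in simp_all)

lemma C0_functional_add:
  assumes "C0_functional R L" "continuous_on UNIV e1" "continuous_on UNIV e2"
  shows "L (\<lambda>w. e1 w + e2 w) = L e1 + L e2"
  using assms unfolding C0_functional_def by blast

lemma C0_functional_scale:
  assumes "C0_functional R L" "continuous_on UNIV e"
  shows "L (\<lambda>w. c * e w) = c * L e"
  using assms unfolding C0_functional_def by blast

lemma C0_functional_bound:
  assumes "C0_functional R L"
  obtains C where "C \<ge> 0"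
    "\<And>e B. continuous_on UNIV e \<Longrightarrow> (\<And>w. w \<in> {-R..R} \<Longrightarrow> norm (e w) \<le> B) \<Longrightarrow> norm (L e) \<le> C * B"
proof -
  have "\<exists>C\<ge>0. \<forall>e B. continuous_on UNIV e \<longrightarrow> (\<forall>w\<in>{-R..R}. norm (e w) \<le> B) \<longrightarrow> norm (L e) \<le> C * B"
    using assms by (simp add: C0_functional_def)
  then obtain C where "C \<ge> 0" and
    C: "\<forall>e B. continuous_on UNIV e \<longrightarrow> (\<forall>w\<in>{-R..R}. norm (e w) \<le> B) \<longrightarrow> norm (L e) \<le> C * B"
    by (elim exE conjE)
  show ?thesis
    by (rule that[OF \<open>C \<ge> 0\<close>]) (use C in simp)
qed

lemma C0_functional_zero:
  assumes "C0_functional R L"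
  shows "L (\<lambda>w. 0) = 0"
  using C0_functional_scale[OF assms, of "\<lambda>w. 0" 0] by simp

lemma C0_functional_diff:
  assumes "C0_functional R L" "continuous_on UNIV e1" "continuous_on UNIV e2"
  shows "L (\<lambda>w. e1 w - e2 w) = L e1 - L e2"
  using C0_functional_add[OF assms(1,2), of "\<lambda>w. - 1 * e2 w"] C0_functional_scale[OF assms(1,3), of "- 1"] assms(3)
  by (simp add: continuous_on_minus)

lemma C0_functional_sum:
  assumes "C0_functional R L" "finite A" "\<And>i. i \<in> A \<Longrightarrow> continuous_on UNIV (e i)"
  shows "L (\<lambda>w. \<Sum>i\<in>A. e i w) = (\<Sum>i\<in>A. L (e i))"
  using assms(2,3)
proof (induction A rule: finite_induct)
  case empty
  then show ?case using C0_functional_zero[OF assms(1)] by simp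
next
  case (insert i A)
  then show ?case
    using C0_functional_add[OF assms(1), of "e i" "\<lambda>w. \<Sum>i\<in>A. e i w"]
    by (simp add: continuous_on_sum)
qed

text \<open>
  The estimate with bound \<open>0\<close> for the difference: the functional sees a function on
  \<open>[-R, R]\<close> only.
\<close>

lemma C0_functional_cong:
  assumes "C0_functional R L" "continuous_on UNIV e1" "continuous_on UNIV e2"
    and "\<And>w. w \<in> {-R..R} \<Longrightarrow> e1 w = e2 w"
  shows "L e1 = L e2"
proof -
  obtain C where C: "C \<ge> 0"
    "\<And>e B. continuous_on UNIV e \<Longrightarrow> (\<And>w. w \<in> {-R..R} \<Longrightarrow> norm (e w) \<le> B) \<Longrightarrow> norm (L e) \<le> C * B"
    using C0_functional_bound[OF assms(1)] by metis
  have "norm (L (\<lambda>w. e1 w - e2 w)) \<le> C * 0"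
    by (rule C(2)) (use assms(2-4) in \<open>simp_all add: continuous_on_diff\<close>)
  then show ?thesis using C0_functional_diff[OF assms(1-3)] by simp
qed

lemma C0_functional_plus_functional:
  assumes "C0_functional R L1" "C0_functional R L2"
  shows "C0_functional R (\<lambda>e. L1 e + L2 e)"
proof -
  obtain C where C: "C \<ge> 0"
    "\<And>e B. continuous_on UNIV e \<Longrightarrow> (\<And>w. w \<in> {-R..R} \<Longrightarrow> norm (e w) \<le> B) \<Longrightarrow> norm (L1 e) \<le> C * B"
    using C0_functional_bound[OF assms(1)] by metis
  obtain D where D: "D \<ge> 0"
    "\<And>e B. continuous_on UNIV e \<Longrightarrow> (\<And>w. w \<in> {-R..R} \<Longrightarrow> norm (e w) \<le> B) \<Longrightarrow> norm (L2 e) \<le> D * B"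
    using C0_functional_bound[OF assms(2)] by metis
  show ?thesis
  proof (rule C0_functionalI[where C = "C + D"])
    fix e :: "real \<Rightarrow> complex" and B assume *: "continuous_on UNIV e" "\<And>w. w \<in> {-R..R} \<Longrightarrow> norm (e w) \<le> B"
    have "norm (L1 e) \<le> C * B" "norm (L2 e) \<le> D * B"
      by (rule C(2) D(2); fact)+
    then show "norm (L1 e + L2 e) \<le> (C + D) * B"
      using norm_triangle_ineq[of "L1 e" "L2 e"] by (simp add: distrib_right)
  next
    fix e1 e2 :: "real \<Rightarrow> complex" assume that: "continuous_on UNIV e1" "continuous_on UNIV e2"
    show "L1 (\<lambda>w. e1 w + e2 w) + L2 (\<lambda>w. e1 w + e2 w) = L1 e1 + L2 e1 + (L1 e2 + L2 e2)"
      using C0_functional_add[OF assms(1) that] C0_functional_add[OF assms(2) that] by simp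
  next
    fix c and e :: "real \<Rightarrow> complex" assume that: "continuous_on UNIV e"
    show "L1 (\<lambda>w. c * e w) + L2 (\<lambda>w. c * e w) = c * (L1 e + L2 e)"
      using C0_functional_scale[OF assms(1) that] C0_functional_scale[OF assms(2) that]
      by (simp add: distrib_left)
  qed (use C D in auto)
qed

lemma C0_functional_uminus_functional:
  assumes "C0_functional R L"
  shows "C0_functional R (\<lambda>e. - L e)"
proof -
  obtain C where C: "C \<ge> 0"
    "\<And>e B. continuous_on UNIV e \<Longrightarrow> (\<And>w. w \<in> {-R..R} \<Longrightarrow> norm (e w) \<le> B) \<Longrightarrow> norm (L e) \<le> C * B"
    using C0_functional_bound[OF assms(1)] by metis
  show ?thesis
    by (rule C0_functionalI[where C = C])
       (use C C0_functional_add[OF assms] C0_functional_scale[OF assms] in simp_all)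
qed

lemma C0_functional_tendsto:
  assumes L: "C0_functional R L" and cont: "\<And>n. continuous_on UNIV (e n)" "continuous_on UNIV e'"
    and lim: "uniform_limit {-R..R} e e' F"
  shows "((\<lambda>n. L (e n)) \<longlongrightarrow> L e') F"
proof (rule tendstoI)
  fix \<epsilon> :: real assume "\<epsilon> > 0"
  obtain C where C: "C \<ge> 0"
    "\<And>e B. continuous_on UNIV e \<Longrightarrow> (\<And>w. w \<in> {-R..R} \<Longrightarrow> norm (e w) \<le> B) \<Longrightarrow> norm (L e) \<le> C * B"
    using C0_functional_bound[OF L] by metis
  define d where "d = \<epsilon> / (C + 1)"
  have d: "d > 0" "C * d < \<epsilon>"
    using \<open>\<epsilon> > 0\<close> C(1) by (auto simp: d_def field_simps)
  show "\<forall>\<^sub>F n in F. dist (L (e n)) (L e') < \<epsilon>"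
    using uniform_limitD[OF lim d(1)]
  proof eventually_elim
    case (elim n)
    have "norm (L (\<lambda>w. e n w - e' w)) \<le> C * d"
      by (rule C(2)) (use elim in \<open>auto intro!: continuous_intros cont simp: dist_norm less_imp_le\<close>)
    then show ?case
      using C0_functional_diff[OF L cont(1)[of n] cont(2)] d(2) by (simp add: dist_norm)
  qed
qed

text \<open>
  Differentiation under the functional: \<open>h'\<close> is uniformly continuous on compact sets, so the
  mean value inequality makes the difference quotients converge uniformly on \<open>[-R, R]\<close>.
\<close>

lemma C0_functional_has_vector_derivative:
  fixes h h' :: "real \<Rightarrow> real \<Rightarrow> complex"
  assumes L: "C0_functional R L" and X: "convex X" "x \<in> X"
    and conth: "\<And>y. y \<in> X \<Longrightarrow> continuous_on UNIV (h y)"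
    and der: "\<And>y w. y \<in> X \<Longrightarrow> ((\<lambda>y. h y w) has_vector_derivative h' y w) (at y within X)"
    and cont: "continuous_on (X \<times> UNIV) (\<lambda>(y, w). h' y w)"
  shows "((\<lambda>y. L (h y)) has_vector_derivative L (h' x)) (at x within X)"
proof -
  obtain C where C: "C \<ge> 0"
    "\<And>e B. continuous_on UNIV e \<Longrightarrow> (\<And>w. w \<in> {-R..R} \<Longrightarrow> norm (e w) \<le> B) \<Longrightarrow> norm (L e) \<le> C * B"
    using C0_functional_bound[OF L] by metis
  have conth': "continuous_on UNIV (h' x)"
    using continuous_on_compose2[OF cont continuous_on_Pair[OF continuous_on_const[of _ x] continuous_on_id], where s = UNIV] X
    by auto
  have "\<exists>d>0. \<forall>y\<in>X. norm (y - x) < d \<longrightarrow>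
      norm (L (h y) - L (h x) - (y - x) *\<^sub>R L (h' x)) \<le> \<epsilon> * norm (y - x)" if "\<epsilon> > 0" for \<epsilon>
  proof -
    define c where "c = \<epsilon> / (C + 1)"
    have c: "c > 0" "C * c \<le> \<epsilon>"
      using \<open>\<epsilon> > 0\<close> C(1) by (auto simp: c_def field_simps)
    have "continuous_on (X \<times> {-R..R}) (\<lambda>(y, w). h' y w)"
      by (rule continuous_on_subset[OF cont]) auto
    from continuous_on_prod_compactE[OF this compact_Icc X(2) c(1)]
    obtain X0 where X0: "x \<in> X0" "open X0"
      "\<forall>y\<in>X0 \<inter> X. \<forall>w\<in>{-R..R}. dist (h' y w) (h' x w) \<le> c" by auto
    then obtain d where d: "d > 0" "ball x d \<subseteq> X0" using openE by blast
    have "norm (L (h y) - L (h x) - (y - x) *\<^sub>R L (h' x)) \<le> \<epsilon> * norm (y - x)"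
      if y: "y \<in> X" "norm (y - x) < d" for y
    proof -
      let ?e = "\<lambda>w. (h y w - h x w) - of_real (y - x) * h' x w"
      have "norm (?e w) \<le> c * norm (y - x)" if w: "w \<in> {-R..R}" for w
      proof -
        have "norm (h y w - h x w - (y - x) *\<^sub>R h' x w) \<le> norm (y - x) * c"
        proof (rule vector_differentiable_bound_linearization
              [where S = "X \<inter> ball x d" and f' = "\<lambda>z. h' z w" and ?x0.0 = x])
          show "closed_segment x y \<subseteq> X \<inter> ball x d"
            by (rule closed_segment_subset) (use X y d in \<open>auto simp: dist_norm norm_minus_commute intro: convex_Int\<close>)
          show "((\<lambda>y. h y w) has_vector_derivative h' z w) (at z within X \<inter> ball x d)"
            if "z \<in> X \<inter> ball x d" for z
            using der[of z w] that by (auto intro: has_vector_derivative_within_subset)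
          show "norm (h' z w - h' x w) \<le> c" if "z \<in> X \<inter> ball x d" for z
            using X0(3) d(2) that w by (auto simp: dist_norm)
          show "x \<in> X \<inter> ball x d" using X d by auto
        qed
        then show ?thesis by (simp add: scaleR_conv_of_real mult.commute)
      qed
      then have "norm (L ?e) \<le> C * (c * norm (y - x))"
        by (intro C(2)) (auto intro!: continuous_intros conth conth' y X)
      also have "\<dots> \<le> \<epsilon> * norm (y - x)"
        using c(2) by (simp add: mult_right_mono flip: mult.assoc)
      also have "L ?e = L (\<lambda>w. h y w - h x w) - L (\<lambda>w. of_real (y - x) * h' x w)"
        by (rule C0_functional_diff[OF L]) (auto intro!: continuous_intros conth conth' y X)
      also have "L (\<lambda>w. h y w - h x w) = L (h y) - L (h x)"
        by (rule C0_functional_diff[OF L]) (auto intro!: conth y X)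
      also have "L (\<lambda>w. of_real (y - x) * h' x w) = of_real (y - x) * L (h' x)"
        by (rule C0_functional_scale[OF L conth'])
      finally show ?thesis by (simp add: scaleR_conv_of_real)
    qed
    then show ?thesis using d(1) by blast
  qed
  then show ?thesis
    unfolding has_vector_derivative_def has_derivative_within_alt
    by (auto intro: bounded_linear_scaleR_left)
qed

text \<open>
  A form of Fubini's theorem, reduced to differentiation under the functional: both sides have the
  same derivative in the upper limit of integration.
\<close>

lemma C0_functional_integral:
  fixes h :: "real \<Rightarrow> real \<Rightarrow> complex"
  assumes L: "C0_functional R L" and "a \<le> b"
    and cont: "continuous_on ({a..b} \<times> UNIV) (\<lambda>(y, w). h y w)"
  shows "((\<lambda>y. L (h y)) has_integral L (\<lambda>w. integral {a..b} (\<lambda>y. h y w))) {a..b}"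
proof -
  define J where "J y w = integral {a..y} (\<lambda>s. h s w)" for y w
  have conty: "continuous_on {a..b} (\<lambda>y. h y w)" for w
    using continuous_on_compose2[OF cont continuous_on_Pair[OF continuous_on_id continuous_on_const[of _ w]], where s = "{a..b}"]
    by auto
  have swap: "continuous_on (UNIV \<times> cbox a y) (\<lambda>(w, y). h y w)" if "y \<in> {a..b}" for y
    using continuous_on_compose2[OF cont continuous_on_swap[of "UNIV \<times> cbox a y"]] that
    by (force simp: case_prod_beta')
  have contJ: "continuous_on UNIV (J y)" if "y \<in> {a..b}" for y
    unfolding J_def using integral_continuous_on_param[OF swap[OF that]] by simp
  have "((\<lambda>y. L (J y)) has_vector_derivative L (h x)) (at x within {a..b})" if "x \<in> {a..b}" for x
    by (rule C0_functional_has_vector_derivative[OF L _ that contJ _ cont])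
       (auto simp: J_def intro!: integral_has_vector_derivative conty)
  then have "((\<lambda>y. L (h y)) has_integral L (J b) - L (J a)) {a..b}"
    by (intro fundamental_theorem_of_calculus) (use \<open>a \<le> b\<close> in auto)
  moreover have "L (J a) = 0"
    using C0_functional_zero[OF L] by (simp add: J_def[abs_def])
  ultimately show ?thesis by (simp add: J_def[abs_def])
qed

section \<open>Smooth functions of one real variable\<close>

lemma continuous_on_vector_derivative:
  assumes "\<And>x. (h has_vector_derivative h' x) (at x)"
  shows "continuous_on UNIV h"
  by (intro continuous_at_imp_continuous_on ballI has_vector_derivative_continuous[OF assms])

lemma C_k_on_scaleR:
  fixes h :: "'a::euclidean_space \<Rightarrow> 'b::real_normed_vector"
  assumes "C_k_on k S h"
  shows "C_k_on k S (\<lambda>z. c *\<^sub>R h z)"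
  using assms
proof (induction k arbitrary: h)
  case 0
  then show ?case by (auto intro: continuous_intros)
next
  case (Suc k)
  then obtain h' where h': "\<forall>z\<in>S. (h has_derivative h' z) (at z within S)"
    "\<forall>v. C_k_on k S (\<lambda>z. h' z v)" by auto
  have "\<forall>z\<in>S. ((\<lambda>z. c *\<^sub>R h z) has_derivative (\<lambda>v. c *\<^sub>R h' z v)) (at z within S)"
    using h'(1) by (auto intro: has_derivative_scaleR_right)
  moreover have "\<forall>v. C_k_on k S (\<lambda>z. c *\<^sub>R h' z v)" using Suc.IH h'(2) by blast
  ultimately show ?case by auto
qed

text \<open>
  On the line the Frechet derivative is multiplication by a vector, so \<^const>\<open>C_k_on\<close> reduces to a
  recursion on the derivative as a function.
\<close>

lemma C_k_on_Suc_real: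
  fixes h :: "real \<Rightarrow> 'b::real_normed_vector"
  shows "C_k_on (Suc k) UNIV h \<longleftrightarrow>
    (\<exists>h'. (\<forall>x. (h has_vector_derivative h' x) (at x)) \<and> C_k_on k UNIV h')" (is "?l \<longleftrightarrow> ?r")
proof
  assume ?l
  then obtain h' where h': "\<And>x. (h has_derivative h' x) (at x)" "\<And>v. C_k_on k UNIV (\<lambda>z. h' z v)"
    by auto
  have "(h has_vector_derivative h' x 1) (at x)" for x
  proof -
    have "h' x v = v *\<^sub>R h' x 1" for v
      using linear_cmul[OF has_derivative_linear[OF h'(1)], of x v 1] by simp
    then have "h' x = (\<lambda>v. v *\<^sub>R h' x 1)" by blast
    then show ?thesis
      unfolding has_vector_derivative_def using h'(1)[of x] by simp
  qed
  with h'(2)[of 1] show ?r by (intro exI[of _ "\<lambda>x. h' x 1"]) simp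
next
  assume ?r
  then obtain h' where h': "\<And>x. (h has_vector_derivative h' x) (at x)" "C_k_on k UNIV h'"
    by blast
  then show ?l
    by (auto simp: has_vector_derivative_def intro!: exI[of _ "\<lambda>x v. v *\<^sub>R h' x"] C_k_on_scaleR)
qed

lemma C_k_on_Suc_realI:
  fixes h :: "real \<Rightarrow> 'b::real_normed_vector"
  assumes "\<And>x. (h has_vector_derivative h' x) (at x)" "C_k_on k UNIV h'"
  shows "C_k_on (Suc k) UNIV h"
  unfolding C_k_on_Suc_real using assms by (intro exI[of _ h'] conjI allI)

lemma C_k_on_Suc_real_deriv:
  fixes h :: "real \<Rightarrow> 'b::real_normed_vector"
  assumes "C_k_on (Suc k) UNIV h"
  shows "(h has_vector_derivative vector_derivative h (at x)) (at x)"
    "C_k_on k UNIV (\<lambda>x. vector_derivative h (at x))"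
proof -
  obtain h' where h': "\<And>x. (h has_vector_derivative h' x) (at x)" "C_k_on k UNIV h'"
    using assms unfolding C_k_on_Suc_real by blast
  have "vector_derivative h (at x) = h' x" for x
    using h'(1) by (rule vector_derivative_at)
  then show "(h has_vector_derivative vector_derivative h (at x)) (at x)"
    "C_k_on k UNIV (\<lambda>x. vector_derivative h (at x))"
    using h' by simp_all
qed

lemma C_k_on_real_SucD:
  fixes h :: "real \<Rightarrow> 'b::real_normed_vector"
  shows "C_k_on (Suc k) UNIV h \<Longrightarrow> C_k_on k UNIV h"
proof (induction k arbitrary: h)
  case 0
  then show ?case
    using continuous_on_vector_derivative[OF C_k_on_Suc_real_deriv(1)[OF 0]] by simp
next
  case (Suc k)
  show ?case
    using C_k_on_Suc_real_deriv(1)[OF Suc.prems] Suc.IH[OF C_k_on_Suc_real_deriv(2)[OF Suc.prems]]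
    by (rule C_k_on_Suc_realI)
qed

lemma C_k_on_const_real: "C_k_on k UNIV (\<lambda>x::real. c)"
proof (induction k arbitrary: c)
  case (Suc k)
  then show ?case
    by (intro C_k_on_Suc_realI[OF has_vector_derivative_const])
qed simp

lemma C_k_on_add_real:
  fixes g h :: "real \<Rightarrow> 'b::real_normed_vector"
  shows "C_k_on k UNIV g \<Longrightarrow> C_k_on k UNIV h \<Longrightarrow> C_k_on k UNIV (\<lambda>x. g x + h x)"
proof (induction k arbitrary: g h)
  case 0
  then show ?case by (auto intro: continuous_intros)
next
  case (Suc k)
  note g = C_k_on_Suc_real_deriv[OF Suc.prems(1)] and h = C_k_on_Suc_real_deriv[OF Suc.prems(2)]
  show ?case
    by (rule C_k_on_Suc_realI[OF has_vector_derivative_add[OF g(1) h(1)] Suc.IH[OF g(2) h(2)]])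
qed

lemma C_k_on_mult_real:
  fixes g h :: "real \<Rightarrow> 'b::real_normed_algebra"
  shows "C_k_on k UNIV g \<Longrightarrow> C_k_on k UNIV h \<Longrightarrow> C_k_on k UNIV (\<lambda>x. g x * h x)"
proof (induction k arbitrary: g h)
  case 0
  then show ?case by (auto intro: continuous_intros)
next
  case (Suc k)
  note g = C_k_on_Suc_real_deriv[OF Suc.prems(1)] and h = C_k_on_Suc_real_deriv[OF Suc.prems(2)]
  have "C_k_on k UNIV (\<lambda>x. g x * vector_derivative h (at x) + vector_derivative g (at x) * h x)"
    using Suc.prems[THEN C_k_on_real_SucD] g(2) h(2) by (intro C_k_on_add_real Suc.IH)
  then show ?case
    by (rule C_k_on_Suc_realI[OF has_vector_derivative_mult[OF g(1) h(1)]])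
qed

definition smooth :: "(real \<Rightarrow> complex) \<Rightarrow> bool" where
  "smooth h \<longleftrightarrow> (\<forall>k. C_k_on k UNIV h)"

text \<open>
  Smoothness is coinductive: a class of functions whose derivatives exist and stay in the class
  consists of smooth functions. This spares an induction on the order for transforms and
  convolutions.
\<close>

lemma smooth_coinduct [consumes 1, case_names deriv]:
  assumes "P h" and "\<And>h. P h \<Longrightarrow> \<exists>h'. (\<forall>x. (h has_vector_derivative h' x) (at x)) \<and> P h'"
  shows "smooth h"
proof -
  have "C_k_on k UNIV h" if "P h" for k h
    using that
  proof (induction k arbitrary: h)
    case 0
    then obtain h' where "\<And>x. (h has_vector_derivative h' x) (at x)"
      using assms(2)[OF 0] by blast
    from continuous_on_vector_derivative[OF this] show ?case by simp
  next
    case (Suc k)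
    obtain h' where "\<And>x. (h has_vector_derivative h' x) (at x)" "P h'"
      using assms(2)[OF Suc.prems] by blast
    then show ?case using Suc.IH by (intro C_k_on_Suc_realI)
  qed
  then show ?thesis using assms(1) by (simp add: smooth_def)
qed

lemma smooth_deriv:
  assumes "smooth h"
  shows "(h has_vector_derivative vector_derivative h (at x)) (at x)"
    "smooth (\<lambda>x. vector_derivative h (at x))"
  using C_k_on_Suc_real_deriv[of _ h] assms unfolding smooth_def by metis+

lemma smooth_continuous: "smooth h \<Longrightarrow> continuous_on S h"
  using continuous_on_subset[of UNIV h S] by (auto simp: smooth_def dest: spec[of _ 0])

lemma smooth_mult: "smooth g \<Longrightarrow> smooth h \<Longrightarrow> smooth (\<lambda>x. g x * h x)"
  by (simp add: smooth_def C_k_on_mult_real)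

lemma smooth_add: "smooth g \<Longrightarrow> smooth h \<Longrightarrow> smooth (\<lambda>x. g x + h x)"
  by (simp add: smooth_def C_k_on_add_real)

lemma smooth_const: "smooth (\<lambda>x. c)"
  by (simp add: smooth_def C_k_on_const_real)

lemma smooth_cmult: "smooth h \<Longrightarrow> smooth (\<lambda>x. c * h x)"
  by (intro smooth_mult smooth_const)

lemma smooth_diff: "smooth g \<Longrightarrow> smooth h \<Longrightarrow> smooth (\<lambda>x. g x - h x)"
  using smooth_add[of g "\<lambda>x. -1 * h x"] smooth_cmult[of h "-1"] by simp

lemma smooth_affine:
  assumes "smooth h"
  shows "smooth (\<lambda>x. h (s * x + a))"
proof -
  have "\<exists>c g. smooth g \<and> (\<lambda>x. h (s * x + a)) = (\<lambda>x. c * g (s * x + a))"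
    using assms by (intro exI[of _ 1] exI[of _ h]) simp
  then show ?thesis
  proof (rule smooth_coinduct)
    fix k :: "real \<Rightarrow> complex"
    assume "\<exists>c g. smooth g \<and> k = (\<lambda>x. c * g (s * x + a))"
    then obtain c g where g: "smooth g" "k = (\<lambda>x. c * g (s * x + a))" by blast
    let ?g' = "\<lambda>x. vector_derivative g (at x)"
    have "((\<lambda>x. c * g (s * x + a)) has_vector_derivative (c * s) * ?g' (s * x + a)) (at x)" for x
    proof -
      have "((\<lambda>x. s * x + a) has_vector_derivative s) (at x)"
        by (auto intro!: derivative_eq_intros)
      from vector_diff_chain_at[OF this smooth_deriv(1)[OF g(1)]]
      have "((\<lambda>x. g (s * x + a)) has_vector_derivative s *\<^sub>R ?g' (s * x + a)) (at x)"
        by (simp add: o_def)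
      from has_vector_derivative_mult_right[OF this, of c] show ?thesis
        by (simp add: scaleR_conv_of_real mult_ac)
    qed
    then show "\<exists>h'. (\<forall>x. (k has_vector_derivative h' x) (at x)) \<and>
        (\<exists>c g. smooth g \<and> h' = (\<lambda>x. c * g (s * x + a)))"
      using smooth_deriv(2)[OF g(1)] unfolding g(2)
      by (intro exI[of _ "\<lambda>x. (c * s) * ?g' (s * x + a)"] conjI exI[of _ "c * s"] exI[of _ ?g']) auto
  qed
qed

lemma higher_vderiv_0 [simp]: "higher_vderiv 0 h = h"
  by (simp add: higher_vderiv_def)

lemma higher_vderiv_Suc: "higher_vderiv (Suc k) h = (\<lambda>x. vector_derivative (higher_vderiv k h) (at x))"
  by (simp add: higher_vderiv_def)

lemma higher_vderiv_Suc': "higher_vderiv (Suc k) h = higher_vderiv k (\<lambda>x. vector_derivative h (at x))"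
  unfolding higher_vderiv_def funpow_Suc_right o_def ..

lemma higher_vderiv_Suc_eq:
  assumes "\<And>x. (h has_vector_derivative h' x) (at x)"
  shows "higher_vderiv (Suc k) h = higher_vderiv k h'"
  using assms[THEN vector_derivative_at] by (simp add: higher_vderiv_Suc')

lemma smooth_higher_vderiv: "smooth h \<Longrightarrow> smooth (higher_vderiv k h)"
  by (induction k) (auto simp: higher_vderiv_Suc smooth_deriv)

lemma higher_vderiv_has_vector_derivative:
  assumes "smooth h"
  shows "(higher_vderiv k h has_vector_derivative higher_vderiv (Suc k) h x) (at x)"
  using smooth_deriv(1)[OF smooth_higher_vderiv[OF assms]] by (simp add: higher_vderiv_Suc)

lemma higher_vderiv_add:
  assumes "smooth g" "smooth h"
  shows "higher_vderiv k (\<lambda>x. g x + h x) = (\<lambda>x. higher_vderiv k g x + higher_vderiv k h x)"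
proof (induction k)
  case (Suc k)
  have "((\<lambda>x. higher_vderiv k g x + higher_vderiv k h x) has_vector_derivative
      higher_vderiv (Suc k) g x + higher_vderiv (Suc k) h x) (at x)" for x
    by (intro has_vector_derivative_add higher_vderiv_has_vector_derivative assms)
  from vector_derivative_at[OF this] show ?case
    by (simp add: higher_vderiv_Suc[of k "\<lambda>x. g x + h x"] Suc)
qed simp

lemma higher_vderiv_cmult:
  assumes "smooth h"
  shows "higher_vderiv k (\<lambda>x. c * h x) = (\<lambda>x. c * higher_vderiv k h x)"
proof (induction k)
  case (Suc k)
  have "((\<lambda>x. c * higher_vderiv k h x) has_vector_derivative c * higher_vderiv (Suc k) h x) (at x)" for x
    by (intro has_vector_derivative_mult_right higher_vderiv_has_vector_derivative assms)
  from vector_derivative_at[OF this] show ?case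
    by (simp add: higher_vderiv_Suc[of k "\<lambda>x. c * h x"] Suc)
qed simp

lemma test_functions_real_iff:
  fixes \<psi> :: "real \<Rightarrow> complex"
  shows "\<psi> \<in> test_functions UNIV \<longleftrightarrow> smooth \<psi> \<and> (\<exists>a. \<forall>x. \<bar>x\<bar> \<ge> a \<longrightarrow> \<psi> x = 0)"
proof
  assume "\<psi> \<in> test_functions UNIV"
  then have *: "smooth \<psi>" "compact (closure (support_on UNIV \<psi>))"
    by (auto simp: test_functions_def Cc_k_def smooth_def)
  then obtain a where a: "\<forall>x\<in>closure (support_on UNIV \<psi>). norm x \<le> a"
    using compact_imp_bounded bounded_iff by blast
  have "\<psi> x = 0" if "\<bar>x\<bar> \<ge> a + 1" for x
    using a closure_subset[of "support_on UNIV \<psi>"] that by (fastforce simp: support_on_def)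
  then show "smooth \<psi> \<and> (\<exists>a. \<forall>x. \<bar>x\<bar> \<ge> a \<longrightarrow> \<psi> x = 0)" using * by blast
next
  assume "smooth \<psi> \<and> (\<exists>a. \<forall>x. \<bar>x\<bar> \<ge> a \<longrightarrow> \<psi> x = 0)"
  then obtain a where a: "smooth \<psi>" "\<forall>x. \<bar>x\<bar> \<ge> a \<longrightarrow> \<psi> x = 0" by blast
  have "support_on UNIV \<psi> \<subseteq> {-a..a}"
    using a(2) by (force simp: support_on_def abs_le_iff not_le)
  then have "bounded (support_on UNIV \<psi>)"
    using bounded_closed_interval bounded_subset by blast
  then show "\<psi> \<in> test_functions UNIV"
    using a(1) by (simp add: test_functions_def Cc_k_def smooth_def)
qed

lemma test_functions_realE:
  assumes "\<psi> \<in> test_functions UNIV"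
  obtains a where "a \<ge> 0" "smooth \<psi>" "\<And>x::real. \<bar>x\<bar> \<ge> a \<Longrightarrow> \<psi> x = 0"
proof -
  from assms obtain a where a: "smooth \<psi>" "\<forall>x. \<bar>x\<bar> \<ge> a \<longrightarrow> \<psi> x = 0"
    unfolding test_functions_real_iff by (elim conjE exE)
  show ?thesis by (rule that[of "\<bar>a\<bar>"]) (use a in auto)
qed

lemma test_functions_real_vderiv:
  assumes "\<psi> \<in> test_functions UNIV"
  shows "(\<lambda>x::real. vector_derivative \<psi> (at x) :: complex) \<in> test_functions UNIV"
proof -
  obtain a where a: "smooth \<psi>" "\<And>x. \<bar>x\<bar> \<ge> a \<Longrightarrow> \<psi> x = 0"
    using assms test_functions_real_iff by blast
  have "vector_derivative \<psi> (at x) = 0" if "\<bar>x\<bar> \<ge> a + 1" for x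
  proof -
    have "((\<lambda>x. 0) has_vector_derivative 0) (at x)" by simp
    then have "(\<psi> has_vector_derivative 0) (at x)"
      by (rule has_vector_derivative_transform_within_open[where S = "ball x 1"])
         (use that a(2) in \<open>auto simp: dist_real_def\<close>)
    then show ?thesis by (rule vector_derivative_at)
  qed
  then show ?thesis
    using smooth_deriv(2)[OF a(1)] by (auto simp: test_functions_real_iff)
qed

lemma test_functions_real_mult:
  assumes "smooth g" "\<psi> \<in> test_functions UNIV"
  shows "(\<lambda>x. g x * \<psi> x) \<in> test_functions UNIV"
  using assms smooth_mult[of g \<psi>] unfolding test_functions_real_iff by fastforce

lemma test_function_real_bounded:
  assumes "\<psi> \<in> test_functions UNIV"
  shows "bounded (range (\<psi> :: real \<Rightarrow> complex))"
proof -
  obtain a where a: "smooth \<psi>" "\<And>x. \<bar>x\<bar> \<ge> a \<Longrightarrow> \<psi> x = 0"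
    using assms test_functions_real_iff by blast
  have "bounded (\<psi> ` {-a..a})"
    by (intro compact_imp_bounded compact_continuous_image smooth_continuous a compact_Icc)
  then have "bounded (insert 0 (\<psi> ` {-a..a}))" by simp
  moreover have "range \<psi> \<subseteq> insert 0 (\<psi> ` {-a..a})"
    using a(2) by (force simp: abs_le_iff not_le)
  ultimately show ?thesis by (rule bounded_subset)
qed

lemma test_functions_real_higher_vderiv:
  "\<psi> \<in> test_functions UNIV \<Longrightarrow> higher_vderiv k \<psi> \<in> test_functions UNIV"
  by (induction k) (auto simp: higher_vderiv_Suc test_functions_real_vderiv)

lemma smooth_of_real: "smooth (\<lambda>x. of_real x)"
proof -
  have "C_k_on k UNIV (\<lambda>x. complex_of_real x)" for k
  proof (cases k)
    case 0
    then show ?thesis by (auto intro: continuous_intros)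
  next
    case (Suc l)
    have "((\<lambda>x. complex_of_real x) has_vector_derivative 1) (at x)" for x
      using has_vector_derivative_of_real[OF DERIV_ident, of "at x"] by simp
    then show ?thesis unfolding Suc
      by (rule C_k_on_Suc_realI) (rule C_k_on_const_real)
  qed
  then show ?thesis by (simp add: smooth_def)
qed

lemma smooth_power: "smooth (\<lambda>x. of_real (x ^ j))"
  by (induction j) (auto intro: smooth_const smooth_mult smooth_of_real)

lemma test_functions_schwartz:
  "\<psi> \<in> test_functions UNIV \<Longrightarrow> \<psi> \<in> schwartz"
  using test_functions_real_mult[OF smooth_power test_functions_real_higher_vderiv]
    test_function_real_bounded
  by (auto simp: schwartz_def test_functions_real_iff[of \<psi>] smooth_def[of \<psi>])

lemma schwartz_smooth: "G \<in> schwartz \<Longrightarrow> smooth G"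
  by (simp add: schwartz_def smooth_def)

lemma schwartz_vderiv: "G \<in> schwartz \<Longrightarrow> (\<lambda>x. vector_derivative G (at x)) \<in> schwartz"
  using smooth_deriv(2)[of G] by (auto simp: schwartz_def smooth_def simp flip: higher_vderiv_Suc')

lemma schwartz_bound:
  assumes "G \<in> schwartz"
  obtains C where "\<And>x. \<bar>x\<bar> ^ m * norm (higher_vderiv k G x) \<le> C"
proof -
  have "bounded (range (\<lambda>x. of_real (x ^ m) * higher_vderiv k G x))"
    using assms by (simp add: schwartz_def)
  then obtain C where C: "\<forall>x. norm (of_real (x ^ m) * higher_vderiv k G x) \<le> C"
    by (auto simp: bounded_iff)
  show ?thesis
    by (rule that[of C]) (use C in \<open>simp add: norm_mult norm_power\<close>)
qed

section \<open>Fourier transforms of test functions\<close>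

lemma lebesgue_integral_compact_support:
  fixes h :: "real \<Rightarrow> complex"
  assumes cont: "continuous_on {-a..a} h" and zero: "\<And>x. \<bar>x\<bar> \<ge> a \<Longrightarrow> h x = 0"
  shows "(LINT x|lebesgue. h x) = integral {-a..a} h"
proof -
  have "(\<lambda>x. if x \<in> {-a..a} then h x else 0) = h"
    using zero by (auto simp: fun_eq_iff abs_le_iff not_le)
  then have "(LINT x|lebesgue. h x) = integral\<^sup>L (lebesgue_on {-a..a}) h"
    using Lebesgue_Measure.integral_restrict_UNIV[of "{-a..a}" h] by simp
  also have "\<dots> = integral {-a..a} h"
    by (rule lebesgue_integral_eq_integral) (use continuous_imp_integrable_real[OF cont] in auto)
  finally show ?thesis .
qed

lemma fourier_eq_integral:
  assumes "continuous_on UNIV \<psi>" "\<And>x. \<bar>x\<bar> \<ge> a \<Longrightarrow> \<psi> x = 0"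
  shows "fourier \<psi> x = integral {-a..a} (\<lambda>\<xi>. cis (- (x * \<xi>)) * \<psi> \<xi>)"
  unfolding fourier_def
  by (rule lebesgue_integral_compact_support)
     (use assms in \<open>auto intro!: continuous_intros intro: continuous_on_subset simp: cis_conv_exp\<close>)

lemma fourier_has_vector_derivative:
  assumes \<psi>: "\<psi> \<in> test_functions UNIV"
  shows "(fourier \<psi> has_vector_derivative fourier (\<lambda>\<xi>. - \<i> * of_real \<xi> * \<psi> \<xi>) x) (at x)"
proof -
  obtain a where a: "smooth \<psi>" "\<And>x. \<bar>x\<bar> \<ge> a \<Longrightarrow> \<psi> x = 0"
    using test_functions_realE[OF \<psi>] by metis
  have c: "continuous_on S \<psi>" for S using smooth_continuous[OF a(1)] .
  have 1: "fourier \<psi> = (\<lambda>x. integral (cbox (-a) a) (\<lambda>\<xi>. cis (- (x * \<xi>)) * \<psi> \<xi>))"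
    using fourier_eq_integral[OF c, of a] a(2) by (auto simp: fun_eq_iff)
  have 2: "fourier (\<lambda>\<xi>. - \<i> * of_real \<xi> * \<psi> \<xi>) x =
      integral (cbox (-a) a) (\<lambda>\<xi>. - \<i> * of_real \<xi> * cis (- (x * \<xi>)) * \<psi> \<xi>)"
    by (subst fourier_eq_integral[of _ a]) (use a(2) in \<open>auto intro!: continuous_intros c simp: mult_ac\<close>)
  show ?thesis unfolding 1 2
  proof (rule leibniz_rule_vector_derivative[where U = UNIV])
    show "((\<lambda>x. cis (- (x * \<xi>)) * \<psi> \<xi>) has_vector_derivative
        - \<i> * of_real \<xi> * cis (- (x * \<xi>)) * \<psi> \<xi>) (at x)" for x \<xi>
    proof -
      have "((\<lambda>x. cis (- (x * \<xi>))) has_vector_derivative (- \<xi>) *\<^sub>R (\<i> * cis (- (x * \<xi>)))) (at x)"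
        unfolding has_vector_derivative_def
        by (auto intro!: derivative_eq_intros simp: scaleR_conv_of_real)
      from has_vector_derivative_mult_left[OF this, of "\<psi> \<xi>"] show ?thesis
        by (simp add: scaleR_conv_of_real mult_ac)
    qed
    show "(\<lambda>\<xi>. cis (- (x * \<xi>)) * \<psi> \<xi>) integrable_on cbox (-a) a" for x
      by (rule integrable_continuous) (auto intro!: continuous_intros c simp: cis_conv_exp)
    show "continuous_on (UNIV \<times> cbox (-a) a) (\<lambda>(x, \<xi>). - \<i> * of_real \<xi> * cis (- (x * \<xi>)) * \<psi> \<xi>)"
      unfolding case_prod_beta' cis_conv_exp
      by (intro continuous_intros continuous_on_compose2[OF c[of UNIV]]) auto
  qed auto
qed

lemma test_functions_times_ident:
  "\<psi> \<in> test_functions UNIV \<Longrightarrow> (\<lambda>\<xi>::real. c * of_real \<xi> * \<psi> \<xi> :: complex) \<in> test_functions UNIV"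
  by (intro test_functions_real_mult smooth_cmult smooth_of_real)

text \<open>
  Integration by parts: the boundary terms vanish because \<open>\<psi>\<close> has compact support.
\<close>

lemma fourier_vderiv:
  assumes \<psi>: "\<psi> \<in> test_functions UNIV"
  shows "fourier (\<lambda>\<xi>. - \<i> * vector_derivative \<psi> (at \<xi>)) x = of_real x * fourier \<psi> x"
proof -
  obtain a0 where a0: "smooth \<psi>" "\<And>x. \<bar>x\<bar> \<ge> a0 \<Longrightarrow> \<psi> x = 0"
    using test_functions_realE[OF \<psi>] by metis
  obtain a1 where a1: "\<And>x. \<bar>x\<bar> \<ge> a1 \<Longrightarrow> vector_derivative \<psi> (at x) = 0"
    using test_functions_realE[OF test_functions_real_vderiv[OF \<psi>]] by metis
  define a where "a = max \<bar>a0\<bar> \<bar>a1\<bar>"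
  have a: "a \<ge> 0" "\<And>x. \<bar>x\<bar> \<ge> a \<Longrightarrow> \<psi> x = 0" "\<And>x. \<bar>x\<bar> \<ge> a \<Longrightarrow> vector_derivative \<psi> (at x) = 0"
    using a0(2) a1 by (auto simp: a_def)
  let ?d = "\<lambda>\<xi>. vector_derivative \<psi> (at \<xi>)"
  have c: "continuous_on S \<psi>" "continuous_on S ?d" for S
    using smooth_continuous[OF a0(1)] smooth_continuous[OF smooth_deriv(2)[OF a0(1)]] .
  have "((\<lambda>\<xi>. cis (- (x * \<xi>)) * \<psi> \<xi>) has_vector_derivative
      cis (- (x * \<xi>)) * ?d \<xi> + (- \<i> * of_real x * cis (- (x * \<xi>))) * \<psi> \<xi>) (at \<xi>)" for \<xi>
  proof -
    have "((\<lambda>\<xi>. cis (- (x * \<xi>))) has_vector_derivative (- x) *\<^sub>R (\<i> * cis (- (x * \<xi>)))) (at \<xi>)"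
      unfolding has_vector_derivative_def
      by (auto intro!: derivative_eq_intros simp: scaleR_conv_of_real)
    from has_vector_derivative_mult[OF this smooth_deriv(1)[OF a0(1)]] show ?thesis
      by (simp add: scaleR_conv_of_real mult_ac)
  qed
  then have "((\<lambda>\<xi>. cis (- (x * \<xi>)) * ?d \<xi> + (- \<i> * of_real x * cis (- (x * \<xi>))) * \<psi> \<xi>) has_integral
      cis (- (x * a)) * \<psi> a - cis (- (x * (-a))) * \<psi> (-a)) {-a..a}"
    using a(1) by (intro fundamental_theorem_of_calculus) (auto intro: has_vector_derivative_at_within)
  then have "integral {-a..a} (\<lambda>\<xi>. cis (- (x * \<xi>)) * ?d \<xi> + (- \<i> * of_real x) * (cis (- (x * \<xi>)) * \<psi> \<xi>)) = 0"
    using a(1) a(2)[of a] a(2)[of "-a"] by (intro integral_unique) (simp add: mult_ac)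
  moreover have "(\<lambda>\<xi>. cis (- (x * \<xi>)) * ?d \<xi>) integrable_on {-a..a}"
    "(\<lambda>\<xi>. cis (- (x * \<xi>)) * \<psi> \<xi>) integrable_on {-a..a}"
    by (auto intro!: integrable_continuous_interval continuous_intros c simp: cis_conv_exp)
  ultimately have "integral {-a..a} (\<lambda>\<xi>. cis (- (x * \<xi>)) * ?d \<xi>) =
      \<i> * of_real x * integral {-a..a} (\<lambda>\<xi>. cis (- (x * \<xi>)) * \<psi> \<xi>)"
    using integrable_on_mult_right[of "\<lambda>\<xi>. cis (- (x * \<xi>)) * \<psi> \<xi>" "{-a..a}" "- \<i> * of_real x"]
    by (simp only: integral_add integral_mult_right) (simp add: eq_neg_iff_add_eq_0)
  then have "fourier ?d x = \<i> * of_real x * fourier \<psi> x"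
    using fourier_eq_integral[OF c(1) a(2)] fourier_eq_integral[OF c(2) a(3)] by simp
  moreover have "fourier (\<lambda>\<xi>. - \<i> * ?d \<xi>) x = - \<i> * fourier ?d x"
    unfolding fourier_def by (simp add: mult.left_commute[of _ \<i>])
  ultimately show ?thesis by (simp add: mult_ac)
qed

lemma fourier_bounded:
  assumes \<psi>: "\<psi> \<in> test_functions UNIV"
  shows "bounded (range (fourier \<psi>))"
proof -
  obtain a where a: "smooth \<psi>" "\<And>x. \<bar>x\<bar> \<ge> a \<Longrightarrow> \<psi> x = 0"
    using test_functions_realE[OF \<psi>] by metis
  obtain B where B: "\<And>x. norm (\<psi> x) \<le> B"
    using test_function_real_bounded[OF \<psi>] by (auto simp: bounded_iff)
  have "norm (fourier \<psi> x) \<le> B * measure lborel (cbox (-a) a)" for x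
  proof (rule has_integral_bound)
    show "((\<lambda>\<xi>. cis (- (x * \<xi>)) * \<psi> \<xi>) has_integral fourier \<psi> x) (cbox (-a) a)"
    proof -
      have "(\<lambda>\<xi>. cis (- (x * \<xi>)) * \<psi> \<xi>) integrable_on {-a..a}"
        using smooth_continuous[OF a(1)]
        by (auto intro!: integrable_continuous_interval continuous_intros simp: cis_conv_exp)
      moreover have "fourier \<psi> x = integral {-a..a} (\<lambda>\<xi>. cis (- (x * \<xi>)) * \<psi> \<xi>)"
        by (rule fourier_eq_integral) (use a smooth_continuous[OF a(1)] in auto)
      ultimately show ?thesis using integrable_integral by (simp add: has_integral_integrable_integral)
    qed
    show "0 \<le> B" using B[of 0] norm_ge_zero order_trans by blast
  qed (use B in \<open>simp add: norm_mult\<close>)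
  then show ?thesis by (auto simp: bounded_iff)
qed

text \<open>
  Differentiation and multiplication by the variable both map Fourier transforms of test functions
  to Fourier transforms of test functions, and each of these is bounded.
\<close>

lemma fourier_schwartz:
  assumes "\<psi> \<in> test_functions UNIV"
  shows "fourier \<psi> \<in> schwartz"
proof -
  have "smooth (fourier \<psi>)"
  proof (rule smooth_coinduct[where P = "\<lambda>h. \<exists>\<psi>\<in>test_functions UNIV. h = fourier \<psi>"])
    fix h :: "real \<Rightarrow> complex" assume "\<exists>\<psi>\<in>test_functions UNIV. h = fourier \<psi>"
    then obtain \<psi> where "\<psi> \<in> test_functions UNIV" "h = fourier \<psi>" by blast
    then show "\<exists>h'. (\<forall>x. (h has_vector_derivative h' x) (at x)) \<and>
        (\<exists>\<psi>\<in>test_functions UNIV. h' = fourier \<psi>)"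
      using fourier_has_vector_derivative[of \<psi>] test_functions_times_ident[of \<psi> "-\<i>"]
      by (intro exI[of _ "fourier (\<lambda>\<xi>. - \<i> * of_real \<xi> * \<psi> \<xi>)"]) auto
  qed (use assms in blast)
  moreover have "\<exists>\<psi>'\<in>test_functions UNIV. higher_vderiv k (fourier \<psi>) = fourier \<psi>'" for k
  proof (induction k)
    case 0
    then show ?case using assms by auto
  next
    case (Suc k)
    then obtain \<psi>' where \<psi>': "\<psi>' \<in> test_functions UNIV" "higher_vderiv k (fourier \<psi>) = fourier \<psi>'"
      by blast
    have "higher_vderiv (Suc k) (fourier \<psi>) = fourier (\<lambda>\<xi>. - \<i> * of_real \<xi> * \<psi>' \<xi>)"
      unfolding higher_vderiv_Suc \<psi>'(2)
      using vector_derivative_at[OF fourier_has_vector_derivative[OF \<psi>'(1)]] by blast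
    then show ?case using test_functions_times_ident[OF \<psi>'(1), of "-\<i>"] by blast
  qed
  moreover have "\<exists>\<psi>'\<in>test_functions UNIV. (\<lambda>x. of_real (x ^ j) * fourier \<theta> x) = fourier \<psi>'"
    if "\<theta> \<in> test_functions UNIV" for j \<theta>
    using that
  proof (induction j arbitrary: \<theta>)
    case (Suc j)
    have "(\<lambda>\<xi>. - \<i> * vector_derivative \<theta> (at \<xi>)) \<in> test_functions UNIV"
      by (intro test_functions_real_mult smooth_const test_functions_real_vderiv Suc.prems)
    from Suc.IH[OF this] show ?case
      unfolding fourier_vderiv[OF Suc.prems] by (simp add: mult_ac)
  qed auto
  ultimately have "\<exists>\<psi>'\<in>test_functions UNIV.
      (\<lambda>x. of_real (x ^ j) * higher_vderiv k (fourier \<psi>) x) = fourier \<psi>'" for j k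
    by metis
  then have "bounded (range (\<lambda>x. of_real (x ^ j) * higher_vderiv k (fourier \<psi>) x))" for j k
    using fourier_bounded by metis
  then show ?thesis using \<open>smooth (fourier \<psi>)\<close> by (auto simp: schwartz_def smooth_def)
qed

section \<open>Cutting off a Schwartz function and dividing a test function\<close>

text \<open>
  Multiplication of \<open>G\<close> by the dilated cutoff \<open>x \<mapsto> \<rho> (s x)\<close> differs from \<open>\<rho> 0 G\<close> by \<open>O(s)\<close>
  in every Schwartz seminorm. At order zero the mean value theorem costs one factor \<open>|x|\<close>, which the decay of
  \<open>G\<close> absorbs; a derivative either falls on \<open>G\<close> or produces a factor \<open>s\<close>.
\<close>

lemma schwartz_cutoff_estimate:
  assumes "\<rho> \<in> test_functions UNIV" "G \<in> schwartz"
  shows "\<exists>C. \<forall>s\<in>{0<..1}. \<forall>x.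
    \<bar>x\<bar> ^ m * norm (higher_vderiv k (\<lambda>x. (\<rho> (s * x) - \<rho> 0) * G x) x) \<le> C * s"
  using assms
proof (induction k arbitrary: \<rho> G)
  case 0
  let ?d = "\<lambda>x. vector_derivative \<rho> (at x)"
  have \<rho>: "smooth \<rho>" using 0 by (simp add: test_functions_real_iff)
  obtain B where B: "\<And>x. norm (?d x) \<le> B"
    using test_function_real_bounded[OF test_functions_real_vderiv[OF 0(1)]] by (auto simp: bounded_iff)
  obtain C where C: "\<And>x. \<bar>x\<bar> ^ Suc m * norm (higher_vderiv 0 G x) \<le> C"
    using schwartz_bound[OF 0(2)] by blast
  have B0: "B \<ge> 0" using B[of 0] norm_ge_zero order_trans by blast
  have "\<bar>x\<bar> ^ m * norm ((\<rho> (s * x) - \<rho> 0) * G x) \<le> (B * C) * s" if s: "s \<in> {0<..1}" for s x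
  proof -
    have "norm (\<rho> (s * x) - \<rho> 0) \<le> B * norm (s * x - 0)"
    proof (rule differentiable_bound[OF convex_UNIV])
      show "(\<rho> has_derivative (\<lambda>h. h *\<^sub>R ?d y)) (at y)" for y
        using smooth_deriv(1)[OF \<rho>, of y] by (simp add: has_vector_derivative_def)
      show "onorm (\<lambda>h. h *\<^sub>R ?d y) \<le> B" for y
        using B[of y] by (intro onorm_le) (simp add: mult.commute[of B] mult_left_mono)
    qed auto
    then have "norm (\<rho> (s * x) - \<rho> 0) \<le> B * s * \<bar>x\<bar>" using s by (simp add: abs_mult)
    then have "\<bar>x\<bar> ^ m * norm ((\<rho> (s * x) - \<rho> 0) * G x) \<le> \<bar>x\<bar> ^ m * ((B * s * \<bar>x\<bar>) * norm (G x))"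
      by (simp add: norm_mult mult_left_mono mult_right_mono)
    also have "\<dots> = B * s * (\<bar>x\<bar> ^ Suc m * norm (higher_vderiv 0 G x))" by (simp add: mult_ac)
    also have "\<dots> \<le> B * s * C" using B0 s by (intro mult_left_mono C) auto
    finally show ?thesis by (simp add: mult_ac)
  qed
  then show ?case by (intro exI[of _ "B * C"]) simp
next
  case (Suc k)
  let ?d = "\<lambda>x. vector_derivative \<rho> (at x)" and ?G' = "\<lambda>x. vector_derivative G (at x)"
  have \<rho>: "smooth \<rho>" "smooth ?d" using Suc.prems smooth_deriv(2) by (simp_all add: test_functions_real_iff)
  note G = schwartz_smooth[OF Suc.prems(2)]
  note G' = schwartz_vderiv[OF Suc.prems(2)]
  have d: "?d \<in> test_functions UNIV" using test_functions_real_vderiv[OF Suc.prems(1)] .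
  obtain C1 where C1: "\<forall>s\<in>{0<..1}. \<forall>x.
      \<bar>x\<bar> ^ m * norm (higher_vderiv k (\<lambda>x. (?d (s * x) - ?d 0) * G x) x) \<le> C1 * s"
    using Suc.IH[OF d Suc.prems(2)] by blast
  obtain C2 where C2: "\<forall>s\<in>{0<..1}. \<forall>x.
      \<bar>x\<bar> ^ m * norm (higher_vderiv k (\<lambda>x. (\<rho> (s * x) - \<rho> 0) * ?G' x) x) \<le> C2 * s"
    using Suc.IH[OF Suc.prems(1) G'] by blast
  obtain C3 where C3: "\<And>x. \<bar>x\<bar> ^ m * norm (higher_vderiv k G x) \<le> C3"
    using schwartz_bound[OF Suc.prems(2)] by blast
  have "\<bar>x\<bar> ^ m * norm (higher_vderiv (Suc k) (\<lambda>x. (\<rho> (s * x) - \<rho> 0) * G x) x)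
      \<le> (C1 + norm (?d 0) * C3 + C2) * s" if s: "s \<in> {0<..1}" for s x
  proof -
    let ?A = "\<lambda>x. (?d (s * x) - ?d 0) * G x" and ?B = "\<lambda>x. (\<rho> (s * x) - \<rho> 0) * ?G' x"
    have smA: "smooth ?A" and smB: "smooth ?B"
      using smooth_affine[OF \<rho>(1), of s 0] smooth_affine[OF \<rho>(2), of s 0] G schwartz_smooth[OF G']
      by (auto intro!: smooth_mult smooth_diff smooth_const)
    have "((\<lambda>x. (\<rho> (s * x) - \<rho> 0) * G x) has_vector_derivative
        ((of_real s * ?A x + of_real s * ?d 0 * G x) + ?B x)) (at x)" for x
    proof -
      have "((\<lambda>x. s * x) has_vector_derivative s) (at x)"
        by (auto intro!: derivative_eq_intros)
      from vector_diff_chain_at[OF this smooth_deriv(1)[OF \<rho>(1)]]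
      have "((\<lambda>x. \<rho> (s * x) - \<rho> 0) has_vector_derivative s *\<^sub>R ?d (s * x)) (at x)"
        by (auto simp: o_def intro!: derivative_eq_intros)
      from has_vector_derivative_mult[OF this smooth_deriv(1)[OF G]] show ?thesis
        by (simp add: scaleR_conv_of_real algebra_simps)
    qed
    from higher_vderiv_Suc_eq[OF this, of k]
    have "higher_vderiv (Suc k) (\<lambda>x. (\<rho> (s * x) - \<rho> 0) * G x) x =
        of_real s * higher_vderiv k ?A x + of_real s * ?d 0 * higher_vderiv k G x + higher_vderiv k ?B x"
      by (simp add: higher_vderiv_add smooth_add smooth_cmult smA smB G
          higher_vderiv_cmult[OF smA] higher_vderiv_cmult[OF G])
    then have "norm (higher_vderiv (Suc k) (\<lambda>x. (\<rho> (s * x) - \<rho> 0) * G x) x) \<le>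
        s * norm (higher_vderiv k ?A x) + s * norm (?d 0) * norm (higher_vderiv k G x) + norm (higher_vderiv k ?B x)"
      using s by (auto intro!: norm_triangle_le add_mono simp: norm_mult)
    then have "\<bar>x\<bar> ^ m * norm (higher_vderiv (Suc k) (\<lambda>x. (\<rho> (s * x) - \<rho> 0) * G x) x) \<le>
        \<bar>x\<bar> ^ m * (s * norm (higher_vderiv k ?A x) + s * norm (?d 0) * norm (higher_vderiv k G x) + norm (higher_vderiv k ?B x))"
      by (intro mult_left_mono) auto
    also have "\<dots> = s * (\<bar>x\<bar> ^ m * norm (higher_vderiv k ?A x)) +
        s * norm (?d 0) * (\<bar>x\<bar> ^ m * norm (higher_vderiv k G x)) + \<bar>x\<bar> ^ m * norm (higher_vderiv k ?B x)"
      by (simp add: algebra_simps)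
    also have "\<dots> \<le> 1 * (C1 * s) + s * norm (?d 0) * C3 + C2 * s"
    proof (intro add_mono)
      have "s \<le> 1" using s by simp
      moreover have "\<bar>x\<bar> ^ m * norm (higher_vderiv k ?A x) \<le> C1 * s" using s C1 by blast
      moreover have "0 \<le> \<bar>x\<bar> ^ m * norm (higher_vderiv k ?A x)" by simp
      ultimately show "s * (\<bar>x\<bar> ^ m * norm (higher_vderiv k ?A x)) \<le> 1 * (C1 * s)"
        by (rule mult_mono[OF _ _ zero_le_one])
      show "s * norm (?d 0) * (\<bar>x\<bar> ^ m * norm (higher_vderiv k G x)) \<le> s * norm (?d 0) * C3"
        using s C3 by (intro mult_left_mono) auto
      show "\<bar>x\<bar> ^ m * norm (higher_vderiv k ?B x) \<le> C2 * s" using s C2 by blast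
    qed
    finally show ?thesis by (simp add: algebra_simps)
  qed
  then show ?case by blast
qed

text \<open>
  Outside \<open>K\<close> the quotient is \<open>0\<close> even where \<open>N\<close> vanishes, because division by zero gives
  zero. The derivative of \<open>\<psi> / N\<close> is a combination of quotients of the same form, with numerators
  that again vanish outside \<open>K\<close>; this drives the induction.
\<close>

lemma C_k_on_divide_real:
  fixes \<psi> N :: "real \<Rightarrow> complex"
  assumes N: "smooth N" "\<And>x. x \<in> K \<Longrightarrow> N x \<noteq> 0" and K: "closed K"
    and \<psi>: "C_k_on k UNIV \<psi>" "\<And>x. x \<notin> K \<Longrightarrow> \<psi> x = 0"
  shows "C_k_on k UNIV (\<lambda>x. \<psi> x / N x)"
  using \<psi>
proof (induction k arbitrary: \<psi>)
  case 0
  have "isCont (\<lambda>x. \<psi> x / N x) x" for x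
  proof (cases "x \<in> K")
    case True
    then show ?thesis
      using 0 N smooth_continuous[OF N(1), of UNIV] by (auto simp: continuous_on_eq_continuous_at intro!: continuous_intros)
  next
    case False
    have "\<forall>\<^sub>F y in nhds x. y \<in> - K"
      using K False by (intro eventually_nhds_in_open) auto
    then have "\<forall>\<^sub>F y in nhds x. \<psi> y / N y = 0"
      by eventually_elim (use 0 in auto)
    then show ?thesis using isCont_cong[of "\<lambda>x. \<psi> x / N x" "\<lambda>x. 0" x] by simp
  qed
  then show ?case by (simp add: continuous_at_imp_continuous_on)
next
  case (Suc k)
  let ?d = "\<lambda>x. vector_derivative \<psi> (at x)" and ?N' = "\<lambda>x. vector_derivative N (at x)"
  note d = C_k_on_Suc_real_deriv[OF Suc.prems(1)]
  have locally0: "\<forall>\<^sub>F y in nhds x. y \<in> - K" if "x \<notin> K" for x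
    using K that by (intro eventually_nhds_in_open) auto
  have zero: "(\<psi> has_vector_derivative 0) (at x)" "((\<lambda>x. \<psi> x / N x) has_vector_derivative 0) (at x)"
    if "x \<notin> K" for x
  proof -
    have *: "((\<lambda>x. 0) has_vector_derivative 0) (at x)" by simp
    show "(\<psi> has_vector_derivative 0) (at x)" "((\<lambda>x. \<psi> x / N x) has_vector_derivative 0) (at x)"
      by (rule has_vector_derivative_transform_within_open[OF *, of "- K"]; use K that Suc.prems in auto)+
  qed
  have d0: "?d x = 0" if "x \<notin> K" for x
    using zero(1)[OF that] by (rule vector_derivative_at)
  have 1: "C_k_on k UNIV (\<lambda>x. ?d x / N x)"
    by (rule Suc.IH[OF d(2) d0])
  have 2: "C_k_on k UNIV (\<lambda>x. - 1 * (\<psi> x * ?N' x / N x / N x))"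
  proof (intro C_k_on_mult_real C_k_on_const_real Suc.IH)
    show "C_k_on k UNIV \<psi>" using Suc.prems(1) by (rule C_k_on_real_SucD)
    show "C_k_on k UNIV ?N'" using smooth_deriv(2)[OF N(1)] by (simp add: smooth_def)
  qed (use Suc.prems in auto)
  have "((\<lambda>x. \<psi> x / N x) has_vector_derivative ?d x / N x + - 1 * (\<psi> x * ?N' x / N x / N x)) (at x)" for x
  proof (cases "x \<in> K")
    case True
    show ?thesis
      using has_derivative_divide'[OF d(1)[unfolded has_vector_derivative_def]
          smooth_deriv(1)[OF N(1), unfolded has_vector_derivative_def] N(2)[OF True]]
      unfolding has_vector_derivative_def
      by (rule has_derivative_eq_rhs) (use N(2)[OF True] in \<open>auto simp: fun_eq_iff field_simps scaleR_conv_of_real\<close>)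
  next
    case False
    then show ?thesis using zero(2)[OF False] d0[OF False] Suc.prems(2) by simp
  qed
  then show ?case by (rule C_k_on_Suc_realI[OF _ C_k_on_add_real[OF 1 2]])
qed

section \<open>Convolution with a functional\<close>

text \<open>
  The convolution of \<open>q\<close> with the measure that \<open>L\<close> stands for.
\<close>

definition conv :: "((real \<Rightarrow> complex) \<Rightarrow> complex) \<Rightarrow> (real \<Rightarrow> complex) \<Rightarrow> real \<Rightarrow> complex" where
  "conv L q x = L (\<lambda>w. q (x - w))"

lemma continuous_on_reflect:
  fixes q :: "real \<Rightarrow> 'b::topological_space"
  assumes "continuous_on UNIV q"
  shows "continuous_on UNIV (\<lambda>w. q (x - w))"
  by (rule continuous_on_compose2[OF assms]) (auto intro!: continuous_intros)

lemma conv_has_vector_derivative: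
  assumes L: "C0_functional R L" and q: "smooth q"
  shows "(conv L q has_vector_derivative conv L (\<lambda>x. vector_derivative q (at x)) x) (at x)"
proof -
  let ?d = "\<lambda>x. vector_derivative q (at x)"
  have "((\<lambda>y. L (\<lambda>w. q (y - w))) has_vector_derivative L (\<lambda>w. ?d (x - w))) (at x within UNIV)"
  proof (rule C0_functional_has_vector_derivative[OF L])
    show "continuous_on UNIV (\<lambda>w. q (y - w))" for y
      by (rule continuous_on_reflect[OF smooth_continuous[OF q]])
    show "((\<lambda>y. q (y - w)) has_vector_derivative ?d (y - w)) (at y within UNIV)" for y w
    proof -
      have "((\<lambda>y. y - w) has_vector_derivative 1) (at y)"
        by (auto intro!: derivative_eq_intros)
      from vector_diff_chain_at[OF this smooth_deriv(1)[OF q]] show ?thesis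
        by (simp add: o_def)
    qed
    show "continuous_on (UNIV \<times> UNIV) (\<lambda>(y, w). ?d (y - w))"
      unfolding case_prod_beta'
      by (rule continuous_on_compose2[OF smooth_continuous[OF smooth_deriv(2)[OF q], of UNIV]])
         (auto intro!: continuous_intros)
  qed auto
  then show ?thesis by (simp add: conv_def[abs_def])
qed

lemma smooth_conv:
  assumes L: "C0_functional R L" and q: "smooth q"
  shows "smooth (conv L q)"
proof (rule smooth_coinduct[where P = "\<lambda>h. \<exists>q. smooth q \<and> h = conv L q"])
  fix h assume "\<exists>q. smooth q \<and> h = conv L q"
  then obtain q where q: "smooth q" "h = conv L q" by blast
  show "\<exists>h'. (\<forall>x. (h has_vector_derivative h' x) (at x)) \<and> (\<exists>q. smooth q \<and> h' = conv L q)"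
    using conv_has_vector_derivative[OF L q(1)] smooth_deriv(2)[OF q(1)] q(2)
    by (intro exI[of _ "conv L (\<lambda>x. vector_derivative q (at x))"]) auto
qed (use q in blast)

lemma higher_vderiv_conv:
  assumes L: "C0_functional R L" and q: "smooth q"
  shows "higher_vderiv k (conv L q) = conv L (higher_vderiv k q)"
proof (induction k)
  case (Suc k)
  show ?case
    unfolding higher_vderiv_Suc Suc
    using vector_derivative_at[OF conv_has_vector_derivative[OF L smooth_higher_vderiv[OF q]]] by blast
qed simp

lemma conv_test_function:
  assumes L: "C0_functional R L" and \<eta>: "\<eta> \<in> test_functions UNIV"
  shows "conv L \<eta> \<in> test_functions UNIV"
proof -
  obtain a where a: "a \<ge> 0" "smooth \<eta>" "\<And>x. \<bar>x\<bar> \<ge> a \<Longrightarrow> \<eta> x = 0"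
    using test_functions_realE[OF \<eta>] by metis
  have "conv L \<eta> x = 0" if "\<bar>x\<bar> \<ge> a + \<bar>R\<bar>" for x
  proof -
    have "conv L \<eta> x = L (\<lambda>w. 0)"
      unfolding conv_def
      by (rule C0_functional_cong[OF L continuous_on_reflect[OF smooth_continuous[OF a(2)]]])
         (use that in \<open>auto intro!: a(3)\<close>)
    then show ?thesis using C0_functional_zero[OF L] by simp
  qed
  then show ?thesis
    using smooth_conv[OF L a(2)] by (auto simp: test_functions_real_iff)
qed

lemma power_add_le:
  fixes a b :: real
  assumes "a \<ge> 0" "b \<ge> 0"
  shows "(a + b) ^ j \<le> 2 ^ j * (a ^ j + b ^ j)"
proof -
  have "(a + b) ^ j \<le> (2 * max a b) ^ j"
    by (rule power_mono) (use assms in auto)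
  also have "\<dots> \<le> 2 ^ j * (a ^ j + b ^ j)"
    using assms by (auto simp: power_mult_distrib max_def)
  finally show ?thesis .
qed

text \<open>
  Convolution with a measure on \<open>[-R, R]\<close> preserves polynomial decay, since
  \<open>|x| \<le> |x - w| + R\<close> for \<open>|w| \<le> R\<close>.
\<close>

lemma conv_decay:
  assumes L: "C0_functional R L"
  obtains C where "C \<ge> 0" "\<And>q B0 B x. continuous_on UNIV q \<Longrightarrow> (\<And>y. norm (q y) \<le> B0) \<Longrightarrow>
      (\<And>y. \<bar>y\<bar> ^ j * norm (q y) \<le> B) \<Longrightarrow> \<bar>x\<bar> ^ j * norm (conv L q x) \<le> C * (B + B0)"
proof -
  obtain C where C: "C \<ge> 0"
    "\<And>e B. continuous_on UNIV e \<Longrightarrow> (\<And>w. w \<in> {-R..R} \<Longrightarrow> norm (e w) \<le> B) \<Longrightarrow> norm (L e) \<le> C * B"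
    using C0_functional_bound[OF L] by metis
  \<comment> \<open>from \<open>|x|\<^sup>j \<le> 2\<^sup>j (|x - w|\<^sup>j + R\<^sup>j)\<close>\<close>
  define D where "D = 2 ^ j * (1 + \<bar>R\<bar> ^ j)"
  have D: "D \<ge> 0" by (simp add: D_def)
  show ?thesis
  proof (rule that[of "C * D"])
    fix q :: "real \<Rightarrow> complex" and B0 B x
    assume q: "continuous_on UNIV q" and B0: "\<And>y. norm (q y) \<le> B0"
      and B: "\<And>y. \<bar>y\<bar> ^ j * norm (q y) \<le> B"
    have B_nonneg: "B0 \<ge> 0" "B \<ge> 0"
      using B0[of 0] B[of 0] norm_ge_zero[of "q 0"] zero_le_power[of "\<bar>0\<bar>::real" j]
      by (smt (verit) mult_nonneg_nonneg abs_ge_zero)+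
    have "\<bar>x\<bar> ^ j * norm (q (x - w)) \<le> D * (B + B0)" if w: "w \<in> {-R..R}" for w
    proof -
      have "\<bar>x\<bar> ^ j \<le> (\<bar>x - w\<bar> + \<bar>R\<bar>) ^ j"
        by (rule power_mono) (use w in auto)
      also have "\<dots> \<le> 2 ^ j * (\<bar>x - w\<bar> ^ j + \<bar>R\<bar> ^ j)"
        by (rule power_add_le) auto
      finally have "\<bar>x\<bar> ^ j * norm (q (x - w)) \<le> 2 ^ j * (\<bar>x - w\<bar> ^ j + \<bar>R\<bar> ^ j) * norm (q (x - w))"
        by (rule mult_right_mono) auto
      also have "\<dots> = 2 ^ j * (\<bar>x - w\<bar> ^ j * norm (q (x - w)) + \<bar>R\<bar> ^ j * norm (q (x - w)))"
        by (simp add: algebra_simps)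
      also have "\<dots> \<le> 2 ^ j * (B + \<bar>R\<bar> ^ j * B0)"
        by (intro mult_left_mono add_mono B B0) auto
      also have "\<dots> \<le> D * (B + B0)"
        using B_nonneg by (simp add: D_def algebra_simps)
      finally show ?thesis .
    qed
    then have "norm (L (\<lambda>w. of_real (\<bar>x\<bar> ^ j) * q (x - w))) \<le> C * (D * (B + B0))"
      by (intro C(2) continuous_intros continuous_on_reflect[OF q]) (auto simp: norm_mult norm_power)
    also have "L (\<lambda>w. of_real (\<bar>x\<bar> ^ j) * q (x - w)) = of_real (\<bar>x\<bar> ^ j) * conv L q x"
      unfolding conv_def by (rule C0_functional_scale[OF L continuous_on_reflect[OF q]])
    finally show "\<bar>x\<bar> ^ j * norm (conv L q x) \<le> C * D * (B + B0)"
      by (simp add: norm_mult norm_power mult.assoc)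
  qed (use C(1) D in auto)
qed

lemma smooth_symbol:
  assumes L: "C0_functional R L"
  shows "smooth (\<lambda>\<xi>. L (\<lambda>w. cis (\<xi> * w)))"
proof (rule smooth_coinduct[where P = "\<lambda>h. \<exists>q. continuous_on UNIV q \<and> h = (\<lambda>\<xi>. L (\<lambda>w. q w * cis (\<xi> * w)))"])
  show "\<exists>q. continuous_on UNIV q \<and> (\<lambda>\<xi>. L (\<lambda>w. cis (\<xi> * w))) = (\<lambda>\<xi>. L (\<lambda>w. q w * cis (\<xi> * w)))"
    by (intro exI[of _ "\<lambda>w. 1"]) auto
  fix h assume "\<exists>q. continuous_on UNIV q \<and> h = (\<lambda>\<xi>. L (\<lambda>w. q w * cis (\<xi> * w)))"
  then obtain q where q: "continuous_on UNIV q" "h = (\<lambda>\<xi>. L (\<lambda>w. q w * cis (\<xi> * w)))" by blast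
  let ?q = "\<lambda>w. q w * (\<i> * of_real w)"
  have "((\<lambda>\<xi>. L (\<lambda>w. q w * cis (\<xi> * w))) has_vector_derivative L (\<lambda>w. ?q w * cis (\<xi> * w))) (at \<xi> within UNIV)" for \<xi>
  proof (rule C0_functional_has_vector_derivative[OF L])
    show "continuous_on UNIV (\<lambda>w. q w * cis (y * w))" for y
      unfolding cis_conv_exp by (intro continuous_intros q)
    show "((\<lambda>y. q w * cis (y * w)) has_vector_derivative ?q w * cis (y * w)) (at y within UNIV)" for y w
    proof -
      have "((\<lambda>y. cis (y * w)) has_vector_derivative w *\<^sub>R (\<i> * cis (y * w))) (at y)"
        unfolding has_vector_derivative_def
        by (auto intro!: derivative_eq_intros simp: scaleR_conv_of_real)
      from has_vector_derivative_mult_right[OF this, of "q w"] show ?thesis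
        by (simp add: scaleR_conv_of_real mult_ac)
    qed
    show "continuous_on (UNIV \<times> UNIV) (\<lambda>(y, w). ?q w * cis (y * w))"
      unfolding case_prod_beta' cis_conv_exp
      by (intro continuous_intros continuous_on_compose2[OF q(1)]) auto
  qed auto
  moreover have "continuous_on UNIV ?q" by (intro continuous_intros q)
  ultimately show "\<exists>h'. (\<forall>x. (h has_vector_derivative h' x) (at x)) \<and>
      (\<exists>q. continuous_on UNIV q \<and> h' = (\<lambda>\<xi>. L (\<lambda>w. q w * cis (\<xi> * w))))"
    unfolding q(2) by (intro exI[of _ "\<lambda>\<xi>. L (\<lambda>w. ?q w * cis (\<xi> * w))"]) auto
qed

text \<open>
  The convolution theorem: convolution with \<open>L\<close> is multiplication by the symbol of \<open>L\<close> on the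
  Fourier side.
\<close>

lemma conv_fourier:
  assumes L: "C0_functional R L" and \<kappa>: "\<kappa> \<in> test_functions UNIV"
  shows "conv L (fourier \<kappa>) x = fourier (\<lambda>\<xi>. L (\<lambda>w. cis (\<xi> * w)) * \<kappa> \<xi>) x"
proof -
  obtain a where a: "a \<ge> 0" "smooth \<kappa>" "\<And>x. \<bar>x\<bar> \<ge> a \<Longrightarrow> \<kappa> x = 0"
    using test_functions_realE[OF \<kappa>] by metis
  note c = smooth_continuous[OF a(2)] smooth_continuous[OF smooth_symbol[OF L]]
  have cc: "continuous_on UNIV (\<lambda>w. cis (s * w))" for s
    unfolding cis_conv_exp by (intro continuous_intros)
  let ?h = "\<lambda>\<xi> w. \<kappa> \<xi> * cis (- (x * \<xi>)) * cis (\<xi> * w)"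
  have "((\<lambda>\<xi>. L (?h \<xi>)) has_integral L (\<lambda>w. integral {-a..a} (\<lambda>\<xi>. ?h \<xi> w))) {-a..a}"
    by (rule C0_functional_integral[OF L])
       (use a(1) in \<open>auto intro!: continuous_intros continuous_on_compose2[OF c(1)[of UNIV]] simp: case_prod_beta' cis_conv_exp\<close>)
  moreover have "L (?h \<xi>) = cis (- (x * \<xi>)) * (L (\<lambda>w. cis (\<xi> * w)) * \<kappa> \<xi>)" for \<xi>
    using C0_functional_scale[OF L cc, of "\<kappa> \<xi> * cis (- (x * \<xi>))" \<xi>] by (simp add: mult_ac)
  moreover have "integral {-a..a} (\<lambda>\<xi>. ?h \<xi> w) = fourier \<kappa> (x - w)" for w
  proof -
    have "fourier \<kappa> (x - w) = integral {-a..a} (\<lambda>\<xi>. cis (- ((x - w) * \<xi>)) * \<kappa> \<xi>)"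
      by (rule fourier_eq_integral) (use a c in auto)
    moreover have "cis (- ((x - w) * \<xi>)) * \<kappa> \<xi> = ?h \<xi> w" for \<xi>
      by (simp add: mult.assoc cis_mult algebra_simps)
    ultimately show ?thesis by simp
  qed
  ultimately have "integral {-a..a} (\<lambda>\<xi>. cis (- (x * \<xi>)) * (L (\<lambda>w. cis (\<xi> * w)) * \<kappa> \<xi>)) = L (\<lambda>w. fourier \<kappa> (x - w))"
    by (intro integral_unique) simp
  moreover have "fourier (\<lambda>\<xi>. L (\<lambda>w. cis (\<xi> * w)) * \<kappa> \<xi>) x =
      integral {-a..a} (\<lambda>\<xi>. cis (- (x * \<xi>)) * (L (\<lambda>w. cis (\<xi> * w)) * \<kappa> \<xi>))"
    by (rule fourier_eq_integral) (use a c in \<open>auto intro!: continuous_intros\<close>)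
  ultimately show ?thesis by (simp add: conv_def)
qed

text \<open>
  Exchanging \<open>L\<close> with the integral and substituting \<open>x = y + w\<close> moves the translation from
  \<open>\<eta>\<close> to \<open>D\<close>, and \<open>L\<close> annihilates the translates of \<open>D\<close>.
\<close>

lemma conv_annihilated:
  fixes D :: "real \<Rightarrow> real"
  assumes L: "C0_functional R L" and D: "continuous_on UNIV D"
    and ann: "\<And>y. L (\<lambda>w. of_real (D (y + w))) = 0" and \<eta>: "\<eta> \<in> test_functions UNIV"
  shows "(LINT x|lebesgue. of_real (D x) * conv L \<eta> x) = 0"
proof -
  obtain a where a: "a \<ge> 0" "smooth \<eta>" "\<And>x. \<bar>x\<bar> \<ge> a \<Longrightarrow> \<eta> x = 0"
    using test_functions_realE[OF \<eta>] by metis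
  note c = smooth_continuous[OF a(2)]
  have cD: "continuous_on S (\<lambda>x. of_real (D (f x)) :: complex)" if "continuous_on S f" for S :: "'b::topological_space set" and f
    by (intro continuous_intros continuous_on_compose2[OF D that]) auto
  obtain b0 where b0: "b0 \<ge> 0" "smooth (conv L \<eta>)" "\<And>x. \<bar>x\<bar> \<ge> b0 \<Longrightarrow> conv L \<eta> x = 0"
    using test_functions_realE[OF conv_test_function[OF L \<eta>]] by metis
  define b where "b = max b0 (a + \<bar>R\<bar>)"
  have b: "b \<ge> 0" "b \<ge> a + \<bar>R\<bar>" "\<And>x. \<bar>x\<bar> \<ge> b \<Longrightarrow> conv L \<eta> x = 0"
    using b0 by (auto simp: b_def)
  have "(LINT x|lebesgue. of_real (D x) * conv L \<eta> x) = integral {-b..b} (\<lambda>x. of_real (D x) * conv L \<eta> x)"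
    by (rule lebesgue_integral_compact_support)
       (use b(3) in \<open>auto intro!: continuous_intros cD smooth_continuous[OF b0(2)]\<close>)
  also have "\<dots> = L (\<lambda>w. integral {-b..b} (\<lambda>x. of_real (D x) * \<eta> (x - w)))"
  proof -
    have "((\<lambda>x. L (\<lambda>w. of_real (D x) * \<eta> (x - w))) has_integral
        L (\<lambda>w. integral {-b..b} (\<lambda>x. of_real (D x) * \<eta> (x - w)))) {-b..b}"
      by (rule C0_functional_integral[OF L])
         (use b(1) in \<open>auto simp: case_prod_beta' intro!: continuous_intros cD continuous_on_compose2[OF c[of UNIV]]\<close>)
    moreover have "L (\<lambda>w. of_real (D x) * \<eta> (x - w)) = of_real (D x) * conv L \<eta> x" for x
      unfolding conv_def by (rule C0_functional_scale[OF L continuous_on_reflect[OF c]])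
    ultimately show ?thesis by (simp add: integral_unique)
  qed
  also have "\<dots> = L (\<lambda>w. integral {-a..a} (\<lambda>y. of_real (D (y + w)) * \<eta> y))"
  proof (rule C0_functional_cong[OF L])
    have "continuous_on (UNIV \<times> cbox (-b) b) (\<lambda>(w, x). of_real (D x) * \<eta> (x - w))"
      unfolding case_prod_beta' by (intro continuous_intros cD continuous_on_compose2[OF c[of UNIV]]) auto
    from integral_continuous_on_param[OF this]
    show "continuous_on UNIV (\<lambda>w. integral {-b..b} (\<lambda>x. of_real (D x) * \<eta> (x - w)))" by simp
    have "continuous_on (UNIV \<times> cbox (-a) a) (\<lambda>(w, y). of_real (D (y + w)) * \<eta> y)"
      unfolding case_prod_beta' by (intro continuous_intros cD continuous_on_compose2[OF c[of UNIV]]) auto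
    from integral_continuous_on_param[OF this]
    show "continuous_on UNIV (\<lambda>w. integral {-a..a} (\<lambda>y. of_real (D (y + w)) * \<eta> y))" by simp
    fix w assume w: "w \<in> {-R..R}"
    let ?f = "\<lambda>y. of_real (D (y + w)) * \<eta> y"
    have int: "?f integrable_on {-a..a}"
      by (intro integrable_continuous_interval continuous_intros cD c)
    have "(?f has_integral integral {-a..a} ?f) {-b-w..b-w}"
      by (rule has_integral_on_superset[OF integrable_integral[OF int]])
         (use w b(2) in \<open>auto simp: a(3)\<close>)
    then have "integral {-a..a} ?f = integral {-b-w..b-w} ?f" by (simp add: integral_unique)
    also have "\<dots> = integral {-b-w..b-w} ((\<lambda>x. of_real (D x) * \<eta> (x - w)) \<circ> (\<lambda>y. y + w))"
      by (simp add: o_def)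
    also have "\<dots> = integral {-b-w+w..b-w+w} (\<lambda>x. of_real (D x) * \<eta> (x - w))"
      by (rule integral_shift) (auto intro!: continuous_intros cD continuous_on_compose2[OF c[of UNIV]])
    finally show "integral {-b..b} (\<lambda>x. of_real (D x) * \<eta> (x - w)) = integral {-a..a} ?f" by simp
  qed
  also have "\<dots> = 0"
  proof -
    have "((\<lambda>y. L (\<lambda>w. of_real (D (y + w)) * \<eta> y)) has_integral
        L (\<lambda>w. integral {-a..a} (\<lambda>y. of_real (D (y + w)) * \<eta> y))) {-a..a}"
      by (rule C0_functional_integral[OF L])
         (use a(1) in \<open>auto simp: case_prod_beta' intro!: continuous_intros cD continuous_on_compose2[OF c[of UNIV]]\<close>)
    moreover have "L (\<lambda>w. of_real (D (y + w)) * \<eta> y) = 0" for y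
    proof -
      have "continuous_on UNIV (\<lambda>w. of_real (D (y + w)) :: complex)"
        by (intro cD continuous_intros)
      from C0_functional_scale[OF L this, of "\<eta> y"] ann[of y] show ?thesis
        by (simp add: mult.commute)
    qed
    ultimately show ?thesis by (simp add: has_integral_0_eq)
  qed
  finally show ?thesis .
qed

section \<open>The symbol of a functional and its zeros\<close>

text \<open>
  For compactly supported \<open>\<eta>\<close> in place of \<open>G\<close> this is lemma \<open>conv_annihilated\<close>, because there
  \<open>\<Lambda>\<close> is integration against \<open>D\<close>. The general case follows by continuity of \<open>\<Lambda>\<close>. The
  function \<open>\<psi>\<close> supplies the cutoff: any test function that is not identically zero becomes one
  after translation and normalisation.
\<close>

lemma tempered_vanishes_on_conv:
  fixes \<psi> :: "real \<Rightarrow> complex"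
  assumes L: "C0_functional R L" and D: "continuous_on UNIV D"
    and ann: "\<And>y. L (\<lambda>w. of_real (D (y + w))) = 0" and \<Lambda>: "represents_tempered D \<Lambda>"
    and G: "G \<in> schwartz" "conv L G \<in> schwartz" and \<psi>: "\<psi> \<in> test_functions UNIV" "\<psi> p \<noteq> 0"
  shows "\<Lambda> (conv L G) = 0"
proof (rule ccontr)
  assume nz: "\<Lambda> (conv L G) \<noteq> 0"
  \<comment> \<open>a test function with value \<open>1\<close> at \<open>0\<close>\<close>
  define \<rho> where "\<rho> x = (1 / \<psi> p) * \<psi> (1 * x + p)" for x
  obtain a where a: "a \<ge> 0" "smooth \<psi>" "\<And>x. \<bar>x\<bar> \<ge> a \<Longrightarrow> \<psi> x = 0"
    using test_functions_realE[OF \<psi>(1)] by metis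
  have sm\<rho>: "smooth \<rho>"
    unfolding \<rho>_def by (intro smooth_cmult smooth_affine a)
  have \<rho>0: "\<rho> 0 = 1" using \<psi>(2) by (simp add: \<rho>_def)
  have \<rho>: "\<rho> \<in> test_functions UNIV"
    using sm\<rho> unfolding test_functions_real_iff
    by (auto simp: \<rho>_def intro!: exI[of _ "a + \<bar>p\<bar>"] a(3))
  note smG = schwartz_smooth[OF G(1)]
  \<comment> \<open>the error of the approximation of \<open>G\<close> by the compactly supported \<open>\<eta> s\<close> below\<close>
  define q where "q s x = (\<rho> (s * x) - \<rho> 0) * G x" for s x
  have smq: "smooth (q s)" for s
    unfolding q_def using smooth_affine[OF sm\<rho>, of s 0] by (intro smooth_mult smooth_diff smooth_const smG) simp
  define \<eta> where "\<eta> s x = \<rho> (s * x) * G x" for s x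
  have \<eta>: "\<eta> s \<in> test_functions UNIV" if "s > 0" for s
  proof -
    obtain b where b: "b \<ge> 0" "\<And>x. \<bar>x\<bar> \<ge> b \<Longrightarrow> \<rho> x = 0"
      using test_functions_realE[OF \<rho>] by metis
    have "smooth (\<eta> s)"
      unfolding \<eta>_def using smooth_affine[OF sm\<rho>, of s 0] by (intro smooth_mult smG) simp
    moreover have "\<eta> s x = 0" if "\<bar>x\<bar> \<ge> b / s" for x
      using that \<open>s > 0\<close> b(2)[of "s * x"] by (simp add: \<eta>_def abs_mult field_simps)
    ultimately show ?thesis by (auto simp: test_functions_real_iff)
  qed
  have diff: "conv L (\<eta> s) x - conv L G x = conv L (q s) x" if "s > 0" for s x
  proof -
    have "smooth (\<eta> s)" using \<eta>[OF that] by (simp add: test_functions_real_iff)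
    from C0_functional_diff[OF L continuous_on_reflect[OF smooth_continuous[OF this]]
        continuous_on_reflect[OF smooth_continuous[OF smG]], of x x]
    show ?thesis by (simp add: conv_def \<eta>_def q_def \<rho>0 left_diff_distrib)
  qed
  \<comment> \<open>decay of \<open>conv L (q s)\<close> needs the seminorms of \<open>q s\<close> with weights \<open>1\<close> and \<open>|x|\<^sup>j\<close>\<close>
  have est: "\<exists>C. \<forall>s\<in>{0<..1}. schwartz_seminorm j k (conv L (q s)) \<le> C * s" for j k
  proof -
    obtain C where C: "C \<ge> 0" "\<And>q B0 B x. continuous_on UNIV q \<Longrightarrow> (\<And>y. norm (q y) \<le> B0) \<Longrightarrow>
      (\<And>y. \<bar>y\<bar> ^ j * norm (q y) \<le> B) \<Longrightarrow> \<bar>x\<bar> ^ j * norm (conv L q x) \<le> C * (B + B0)"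
      using conv_decay[OF L, of j] by metis
    obtain C0 where C0: "\<forall>s\<in>{0<..1}. \<forall>x. \<bar>x\<bar> ^ 0 * norm (higher_vderiv k (q s) x) \<le> C0 * s"
      using schwartz_cutoff_estimate[OF \<rho> G(1), of 0 k] unfolding q_def by metis
    obtain C1 where C1: "\<forall>s\<in>{0<..1}. \<forall>x. \<bar>x\<bar> ^ j * norm (higher_vderiv k (q s) x) \<le> C1 * s"
      using schwartz_cutoff_estimate[OF \<rho> G(1), of j k] unfolding q_def by metis
    have "schwartz_seminorm j k (conv L (q s)) \<le> C * (C1 + C0) * s" if s: "s \<in> {0<..1}" for s
      unfolding schwartz_seminorm_def higher_vderiv_conv[OF L smq]
    proof (rule cSUP_least)
      fix x :: real
      have "\<bar>x\<bar> ^ j * norm (conv L (higher_vderiv k (q s)) x) \<le> C * (C1 * s + C0 * s)"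
        using C0 C1 s by (intro C(2) smooth_continuous smooth_higher_vderiv smq) auto
      then show "norm (of_real (x ^ j) * conv L (higher_vderiv k (q s)) x) \<le> C * (C1 + C0) * s"
        by (simp add: norm_mult norm_power algebra_simps)
    qed simp
    then show ?thesis by blast
  qed
  have small: "\<forall>\<^sub>F s in at_right 0. schwartz_seminorm j k (conv L (q s)) < \<delta>" if \<delta>: "\<delta> > 0" for j k \<delta>
  proof -
    obtain C where C: "\<forall>s\<in>{0<..1}. schwartz_seminorm j k (conv L (q s)) \<le> C * s"
      using est by blast
    have "((\<lambda>s. C * s) \<longlongrightarrow> C * 0) (at_right 0)" by (intro tendsto_intros)
    then have "\<forall>\<^sub>F s in at_right 0. C * s < \<delta>" using \<delta> by (simp add: order_tendstoD)
    moreover have "\<forall>\<^sub>F s in at_right (0::real). s \<in> {0<..<1}"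
      by (rule eventually_at_right_real) simp
    ultimately show ?thesis
    proof eventually_elim
      case (elim s)
      have "schwartz_seminorm j k (conv L (q s)) \<le> C * s" using C elim(2) by simp
      with elim(1) show ?case by linarith
    qed
  qed
  have "tempered_distribution \<Lambda>" using \<Lambda> by (simp add: represents_tempered_def)
  note continuous = this[unfolded tempered_distribution_def, THEN conjunct2, THEN conjunct2]
  from nz have pos: "norm (\<Lambda> (conv L G)) > 0" by simp
  from bspec[OF continuous G(2), THEN spec, THEN mp, OF pos] obtain N \<delta> where N: "\<delta> > 0" "\<forall>\<psi>\<in>schwartz.
        (\<forall>j\<le>N. \<forall>k\<le>N. schwartz_seminorm j k (\<lambda>x. \<psi> x - conv L G x) < \<delta>) \<longrightarrow>
        norm (\<Lambda> \<psi> - \<Lambda> (conv L G)) < norm (\<Lambda> (conv L G))"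
    by (elim exE conjE)
  have "\<forall>\<^sub>F s in at_right 0. \<forall>j\<in>{..N}. \<forall>k\<in>{..N}. schwartz_seminorm j k (conv L (q s)) < \<delta>"
    by (intro eventually_ball_finite ballI small N) auto
  moreover have "\<forall>\<^sub>F s in at_right (0::real). s > 0"
    by (rule eventually_at_right_less)
  ultimately have "\<forall>\<^sub>F s in at_right (0::real). False"
  proof eventually_elim
    case (elim s)
    have t: "conv L (\<eta> s) \<in> test_functions UNIV" by (intro conv_test_function[OF L] \<eta> elim)
    have "(\<lambda>x. conv L (\<eta> s) x - conv L G x) = conv L (q s)"
      using diff[OF elim(2)] by blast
    then have "norm (\<Lambda> (conv L (\<eta> s)) - \<Lambda> (conv L G)) < norm (\<Lambda> (conv L G))"
      using N(2) elim(1) test_functions_schwartz[OF t] by simp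
    moreover have "\<Lambda> (conv L (\<eta> s)) = 0"
      using \<Lambda> t conv_annihilated[OF L D ann \<eta>[OF elim(2)]] by (simp add: represents_tempered_def)
    ultimately show False by simp
  qed
  then show False by (simp add: eventually_False)
qed

text \<open>
  Let \<open>\<psi>\<close> be a test function supported where the symbol \<open>N\<close> is nonzero. Then
  \<open>\<psi> = N (\<psi> / N)\<close> with \<open>\<psi> / N\<close> a test function, so the Fourier transform of \<open>\<psi>\<close> is the
  convolution of \<open>L\<close> with a Schwartz function, and \<open>\<Lambda>\<close> vanishes on it.
\<close>

lemma symbol_zero_on_support:
  assumes L: "C0_functional R L" and D: "continuous_on UNIV D"
    and ann: "\<And>y. L (\<lambda>w. of_real (D (y + w))) = 0" and \<Lambda>: "represents_tempered D \<Lambda>"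
    and supp: "\<xi> \<in> distr_support (fourier_distr \<Lambda>)"
  shows "L (\<lambda>w. cis (\<xi> * w)) = 0"
proof (rule ccontr)
  define N where "N \<xi> = L (\<lambda>w. cis (\<xi> * w))" for \<xi>
  assume "L (\<lambda>w. cis (\<xi> * w)) \<noteq> 0"
  then have \<xi>: "\<xi> \<in> {\<xi>. N \<xi> \<noteq> 0}" by (simp add: N_def)
  have smN: "smooth N" using smooth_symbol[OF L] by (simp add: N_def[abs_def])
  have "open {\<xi>. N \<xi> \<noteq> 0}"
    using open_Collect_neq[OF smooth_continuous[OF smN] continuous_on_const[of _ 0]] .
  moreover have "fourier_distr \<Lambda> \<psi> = 0"
    if \<psi>: "\<psi> \<in> test_functions UNIV" "closure (support_on UNIV \<psi>) \<subseteq> {\<xi>. N \<xi> \<noteq> 0}" for \<psi>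
  proof (cases "\<exists>p. \<psi> p \<noteq> 0")
    case False
    then have "\<psi> = (\<lambda>x. 0)" by auto
    then have "fourier \<psi> = (\<lambda>x. 0 * fourier \<psi> x)" by (simp add: fourier_def fun_eq_iff)
    moreover
    have "\<forall>c. \<forall>\<phi>\<in>schwartz. \<Lambda> (\<lambda>x. c * \<phi> x) = c * \<Lambda> \<phi>"
      using \<Lambda> by (simp add: represents_tempered_def tempered_distribution_def)
    note bspec[OF spec[OF this, of 0] fourier_schwartz[OF \<psi>(1)]]
    ultimately show ?thesis unfolding fourier_distr_def by simp
  next
    case True
    then obtain p where p: "\<psi> p \<noteq> 0" by blast
    let ?K = "closure (support_on UNIV \<psi>)"
    define \<kappa> where "\<kappa> \<xi> = \<psi> \<xi> / N \<xi>" for \<xi>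
    have outside: "\<psi> x = 0" if "x \<notin> ?K" for x
      using that closure_subset[of "support_on UNIV \<psi>"] by (auto simp: support_on_def)
    obtain a where a: "a \<ge> 0" "smooth \<psi>" "\<And>x. \<bar>x\<bar> \<ge> a \<Longrightarrow> \<psi> x = 0"
      using test_functions_realE[OF \<psi>(1)] by metis
    have "smooth \<kappa>"
      unfolding smooth_def \<kappa>_def
      using C_k_on_divide_real[OF smN _ closed_closure, of "support_on UNIV \<psi>"] \<psi>(2) a(2) outside
      by (auto simp: smooth_def[of \<psi>])
    then have \<kappa>: "\<kappa> \<in> test_functions UNIV"
      using a(3) by (auto simp: test_functions_real_iff \<kappa>_def intro!: exI[of _ a])
    have "N \<xi> * \<kappa> \<xi> = \<psi> \<xi>" for \<xi>
    proof (cases "\<xi> \<in> ?K")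
      case True
      then have "N \<xi> \<noteq> 0" using \<psi>(2) by blast
      then show ?thesis by (simp add: \<kappa>_def)
    next
      case False
      then show ?thesis using outside by (simp add: \<kappa>_def)
    qed
    then have eq: "conv L (fourier \<kappa>) = fourier \<psi>"
      using conv_fourier[OF L \<kappa>] by (simp add: fun_eq_iff N_def)
    have "\<Lambda> (conv L (fourier \<kappa>)) = 0"
      by (rule tempered_vanishes_on_conv[OF L D ann \<Lambda> fourier_schwartz[OF \<kappa>] _ \<psi>(1) p])
         (simp add: eq fourier_schwartz[OF \<psi>(1)])
    then show ?thesis by (simp add: eq fourier_distr_def)
  qed
  ultimately have "{\<xi>. N \<xi> \<noteq> 0} \<subseteq> - distr_support (fourier_distr \<Lambda>)"
    unfolding distr_support_def by blast
  then show False using \<xi> supp by blast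
qed

text \<open>
  The Taylor series, at a real point, of the entire extension of the symbol. The exponential
  series converges uniformly for \<open>w\<close> in \<open>[-R, R]\<close>, so \<open>L\<close> can be applied termwise.
\<close>

lemma power_series_of_symbol:
  assumes L: "C0_functional R L"
  shows "(\<lambda>n. L (\<lambda>w. (\<i> * of_real w) ^ n / fact n * exp (\<i> * of_real (\<xi> * w))) * z ^ n) sums
    L (\<lambda>w. exp (\<i> * of_real w * (of_real \<xi> + z)))"
proof -
  let ?e = "\<lambda>n w. (\<i> * of_real w) ^ n / fact n * exp (\<i> * of_real (\<xi> * w)) :: complex"
  have cont: "continuous_on UNIV (?e n)" for n by (intro continuous_intros) auto
  define T where "T n w = (\<Sum>k<n. ?e k w * z ^ k)" for n and w :: real
  have Tcont: "continuous_on UNIV (T n)" for n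
    unfolding T_def by (intro continuous_intros cont)
  have "uniform_limit {-R..R} T (\<lambda>w. \<Sum>k. ?e k w * z ^ k) sequentially"
    unfolding T_def
  proof (rule Weierstrass_m_test)
    show "summable (\<lambda>n. (\<bar>R\<bar> * norm z) ^ n / fact n)"
      using summable_exp_generic[of "\<bar>R\<bar> * norm z"] by (simp add: field_simps)
    fix n w assume w: "w \<in> {-R..R}"
    have "norm (?e n w * z ^ n) = (\<bar>w\<bar> * norm z) ^ n / fact n"
      using norm_exp_i_times[of "\<xi> * w"] by (simp add: norm_mult norm_divide norm_power power_mult_distrib)
    also have "\<dots> \<le> (\<bar>R\<bar> * norm z) ^ n / fact n"
      using w by (intro divide_right_mono power_mono mult_right_mono) auto
    finally show "norm (?e n w * z ^ n) \<le> (\<bar>R\<bar> * norm z) ^ n / fact n" .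
  qed
  also have "(\<lambda>w. \<Sum>k. ?e k w * z ^ k) = (\<lambda>w. exp (\<i> * of_real w * (of_real \<xi> + z)))"
  proof
    fix w :: real
    have "(\<lambda>n. (\<i> * of_real w * z) ^ n /\<^sub>R fact n) sums exp (\<i> * of_real w * z)"
      by (rule exp_converges)
    from sums_mult2[OF this, of "exp (\<i> * of_real (\<xi> * w))"]
    have "(\<lambda>n. ?e n w * z ^ n) sums (exp (\<i> * of_real w * z) * exp (\<i> * of_real (\<xi> * w)))"
      by (simp add: power_mult_distrib scaleR_conv_of_real field_simps)
    then show "(\<Sum>n. ?e n w * z ^ n) = exp (\<i> * of_real w * (of_real \<xi> + z))"
      by (simp add: sums_iff exp_add[symmetric] algebra_simps)
  qed
  finally have "(\<lambda>n. L (T n)) \<longlonglongrightarrow> L (\<lambda>w. exp (\<i> * of_real w * (of_real \<xi> + z)))"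
    by (intro C0_functional_tendsto[OF L Tcont]) (intro continuous_intros)
  moreover have "L (T n) = (\<Sum>k<n. L (?e k) * z ^ k)" for n
  proof -
    have "L (T n) = (\<Sum>k<n. L (\<lambda>w. ?e k w * z ^ k))"
      unfolding T_def by (rule C0_functional_sum[OF L]) (auto intro!: continuous_intros cont)
    moreover have "L (\<lambda>w. ?e k w * z ^ k) = L (?e k) * z ^ k" for k
      using C0_functional_scale[OF L cont[of k], of "z ^ k"] by (simp add: mult.commute)
    ultimately show ?thesis by simp
  qed
  ultimately show ?thesis by (simp add: sums_def)
qed

text \<open>
  The identity theorem: the entire extension of the symbol has a non-isolated zero at \<open>\<xi>\<close>, so its
  Taylor coefficients there are zero.
\<close>

lemma moments_vanish_at_accumulated_zero:
  assumes L: "C0_functional R L" and acc: "\<xi> islimpt {\<xi>. L (\<lambda>w. cis (\<xi> * w)) = 0}"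
  shows "L (\<lambda>w. of_real w ^ n * cis (\<xi> * w)) = 0"
proof -
  \<comment> \<open>the entire extension of the symbol\<close>
  define f where "f z = L (\<lambda>w. exp (\<i> * of_real w * z))" for z
  define c where "c n = L (\<lambda>w. (\<i> * of_real w) ^ n / fact n * exp (\<i> * of_real (\<xi> * w)))" for n
  have f_real: "f (of_real t) = L (\<lambda>w. cis (t * w))" for t
    by (simp add: f_def cis_conv_exp mult_ac)
  have sm: "(\<lambda>n. c n * (z - of_real \<xi>) ^ n) sums f z" for z
    using power_series_of_symbol[OF L, of \<xi> "z - of_real \<xi>"] by (simp add: c_def f_def)
  have "closed {\<xi>. L (\<lambda>w. cis (\<xi> * w)) = 0}"
    by (intro closed_Collect_eq smooth_continuous[OF smooth_symbol[OF L]] continuous_on_const)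
  then have f0: "f (of_real \<xi>) = 0"
    using acc unfolding closed_limpt f_real by blast
  have cn: "c m = 0" for m
  proof (cases "m = 0")
    case True
    then show ?thesis using f0 by (simp add: c_def f_def mult_ac)
  next
    case False
    show ?thesis
    proof (rule ccontr)
      assume "c m \<noteq> 0"
      then obtain s where s: "0 < s" "\<And>z. z \<in> cball (of_real \<xi>) s - {of_real \<xi>} \<Longrightarrow> f z \<noteq> 0"
        using powser_0_nonzero[of 1 "of_real \<xi>" c f m] sm f0 False by (metis less_numeral_extra(1) neq0_conv)
      obtain t where t: "f (of_real t) = 0" "t \<noteq> \<xi>" "dist t \<xi> < s"
        using acc s(1) unfolding islimpt_approachable f_real[symmetric] by blast
      have "of_real t \<in> cball (of_real \<xi> :: complex) s - {of_real \<xi>}"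
        using t(2,3) by (auto simp: dist_norm norm_minus_commute simp flip: of_real_diff)
      from s(2)[OF this] t(1) show False by simp
    qed
  qed
  have "continuous_on UNIV (\<lambda>w. (\<i> * of_real w) ^ n / fact n * exp (\<i> * of_real (\<xi> * w)))"
    by (intro continuous_intros) auto
  from C0_functional_scale[OF L this, of "fact n / \<i> ^ n"] cn[of n]
  show ?thesis by (simp add: c_def cis_conv_exp power_mult_distrib)
qed

text \<open>
  On \<open>[-R, R]\<close>, \<open>e\<close> is uniformly close to \<open>p w exp (\<i> \<xi> w)\<close> for a polynomial \<open>p\<close> that
  approximates \<open>e w exp (- \<i> \<xi> w)\<close>, because the exponentials have modulus one; \<open>L\<close> annihilates
  these functions.
\<close>

lemma C0_functional_vanishes:
  assumes L: "C0_functional R L" and acc: "\<xi> islimpt {\<xi>. L (\<lambda>w. cis (\<xi> * w)) = 0}"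
    and e: "continuous_on UNIV e"
  shows "L e = 0"
proof -
  obtain C where C: "C \<ge> 0"
    "\<And>e B. continuous_on UNIV e \<Longrightarrow> (\<And>w. w \<in> {-R..R} \<Longrightarrow> norm (e w) \<le> B) \<Longrightarrow> norm (L e) \<le> C * B"
    using C0_functional_bound[OF L] by metis
  have cis: "continuous_on UNIV (\<lambda>w. cis (s * w))" for s
    unfolding cis_conv_exp by (intro continuous_intros)
  have poly0: "L (\<lambda>w. of_real (p w) * cis (\<xi> * w)) = 0"
    "continuous_on UNIV (\<lambda>w. of_real (p w) * cis (\<xi> * w))"
    if poly: "real_polynomial_function p" for p :: "real \<Rightarrow> real"
  proof -
    obtain a n where p: "p = (\<lambda>x. \<Sum>i\<le>n. a i * x ^ i)"
      using poly unfolding real_polynomial_function_iff_sum by (elim exE)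
    show "continuous_on UNIV (\<lambda>w. of_real (p w) * cis (\<xi> * w))"
      unfolding p by (intro continuous_intros cis)
    have "L (\<lambda>w. of_real (p w) * cis (\<xi> * w)) = L (\<lambda>w. \<Sum>i\<le>n. of_real (a i) * (of_real w ^ i * cis (\<xi> * w)))"
      by (simp add: p sum_distrib_right mult.assoc)
    also have "\<dots> = (\<Sum>i\<le>n. L (\<lambda>w. of_real (a i) * (of_real w ^ i * cis (\<xi> * w))))"
      by (rule C0_functional_sum[OF L]) (auto intro!: continuous_intros cis)
    also have "\<dots> = (\<Sum>i\<le>n. of_real (a i) * L (\<lambda>w. of_real w ^ i * cis (\<xi> * w)))"
      by (intro sum.cong refl C0_functional_scale[OF L] continuous_intros cis)
    finally show "L (\<lambda>w. of_real (p w) * cis (\<xi> * w)) = 0"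
      using moments_vanish_at_accumulated_zero[OF L acc] by simp
  qed
  have "norm (L e) \<le> C * \<epsilon>" if "\<epsilon> > 0" for \<epsilon>
  proof -
    have "continuous_on {-R..R} (\<lambda>w. e w * cis (- (\<xi> * w)))"
      using cis[of "-\<xi>"] e by (auto intro!: continuous_intros intro: continuous_on_subset)
    from Stone_Weierstrass_polynomial_function[OF compact_Icc this that]
    obtain p :: "real \<Rightarrow> complex" where p: "polynomial_function p"
      "\<And>w. w \<in> {-R..R} \<Longrightarrow> norm (e w * cis (- (\<xi> * w)) - p w) < \<epsilon>" by blast
    define r i where "r w = Re (p w)" and "i w = Im (p w)" for w
    have ri: "real_polynomial_function r" "real_polynomial_function i"
      using p(1) bounded_linear_Re bounded_linear_Im
      unfolding polynomial_function_def r_def[abs_def] i_def[abs_def] by (auto simp: o_def)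
    let ?p = "\<lambda>w. of_real (r w) * cis (\<xi> * w) + \<i> * (of_real (i w) * cis (\<xi> * w))"
    have p_eq: "?p w = p w * cis (\<xi> * w)" for w
      by (simp add: complex_eq_iff r_def i_def)
    have cp: "continuous_on UNIV ?p" by (intro continuous_intros poly0 ri)
    have "L ?p = 0"
      using poly0[OF ri(1)] poly0[OF ri(2)]
        C0_functional_add[OF L poly0(2)[OF ri(1)], of "\<lambda>w. \<i> * (of_real (i w) * cis (\<xi> * w))"]
        C0_functional_scale[OF L poly0(2)[OF ri(2)], of \<i>]
      by (simp add: continuous_on_mult_left)
    then have "L e = L (\<lambda>w. e w - ?p w)"
      using C0_functional_diff[OF L e cp] by simp
    also have "norm \<dots> \<le> C * \<epsilon>"
    proof (rule C(2))
      show "continuous_on UNIV (\<lambda>w. e w - ?p w)" by (intro continuous_on_diff e cp)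
      fix w assume w: "w \<in> {-R..R}"
      have "e w - ?p w = (e w * cis (- (\<xi> * w)) - p w) * cis (\<xi> * w)"
        by (simp add: p_eq left_diff_distrib mult.assoc cis_mult)
      then show "norm (e w - ?p w) \<le> \<epsilon>" using p(2)[OF w] by (simp add: norm_mult)
    qed
    finally show ?thesis .
  qed
  then have approx: "norm (L e) \<le> C * \<epsilon>" if "\<epsilon> > 0" for \<epsilon> using that .
  have "norm (L e) \<le> 0 + \<epsilon>" if "\<epsilon> > 0" for \<epsilon>
  proof -
    have "norm (L e) \<le> C * (\<epsilon> / (C + 1))" using C(1) that by (intro approx) simp
    also have "\<dots> \<le> \<epsilon>" using C(1) that by (simp add: field_simps)
    finally show ?thesis by simp
  qed
  then have "norm (L e) \<le> 0" by (rule field_le_epsilon)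
  then show ?thesis by simp
qed

section \<open>Primitives depending on parameters\<close>

text \<open>
  The oriented integral of \<open>h\<close> from \<open>0\<close> to \<open>u\<close>, for \<open>u\<close> of either sign, written over a fixed
  interval so that continuity and differentiability in parameters come from the theorems on
  parameter integrals.
\<close>

definition sint :: "(real \<Rightarrow> 'a::banach) \<Rightarrow> real \<Rightarrow> 'a" where
  "sint h u = u *\<^sub>R integral {0..1} (\<lambda>s. h (s * u))"

lemma sint_eq_antiderivative:
  assumes X: "convex X" "0 \<in> X" "u \<in> X"
    and F: "\<And>w. w \<in> X \<Longrightarrow> (F has_vector_derivative h w) (at w within X)"
  shows "sint h u = F u - F 0"
proof -
  have "((\<lambda>s. u *\<^sub>R h (s * u)) has_integral F (1 * u) - F (0 * u)) {0..1}"
  proof (rule fundamental_theorem_of_calculus)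
    fix s :: real assume s: "s \<in> {0..1}"
    have sub: "(\<lambda>s. s * u) ` {0..1} \<subseteq> X"
    proof (clarify)
      fix s :: real assume "s \<in> {0..1}"
      then show "s * u \<in> X"
        using convexD[OF X(1,3,2), of s "1 - s"] by simp
    qed
    have "((\<lambda>s. s * u) has_vector_derivative u) (at s within {0..1})"
      by (auto intro!: derivative_eq_intros)
    moreover have "(F has_vector_derivative h (s * u)) (at (s * u) within (\<lambda>s. s * u) ` {0..1})"
      by (rule has_vector_derivative_within_subset[OF F sub]) (use sub s in blast)
    ultimately show "((\<lambda>s. F (s * u)) has_vector_derivative u *\<^sub>R h (s * u)) (at s within {0..1})"
      using vector_diff_chain_within[of "\<lambda>s. s * u" u s "{0..1}" F "h (s * u)"] by (simp add: o_def)
  qed simp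
  from integral_unique[OF this] show ?thesis by (simp add: sint_def)
qed

lemma sint_has_vector_derivative:
  assumes "continuous_on UNIV h"
  shows "(sint h has_vector_derivative h u) (at u)"
proof -
  \<comment> \<open>the larger interval has \<open>u\<close> in its interior, where one-sided derivatives are two-sided\<close>
  define B where "B = \<bar>u\<bar> + 1"
  obtain F where F: "\<And>w. w \<in> {-B..B} \<Longrightarrow> (F has_vector_derivative h w) (at w within {-B..B})"
    using antiderivative_continuous[OF continuous_on_subset[OF assms subset_UNIV]] by metis
  have u: "u \<in> {-B<..<B}" by (auto simp: B_def)
  have "((\<lambda>y. F y - F 0) has_vector_derivative h u) (at u within {-B..B})"
    using F[of u] u by (auto intro!: derivative_eq_intros)
  then have "((\<lambda>y. F y - F 0) has_vector_derivative h u) (at u)"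
    using u at_within_interior[of u "{-B..B}"] by simp
  then show ?thesis
  proof (rule has_vector_derivative_transform_within_open[OF _ open_greaterThanLessThan u])
    fix y assume "y \<in> {-B<..<B}"
    then show "F y - F 0 = sint h y"
      using sint_eq_antiderivative[OF _ _ _ F, of y] by (auto simp: B_def)
  qed
qed

lemma sint_continuous_on:
  assumes "continuous_on (Z \<times> UNIV) (\<lambda>(z, w). h z w)"
  shows "continuous_on (Z \<times> UNIV) (\<lambda>(z, u). sint (h z) u)"
proof -
  have "continuous_on ((Z \<times> UNIV) \<times> cbox 0 1) (\<lambda>(p, s). h (fst p) (s * snd p))"
    using continuous_on_compose2[OF assms, of "(Z \<times> UNIV) \<times> cbox 0 1" "\<lambda>(p, s). (fst p, s * snd p)"]
    by (force simp: case_prod_beta' intro!: continuous_intros)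
  from integral_continuous_on_param[OF this] show ?thesis
    unfolding sint_def case_prod_beta' by (auto intro!: continuous_intros)
qed

lemma sint_parameter_derivative:
  fixes h :: "real \<Rightarrow> real \<Rightarrow> 'a::banach"
  assumes X: "convex X" "x \<in> X"
    and h: "\<And>y. y \<in> X \<Longrightarrow> continuous_on UNIV (h y)"
    and der: "\<And>y w. y \<in> X \<Longrightarrow> ((\<lambda>y. h y w) has_vector_derivative h' y w) (at y within X)"
    and cont: "continuous_on (X \<times> UNIV) (\<lambda>(y, w). h' y w)"
  shows "((\<lambda>y. sint (h y) u) has_vector_derivative sint (h' x) u) (at x within X)"
proof -
  have "((\<lambda>y. integral (cbox 0 1) (\<lambda>s. h y (s * u))) has_vector_derivative
      integral (cbox 0 1) (\<lambda>s. h' x (s * u))) (at x within X)"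
  proof (rule leibniz_rule_vector_derivative[OF der])
    show "(\<lambda>s. h y (s * u)) integrable_on cbox 0 1" if "y \<in> X" for y
      by (intro integrable_continuous continuous_on_compose2[OF h[OF that]] continuous_intros) auto
    show "continuous_on (X \<times> cbox 0 1) (\<lambda>(y, s). h' y (s * u))"
      using continuous_on_compose2[OF cont, of "X \<times> cbox 0 1" "\<lambda>(y, s). (y, s * u)"]
      by (force simp: case_prod_beta' intro!: continuous_intros)
  qed (use X in auto)
  from has_vector_derivative_scaleR[OF DERIV_const[of u] this] show ?thesis
    by (simp add: sint_def)
qed

lemma sint_add:
  assumes "continuous_on UNIV h" "continuous_on UNIV k"
  shows "sint (\<lambda>w. h w + k w) u = sint h u + sint k u"
proof -
  have "(\<lambda>s. h (s * u)) integrable_on {0..1}" "(\<lambda>s. k (s * u)) integrable_on {0..1}"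
    by (intro integrable_continuous_interval continuous_on_compose2[OF assms(1)]
        continuous_on_compose2[OF assms(2)] continuous_intros; auto)+
  then show ?thesis by (simp add: sint_def integral_add scaleR_add_right)
qed

lemma sint_bounded_linear:
  assumes "bounded_linear T" "continuous_on UNIV h"
  shows "sint (\<lambda>w. T (h w)) u = T (sint h u)"
proof -
  have "(\<lambda>s. h (s * u)) integrable_on {0..1}"
    by (intro integrable_continuous_interval continuous_on_compose2[OF assms(2)] continuous_intros) auto
  from integral_linear[OF this assms(1)] show ?thesis
    by (simp add: sint_def o_def linear_scale[OF bounded_linear.linear[OF assms(1)]])
qed

lemma sint_bound:
  assumes "continuous_on UNIV h" "\<And>w. w \<in> {-R..R} \<Longrightarrow> norm (h w) \<le> B" "\<bar>u\<bar> \<le> R"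
  shows "norm (sint h u) \<le> R * B"
proof -
  have "norm (h 0) \<le> B" by (rule assms(2)) (use assms(3) in auto)
  then have B: "B \<ge> 0" by (rule order_trans[OF norm_ge_zero])
  have "(\<lambda>s. h (s * u)) integrable_on cbox 0 1"
    by (intro integrable_continuous continuous_on_compose2[OF assms(1)] continuous_intros) auto
  then have "norm (integral (cbox 0 1) (\<lambda>s. h (s * u))) \<le> B * measure lborel (cbox 0 (1::real))"
  proof (rule has_integral_bound[OF B integrable_integral])
    fix s :: real assume s: "s \<in> cbox 0 1"
    then have "\<bar>s * u\<bar> \<le> 1 * R" unfolding abs_mult using assms(3) by (intro mult_mono) auto
    then show "norm (h (s * u)) \<le> B" by (intro assms(2)) auto
  qed
  then have "norm (integral {0..1} (\<lambda>s. h (s * u))) \<le> B" by simp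
  then show ?thesis
    using assms(3) B by (simp add: sint_def mult_mono)
qed

lemma sint_sum:
  assumes "finite A" "\<And>i. i \<in> A \<Longrightarrow> continuous_on UNIV (h i)"
  shows "sint (\<lambda>w. \<Sum>i\<in>A. h i w) u = (\<Sum>i\<in>A. sint (h i) u)"
  using assms
proof (induction A rule: finite_induct)
  case empty
  then show ?case by (simp add: sint_def)
next
  case (insert i A)
  then show ?case using sint_add[of "h i" "\<lambda>w. \<Sum>i\<in>A. h i w" u] by (simp add: continuous_on_sum)
qed

section \<open>Differentiability from continuous partial derivatives\<close>

lemma has_vector_derivative_shift:
  assumes "((\<lambda>s. g (c + s)) has_vector_derivative d) (at 0 within {s. c + s \<in> X})"
  shows "(g has_vector_derivative d) (at c within X)"
proof -
  have "((\<lambda>w. w - c) has_vector_derivative 1) (at c within X)"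
    by (auto intro!: derivative_eq_intros)
  moreover have "(\<lambda>w. w - c) ` X = {s. c + s \<in> X}"
    by (force simp: image_iff)
  ultimately show ?thesis
    using vector_diff_chain_within[of "\<lambda>w. w - c" 1 c X "\<lambda>s. g (c + s)" d] assms by (simp add: o_def)
qed

lemma norm_le_Basis_components:
  fixes x y :: "'a::euclidean_space"
  assumes "\<And>b. b \<in> Basis \<Longrightarrow> \<bar>x \<bullet> b\<bar> \<le> \<bar>y \<bullet> b\<bar>"
  shows "norm x \<le> norm y"
  unfolding norm_le euclidean_inner[of x x] euclidean_inner[of y y]
  by (intro sum_mono) (use assms in \<open>simp add: abs_le_square_iff flip: power2_eq_square\<close>)

text \<open>
  The classical criterion for Frechet differentiability, on a product of intervals that need not be
  open: from \<open>z\<close> one reaches \<open>y\<close> by changing one coordinate after the other without leaving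
  \<open>S\<close>, and the mean value inequality applies on each segment.
\<close>

lemma has_derivative_within_box:
  fixes h :: "'a::euclidean_space \<Rightarrow> 'b::real_normed_vector"
  assumes S: "S = {z. \<forall>b\<in>Basis. z \<bullet> b \<in> J b}" and J: "\<And>b. b \<in> Basis \<Longrightarrow> convex (J b)"
    and part: "\<And>z b. z \<in> S \<Longrightarrow> b \<in> Basis \<Longrightarrow>
      ((\<lambda>s. h (z + s *\<^sub>R b)) has_vector_derivative D b z) (at 0 within {s. z \<bullet> b + s \<in> J b})"
    and cont: "\<And>b. b \<in> Basis \<Longrightarrow> continuous_on S (D b)"
    and z: "z \<in> S"
  shows "(h has_derivative (\<lambda>v. \<Sum>b\<in>Basis. (v \<bullet> b) *\<^sub>R D b z)) (at z within S)"
proof -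
  have "\<exists>d>0. \<forall>y\<in>S. norm (y - z) < d \<longrightarrow>
      norm (h y - h z - (\<Sum>b\<in>Basis. ((y - z) \<bullet> b) *\<^sub>R D b z)) \<le> \<epsilon> * norm (y - z)" if "\<epsilon> > 0" for \<epsilon>
  proof -
    \<comment> \<open>the errors of the coordinate steps add up to \<open>\<epsilon> |y - z|\<close>\<close>
    define c where "c = \<epsilon> / real DIM('a)"
    have c: "c > 0" using that by (simp add: c_def)
    have "\<forall>b\<in>Basis. \<exists>d>0. \<forall>y\<in>S. dist y z < d \<longrightarrow> dist (D b y) (D b z) < c"
      using cont z c unfolding continuous_on_iff by blast
    then obtain d where d: "\<And>b. b \<in> Basis \<Longrightarrow> d b > 0"
      "\<And>b y. b \<in> Basis \<Longrightarrow> y \<in> S \<Longrightarrow> dist y z < d b \<Longrightarrow> dist (D b y) (D b z) < c"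
      by metis
    define \<delta> where "\<delta> = Min (d ` Basis)"
    have \<delta>: "\<delta> > 0" "\<And>b. b \<in> Basis \<Longrightarrow> \<delta> \<le> d b"
      using d(1) by (auto simp: \<delta>_def)
    have "norm (h y - h z - (\<Sum>b\<in>Basis. ((y - z) \<bullet> b) *\<^sub>R D b z)) \<le> \<epsilon> * norm (y - z)"
      if y: "y \<in> S" "norm (y - z) < \<delta>" for y
    proof -
      \<comment> \<open>the point that agrees with \<open>y\<close> in the coordinates of \<open>A\<close> and with \<open>z\<close> in the others\<close>
      define p where "p A = z + (\<Sum>b\<in>A. ((y - z) \<bullet> b) *\<^sub>R b)" for A
      have p_inner: "p A \<bullet> b = (if b \<in> A then y \<bullet> b else z \<bullet> b)" if "A \<subseteq> Basis" "b \<in> Basis" for A b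
      proof -
        have "(\<Sum>b'\<in>A. ((y - z) \<bullet> b') *\<^sub>R b') \<bullet> b = (\<Sum>b'\<in>A. if b' = b then (y - z) \<bullet> b' else 0)"
          unfolding inner_sum_left
          by (rule sum.cong) (use that in \<open>auto simp: inner_Basis\<close>)
        then show ?thesis
          using finite_subset[OF that(1) finite_Basis] by (simp add: p_def inner_add_left inner_diff_left)
      qed
      have "norm (h (p A) - h z - (\<Sum>b\<in>A. ((y - z) \<bullet> b) *\<^sub>R D b z)) \<le> (\<Sum>b\<in>A. c * \<bar>(y - z) \<bullet> b\<bar>)"
        if "finite A" "A \<subseteq> Basis" for A
        using that
      proof (induction A rule: finite_induct)
        case empty
        then show ?case by (simp add: p_def)
      next
        case (insert b A)
        then have b: "b \<in> Basis" "A \<subseteq> Basis" "b \<notin> A" by auto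
        let ?q = "p A" and ?\<tau> = "(y - z) \<bullet> b"
        let ?I = "closed_segment 0 ?\<tau>"
        have J_seg: "z \<bullet> b + \<sigma> \<in> J b" "\<bar>\<sigma>\<bar> \<le> \<bar>?\<tau>\<bar>" if \<sigma>: "\<sigma> \<in> ?I" for \<sigma>
        proof -
          obtain s where s: "0 \<le> s" "s \<le> 1" "\<sigma> = s * ?\<tau>"
            using \<sigma> by (auto simp: closed_segment_def)
          have "(1 - s) *\<^sub>R (z \<bullet> b) + s *\<^sub>R (y \<bullet> b) \<in> J b"
            using J[OF b(1)] z y(1) b(1) s unfolding S by (intro convexD) auto
          then show "z \<bullet> b + \<sigma> \<in> J b" by (simp add: s(3) inner_diff_left algebra_simps)
          show "\<bar>\<sigma>\<bar> \<le> \<bar>?\<tau>\<bar>" using s mult_right_mono[of s 1 "\<bar>?\<tau>\<bar>"] by (simp add: abs_mult)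
        qed
        have r_inner: "(?q + \<sigma> *\<^sub>R b) \<bullet> b' = (if b' = b then z \<bullet> b + \<sigma> else if b' \<in> A then y \<bullet> b' else z \<bullet> b')"
          if "b' \<in> Basis" for \<sigma> b'
          using b that p_inner[OF b(2) that] by (auto simp: inner_add_left inner_Basis)
        have r_S: "?q + \<sigma> *\<^sub>R b \<in> S" if "\<sigma> \<in> ?I" for \<sigma>
          using z y(1) J_seg(1)[OF that] unfolding S by (auto simp: r_inner)
        have r_near: "dist (?q + \<sigma> *\<^sub>R b) z < \<delta>" if "\<sigma> \<in> ?I" for \<sigma>
        proof -
          have "norm (?q + \<sigma> *\<^sub>R b - z) \<le> norm (y - z)"
            by (rule norm_le_Basis_components)
               (use J_seg(2)[OF that] in \<open>auto simp: inner_diff_left r_inner\<close>)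
          then show ?thesis using y(2) by (simp add: dist_norm)
        qed
        \<comment> \<open>subtracting the linear part at \<open>z\<close> leaves a function with small derivative\<close>
        define k where "k \<sigma> = h (?q + \<sigma> *\<^sub>R b) - \<sigma> *\<^sub>R D b z" for \<sigma>
        have "norm (k ?\<tau> - k 0) \<le> c * norm (?\<tau> - 0)"
        proof (rule differentiable_bound[of ?I])
          fix \<sigma> assume \<sigma>: "\<sigma> \<in> ?I"
          have "((\<lambda>s. h (?q + \<sigma> *\<^sub>R b + s *\<^sub>R b)) has_vector_derivative D b (?q + \<sigma> *\<^sub>R b))
              (at 0 within {s. (?q + \<sigma> *\<^sub>R b) \<bullet> b + s \<in> J b})"
            by (rule part[OF r_S[OF \<sigma>] b(1)])
          then have "((\<lambda>s. h (?q + \<sigma> *\<^sub>R b + s *\<^sub>R b)) has_vector_derivative D b (?q + \<sigma> *\<^sub>R b))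
              (at 0 within {s. \<sigma> + s \<in> ?I})"
          proof (rule has_vector_derivative_within_subset, intro subsetI CollectI)
            fix s assume "s \<in> {s. \<sigma> + s \<in> ?I}"
            then have "z \<bullet> b + (\<sigma> + s) \<in> J b" using J_seg(1) by blast
            then show "(?q + \<sigma> *\<^sub>R b) \<bullet> b + s \<in> J b"
              by (simp only: r_inner[OF b(1)] if_True simp_thms add.assoc)
          qed
          then have "((\<lambda>\<sigma>. h (?q + \<sigma> *\<^sub>R b)) has_vector_derivative D b (?q + \<sigma> *\<^sub>R b)) (at \<sigma> within ?I)"
            using has_vector_derivative_shift[of "\<lambda>\<sigma>. h (?q + \<sigma> *\<^sub>R b)" \<sigma> "D b (?q + \<sigma> *\<^sub>R b)" ?I]
            by (simp only: scaleR_add_left add.assoc)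
          then have "(k has_vector_derivative D b (?q + \<sigma> *\<^sub>R b) - D b z) (at \<sigma> within ?I)"
            unfolding k_def[abs_def]
          proof (rule has_vector_derivative_diff)
            show "((\<lambda>\<sigma>. \<sigma> *\<^sub>R D b z) has_vector_derivative D b z) (at \<sigma> within ?I)"
              by (auto simp: has_vector_derivative_def intro!: derivative_eq_intros)
          qed
          then show "(k has_derivative (\<lambda>v. v *\<^sub>R (D b (?q + \<sigma> *\<^sub>R b) - D b z))) (at \<sigma> within ?I)"
            by (simp add: has_vector_derivative_def)
          have "norm (D b (?q + \<sigma> *\<^sub>R b) - D b z) \<le> c"
            using d(2)[OF b(1) r_S[OF \<sigma>]] r_near[OF \<sigma>] \<delta>(2)[OF b(1)] by (simp add: dist_norm)
          then show "onorm (\<lambda>v. v *\<^sub>R (D b (?q + \<sigma> *\<^sub>R b) - D b z)) \<le> c"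
            by (intro onorm_le) (simp add: mult.commute[of c] mult_left_mono)
        qed auto
        moreover have "p (insert b A) = ?q + ?\<tau> *\<^sub>R b"
          using insert.hyps by (simp add: p_def add_ac)
        ultimately have "norm (h (p (insert b A)) - h ?q - ?\<tau> *\<^sub>R D b z) \<le> c * \<bar>?\<tau>\<bar>"
          by (simp add: k_def diff_diff_eq add.commute)
        moreover have "norm (h ?q - h z - (\<Sum>b\<in>A. ((y - z) \<bullet> b) *\<^sub>R D b z)) \<le> (\<Sum>b\<in>A. c * \<bar>(y - z) \<bullet> b\<bar>)"
          using insert.IH b(2) by blast
        ultimately have "norm ((h (p (insert b A)) - h ?q - ?\<tau> *\<^sub>R D b z) +
            (h ?q - h z - (\<Sum>b\<in>A. ((y - z) \<bullet> b) *\<^sub>R D b z))) \<le> c * \<bar>?\<tau>\<bar> + (\<Sum>b\<in>A. c * \<bar>(y - z) \<bullet> b\<bar>)"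
          by (rule norm_triangle_mono)
        then show ?case using insert.hyps by (simp add: algebra_simps)
      qed
      from this[OF finite_Basis subset_refl]
      have "norm (h y - h z - (\<Sum>b\<in>Basis. ((y - z) \<bullet> b) *\<^sub>R D b z)) \<le> (\<Sum>b\<in>Basis. c * \<bar>(y - z) \<bullet> b\<bar>)"
        by (simp add: p_def euclidean_representation)
      also have "\<dots> \<le> (\<Sum>b\<in>(Basis::'a set). c * norm (y - z))"
        using c by (intro sum_mono mult_left_mono Basis_le_norm) auto
      also have "\<dots> = \<epsilon> * norm (y - z)" by (simp add: c_def)
      finally show ?thesis .
    qed
    then show ?thesis using \<delta>(1) by blast
  qed
  then show ?thesis
    unfolding has_derivative_within_alt
    by (auto intro!: bounded_linear_sum bounded_linear_scaleR_left[THEN bounded_linear_compose] bounded_linear_inner_left simp: o_def)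
qed

lemma C_k_on_1_box:
  fixes h :: "'a::euclidean_space \<Rightarrow> 'b::real_normed_vector"
  assumes S: "S = {z. \<forall>b\<in>Basis. z \<bullet> b \<in> J b}" and J: "\<And>b. b \<in> Basis \<Longrightarrow> convex (J b)"
    and part: "\<And>b. b \<in> Basis \<Longrightarrow> \<exists>D. continuous_on S D \<and> (\<forall>z\<in>S.
      ((\<lambda>s. h (z + s *\<^sub>R b)) has_vector_derivative D z) (at 0 within {s. z \<bullet> b + s \<in> J b}))"
  shows "C_k_on 1 S h"
proof -
  obtain D where D: "\<And>b. b \<in> Basis \<Longrightarrow> continuous_on S (D b)"
    "\<And>b z. b \<in> Basis \<Longrightarrow> z \<in> S \<Longrightarrow>
      ((\<lambda>s. h (z + s *\<^sub>R b)) has_vector_derivative D b z) (at 0 within {s. z \<bullet> b + s \<in> J b})"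
    using part by metis
  have "\<forall>z\<in>S. (h has_derivative (\<lambda>v. \<Sum>b\<in>Basis. (v \<bullet> b) *\<^sub>R D b z)) (at z within S)"
    using has_derivative_within_box[OF S J D(2) D(1)] by blast
  moreover have "continuous_on S (\<lambda>z. \<Sum>b\<in>Basis. (v \<bullet> b) *\<^sub>R D b z)" for v
    by (intro continuous_intros D)
  ultimately show ?thesis
    unfolding One_nat_def C_k_on.simps
    by (intro exI[of _ "\<lambda>z v. \<Sum>b\<in>Basis. (v \<bullet> b) *\<^sub>R D b z"] conjI allI)
qed

lemma C_k_on_1_directional:
  assumes "C_k_on 1 S h"
  obtains h' where "\<And>v. continuous_on S (\<lambda>z. h' z v)"
    "\<And>z v X. z \<in> S \<Longrightarrow> (\<And>s. s \<in> X \<Longrightarrow> z + s *\<^sub>R v \<in> S) \<Longrightarrow>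
      ((\<lambda>s. h (z + s *\<^sub>R v)) has_vector_derivative h' z v) (at 0 within X)"
proof -
  have "C_k_on (Suc 0) S h" using assms by simp
  then obtain h' where h': "\<And>z. z \<in> S \<Longrightarrow> (h has_derivative h' z) (at z within S)"
    "\<And>v. continuous_on S (\<lambda>z. h' z v)" by auto
  show ?thesis
  proof (rule that[OF h'(2)])
    fix z v X assume z: "z \<in> S" and X: "\<And>s. s \<in> X \<Longrightarrow> z + s *\<^sub>R v \<in> S"
    have "((\<lambda>s. z + s *\<^sub>R v) has_derivative (\<lambda>s. s *\<^sub>R v)) (at 0 within X)"
      by (auto intro!: derivative_eq_intros)
    moreover have "(h has_derivative h' z) (at (z + 0 *\<^sub>R v) within (\<lambda>s. z + s *\<^sub>R v) ` X)"
      using has_derivative_subset[OF h'(1)[OF z], of "(\<lambda>s. z + s *\<^sub>R v) ` X"] X by auto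
    ultimately have "((\<lambda>s. h (z + s *\<^sub>R v)) has_derivative (\<lambda>s. h' z (s *\<^sub>R v))) (at 0 within X)"
      by (rule has_derivative_in_compose)
    then show "((\<lambda>s. h (z + s *\<^sub>R v)) has_vector_derivative h' z v) (at 0 within X)"
      unfolding has_vector_derivative_def
      using linear_cmul[OF has_derivative_linear[OF h'(1)[OF z]]] by simp
  qed
qed

section \<open>The time interval and the partial derivatives of fluxes\<close>

lemma time_interval:
  assumes "I = {0..} \<or> (\<exists>T>0. I = {0..<T::real})"
  shows "convex I" "convex (closure I)" "0 \<in> I" "I \<in> sets borel"
    "t \<in> I \<Longrightarrow> at t within I \<noteq> bot" "t \<in> closure I \<Longrightarrow> at t within closure I \<noteq> bot"
proof -
  show c: "convex I" "0 \<in> I" "I \<in> sets borel" using assms by auto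
  show c': "convex (closure I)" using c by (intro convex_closure)
  have ne: "I \<noteq> {x}" "closure I \<noteq> {x}" for x
  proof -
    obtain y where y: "y \<noteq> 0" "y \<in> I"
      using assms by (auto intro: that[of 1]) (metis atLeastLessThan_iff dense less_irrefl less_imp_le that)
    then show "I \<noteq> {x}" "closure I \<noteq> {x}" using c(2) closure_subset[of I] by (metis singletonD subsetD)+
  qed
  show "at t within I \<noteq> bot" if "t \<in> I"
    using connected_imp_perfect[OF convex_connected[OF c(1)] that ne(1)] by (simp add: trivial_limit_within)
  show "at t within closure I \<noteq> bot" if "t \<in> closure I"
    using connected_imp_perfect[OF convex_connected[OF c'] that ne(2)] by (simp add: trivial_limit_within)
qed

lemma has_vector_derivative_dx:
  assumes "((\<lambda>s. h (x + s *\<^sub>R axis i 1)) has_vector_derivative d) (at 0)"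
  shows "dx i h x = d"
  using assms unfolding dx_def by (rule vector_derivative_at)

lemma continuous_on_C_k_1:
  assumes "C_k_on 1 S h"
  shows "continuous_on S h"
proof -
  have "C_k_on (Suc 0) S h" using assms by simp
  then obtain h' where "\<And>z. z \<in> S \<Longrightarrow> (h has_derivative h' z) (at z within S)" by auto
  then show ?thesis by (rule has_derivative_continuous_on)
qed

text \<open>
  The unpacking of \<^const>\<open>F_class\<close> into derivatives along coordinate lines.
\<close>

lemma F_class_partials:
  fixes \<zeta> :: "real \<times> (real^'n) \<times> real \<Rightarrow> 'b::real_normed_vector"
  assumes \<zeta>: "\<zeta> \<in> F_class I"
  shows F_class_continuous: "continuous_on (closure I \<times> UNIV) \<zeta>"
    and F_class_du: "\<And>t x u. t \<in> closure I \<Longrightarrow> ((\<lambda>w. \<zeta> (t, x, w)) has_vector_derivative du \<zeta> (t, x, u)) (at u)"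
    and F_class_du_continuous: "continuous_on (closure I \<times> UNIV) (du \<zeta>)"
    and F_class_dx: "\<And>t x u i. t \<in> closure I \<Longrightarrow>
      ((\<lambda>s. \<zeta> (t, x + s *\<^sub>R axis i 1, u)) has_vector_derivative dx i (\<lambda>y. \<zeta> (t, y, u)) x) (at 0)"
    and F_class_dx_continuous: "\<And>i. continuous_on (closure I \<times> UNIV) (\<lambda>(t, x, u). dx i (\<lambda>y. \<zeta> (t, y, u)) x)"
    and F_class_dt_du: "\<And>t x u. t \<in> closure I \<Longrightarrow>
      ((\<lambda>s. du \<zeta> (s, x, u)) has_vector_derivative dt (closure I) (du \<zeta>) (t, x, u)) (at t within closure I)"
    and F_class_dt_du_continuous: "continuous_on (closure I \<times> UNIV) (dt (closure I) (du \<zeta>))"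
    and F_class_dx_du: "\<And>t x u i. t \<in> closure I \<Longrightarrow>
      ((\<lambda>s. du \<zeta> (t, x + s *\<^sub>R axis i 1, u)) has_vector_derivative dx i (\<lambda>y. du \<zeta> (t, y, u)) x) (at 0)"
    and F_class_dx_du_continuous: "\<And>i. continuous_on (closure I \<times> UNIV) (\<lambda>(t, x, u). dx i (\<lambda>y. du \<zeta> (t, y, u)) x)"
proof -
  let ?S = "closure I \<times> (UNIV :: ((real^'n) \<times> real) set)"
  have C1: "C_k_on 1 ?S \<zeta>"
    and t: "\<forall>t\<in>closure I. \<forall>x u. (\<lambda>s. du \<zeta> (s, x, u)) differentiable (at t within closure I)"
    and x: "\<And>i. \<forall>t\<in>closure I. \<forall>x u. (\<lambda>s. du \<zeta> (t, x + s *\<^sub>R axis i 1, u)) differentiable (at 0)"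
    using \<zeta> by (simp_all add: F_class_def del: One_nat_def)
  show "continuous_on ?S (dt (closure I) (du \<zeta>))"
    "\<And>i. continuous_on ?S (\<lambda>(t, x, u). dx i (\<lambda>y. du \<zeta> (t, y, u)) x)"
    using \<zeta> by (simp_all add: F_class_def del: One_nat_def)
  show "continuous_on ?S \<zeta>" by (rule continuous_on_C_k_1[OF C1])
  show "((\<lambda>s. du \<zeta> (s, x, u)) has_vector_derivative dt (closure I) (du \<zeta>) (t, x, u)) (at t within closure I)"
    if "t \<in> closure I" for t x u
    using t that by (simp add: dt_def vector_derivative_works)
  show "((\<lambda>s. du \<zeta> (t, x + s *\<^sub>R axis i 1, u)) has_vector_derivative dx i (\<lambda>y. du \<zeta> (t, y, u)) x) (at 0)"
    if "t \<in> closure I" for t x u i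
    using x that by (simp add: dx_def vector_derivative_works)
  obtain \<zeta>' where cont: "\<And>v. continuous_on ?S (\<lambda>z. \<zeta>' z v)" and
    dir: "\<And>z v X. z \<in> ?S \<Longrightarrow> (\<And>s. s \<in> X \<Longrightarrow> z + s *\<^sub>R v \<in> ?S) \<Longrightarrow>
      ((\<lambda>s. \<zeta> (z + s *\<^sub>R v)) has_vector_derivative \<zeta>' z v) (at 0 within X)"
    using C_k_on_1_directional[OF C1] by metis
  have u: "((\<lambda>w. \<zeta> (t, x, w)) has_vector_derivative \<zeta>' (t, x, u) (0, 0, 1)) (at u)"
    if "t \<in> closure I" for t x u
  proof -
    have "((\<lambda>s. \<zeta> (t, x, u + s)) has_vector_derivative \<zeta>' (t, x, u) (0, 0, 1)) (at 0)"
      using dir[of "(t, x, u)" UNIV "(0, 0, 1)"] that by simp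
    then show ?thesis
      using has_vector_derivative_shift[of "\<lambda>w. \<zeta> (t, x, w)" u "\<zeta>' (t, x, u) (0, 0, 1)" UNIV] by simp
  qed
  then have du_eq: "du \<zeta> (t, x, u) = \<zeta>' (t, x, u) (0, 0, 1)" if "t \<in> closure I" for t x u
    using that by (simp add: du_def vector_derivative_at)
  show "((\<lambda>w. \<zeta> (t, x, w)) has_vector_derivative du \<zeta> (t, x, u)) (at u)"
    if "t \<in> closure I" for t x u
    using u du_eq that by simp
  show "continuous_on ?S (du \<zeta>)"
    by (rule continuous_on_eq[OF cont[of "(0, 0, 1)"]]) (auto simp: du_eq)
  have xi: "((\<lambda>s. \<zeta> (t, x + s *\<^sub>R axis i 1, u)) has_vector_derivative \<zeta>' (t, x, u) (0, axis i 1, 0)) (at 0)"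
    if "t \<in> closure I" for t x u i
    using dir[of "(t, x, u)" UNIV "(0, axis i 1, 0)"] that by simp
  then have dx_eq: "dx i (\<lambda>y. \<zeta> (t, y, u)) x = \<zeta>' (t, x, u) (0, axis i 1, 0)" if "t \<in> closure I" for t x u i
    using that by (intro has_vector_derivative_dx) simp
  show "((\<lambda>s. \<zeta> (t, x + s *\<^sub>R axis i 1, u)) has_vector_derivative dx i (\<lambda>y. \<zeta> (t, y, u)) x) (at 0)"
    if "t \<in> closure I" for t x u i
    using xi dx_eq that by simp
  show "continuous_on ?S (\<lambda>(t, x, u). dx i (\<lambda>y. \<zeta> (t, y, u)) x)" for i
    by (rule continuous_on_eq[OF cont[of "(0, axis i 1, 0)"]]) (auto simp: dx_eq)
qed

section \<open>Entropy fluxes\<close>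

definition cscale :: "complex \<Rightarrow> real^'n \<Rightarrow> complex^'n" where
  "cscale c v = (\<chi> i. c * of_real (v $ i))"

lemma cscale_nth [simp]: "cscale c v $ i = c * of_real (v $ i)"
  by (simp add: cscale_def)

interpretation cscale: bounded_bilinear cscale
proof
  show "\<exists>K. \<forall>c (v::real^'n). norm (cscale c v) \<le> norm c * norm v * K"
    by (intro exI[of _ 1]) (simp add: norm_vec_def norm_mult L2_set_right_distrib)
qed (simp_all add: vec_eq_iff algebra_simps scaleR_conv_of_real[where 'a = complex])

text \<open>
  The vector \<open>\<integral>\<^sub>0\<^sup>u e w a (t, x, w) dw\<close>. For \<open>a = \<partial>\<^sub>u f\<close> and \<open>e = H'\<close> it is the entropy flux of
  \<open>H\<close> that vanishes at \<open>u = 0\<close>; for \<open>a\<close> a further derivative of \<open>\<partial>\<^sub>u f\<close> it is the corresponding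
  derivative of this flux.
\<close>

definition flux_of ::
  "(real \<times> (real^'n) \<times> real \<Rightarrow> real^'n) \<Rightarrow> (real \<Rightarrow> complex) \<Rightarrow> real \<times> (real^'n) \<times> real \<Rightarrow> complex^'n" where
  "flux_of a e = (\<lambda>(t, x, u). sint (\<lambda>w. cscale (e w) (a (t, x, w))) u)"

lemma cscale_continuous_on:
  fixes a :: "real \<times> (real^'n) \<times> real \<Rightarrow> real^'n"
  assumes e: "continuous_on UNIV e" and a: "continuous_on (J \<times> UNIV) a"
  shows "continuous_on (J \<times> UNIV) (\<lambda>(t, x, u). cscale (e u) (a (t, x, u)))"
proof -
  have "continuous_on (J \<times> UNIV) (\<lambda>z. cscale (e (snd (snd z))) (a z))"
    by (intro cscale.continuous_on a continuous_on_compose2[OF e] continuous_intros) auto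
  then show ?thesis by (simp add: case_prod_beta')
qed

lemma cscale_continuous_on_u:
  fixes a :: "real \<times> (real^'n) \<times> real \<Rightarrow> real^'n"
  assumes e: "continuous_on UNIV e" and a: "continuous_on (J \<times> UNIV) a" and t: "t \<in> J"
  shows "continuous_on UNIV (\<lambda>w. cscale (e w) (a (t, x, w)))"
proof -
  have "continuous_on UNIV (\<lambda>w. a (t, x, w))"
    by (rule continuous_on_compose2[OF a]) (auto intro!: continuous_intros t)
  with e show ?thesis by (rule cscale.continuous_on)
qed

lemma flux_of_continuous_on:
  fixes a :: "real \<times> (real^'n) \<times> real \<Rightarrow> real^'n"
  assumes e: "continuous_on UNIV e" and a: "continuous_on (J \<times> UNIV) a"
  shows "continuous_on (J \<times> UNIV) (flux_of a e)"
proof -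
  have "continuous_on ((J \<times> UNIV) \<times> UNIV) (\<lambda>((t, x), w). cscale (e w) (a (t, x, w)))"
    unfolding case_prod_beta'
    by (intro cscale.continuous_on continuous_on_compose2[OF a] continuous_on_compose2[OF e] continuous_intros) auto
  then have "continuous_on ((J \<times> UNIV) \<times> UNIV) (\<lambda>(z, w). cscale (e w) (a (fst z, snd z, w)))"
    by (simp add: case_prod_beta')
  from sint_continuous_on[OF this]
  have "continuous_on ((J \<times> UNIV) \<times> UNIV) (\<lambda>(z, u). flux_of a e (fst z, snd z, u))"
    by (simp add: flux_of_def)
  from continuous_on_compose2[OF this, of "J \<times> UNIV" "\<lambda>(t, x, u). ((t, x), u)"]
  show ?thesis by (force simp: case_prod_beta' intro!: continuous_intros)
qed

lemma flux_of_du: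
  fixes a :: "real \<times> (real^'n) \<times> real \<Rightarrow> real^'n"
  assumes e: "continuous_on UNIV e" and a: "continuous_on (J \<times> UNIV) a" and t: "t \<in> J"
  shows "((\<lambda>w. flux_of a e (t, x, w)) has_vector_derivative cscale (e u) (a (t, x, u))) (at u)"
  using sint_has_vector_derivative[OF cscale_continuous_on_u[OF e a t, of x], of u] by (simp add: flux_of_def)

lemma flux_of_dt:
  fixes a a' :: "real \<times> (real^'n) \<times> real \<Rightarrow> real^'n"
  assumes e: "continuous_on UNIV e" and a: "continuous_on (J \<times> UNIV) a" "continuous_on (J \<times> UNIV) a'"
    and J: "convex J" "t \<in> J"
    and der: "\<And>t u. t \<in> J \<Longrightarrow> ((\<lambda>s. a (s, x, u)) has_vector_derivative a' (t, x, u)) (at t within J)"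
  shows "((\<lambda>s. flux_of a e (s, x, u)) has_vector_derivative flux_of a' e (t, x, u)) (at t within J)"
  unfolding flux_of_def prod.case
proof (rule sint_parameter_derivative[OF J])
  show "continuous_on UNIV (\<lambda>w. cscale (e w) (a (y, x, w)))" if "y \<in> J" for y
    by (rule cscale_continuous_on_u[OF e a(1) that])
  show "((\<lambda>y. cscale (e w) (a (y, x, w))) has_vector_derivative cscale (e w) (a' (y, x, w))) (at y within J)"
    if "y \<in> J" for y w
    by (rule bounded_linear.has_vector_derivative[OF cscale.bounded_linear_right der[OF that]])
  show "continuous_on (J \<times> UNIV) (\<lambda>(y, w). cscale (e w) (a' (y, x, w)))"
    unfolding case_prod_beta'
    by (intro cscale.continuous_on continuous_on_compose2[OF a(2)] continuous_on_compose2[OF e] continuous_intros) auto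
qed

lemma flux_of_dx:
  fixes a a' :: "real \<times> (real^'n) \<times> real \<Rightarrow> real^'n"
  assumes e: "continuous_on UNIV e" and a: "continuous_on (J \<times> UNIV) a" "continuous_on (J \<times> UNIV) a'"
    and t: "t \<in> J"
    and der: "\<And>x u. ((\<lambda>s. a (t, x + s *\<^sub>R axis i 1, u)) has_vector_derivative a' (t, x, u)) (at 0)"
  shows "((\<lambda>s. flux_of a e (t, x + s *\<^sub>R axis i 1, u)) has_vector_derivative flux_of a' e (t, x, u)) (at 0)"
proof -
  have "((\<lambda>s. sint (\<lambda>w. cscale (e w) (a (t, x + s *\<^sub>R axis i 1, w))) u) has_vector_derivative
      sint (\<lambda>w. cscale (e w) (a' (t, x + 0 *\<^sub>R axis i 1, w))) u) (at 0 within UNIV)"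
  proof (rule sint_parameter_derivative)
    show "continuous_on UNIV (\<lambda>w. cscale (e w) (a (t, x + y *\<^sub>R axis i 1, w)))" for y
      by (rule cscale_continuous_on_u[OF e a(1) t])
    show "((\<lambda>y. cscale (e w) (a (t, x + y *\<^sub>R axis i 1, w))) has_vector_derivative
        cscale (e w) (a' (t, x + y *\<^sub>R axis i 1, w))) (at y within UNIV)" for y w
    proof (rule bounded_linear.has_vector_derivative[OF cscale.bounded_linear_right])
      have "((\<lambda>s. a (t, x + (y + s) *\<^sub>R axis i 1, w)) has_vector_derivative
          a' (t, x + y *\<^sub>R axis i 1, w)) (at 0)"
        using der[of "x + y *\<^sub>R axis i 1" w] by (simp add: scaleR_add_left add.assoc)
      then show "((\<lambda>y. a (t, x + y *\<^sub>R axis i 1, w)) has_vector_derivative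
          a' (t, x + y *\<^sub>R axis i 1, w)) (at y within UNIV)"
        using has_vector_derivative_shift[of "\<lambda>y. a (t, x + y *\<^sub>R axis i 1, w)" y _ UNIV] by simp
    qed
    show "continuous_on (UNIV \<times> UNIV) (\<lambda>(y, w). cscale (e w) (a' (t, x + y *\<^sub>R axis i 1, w)))"
      unfolding case_prod_beta'
      by (intro cscale.continuous_on continuous_on_compose2[OF a(2)] continuous_on_compose2[OF e] continuous_intros)
         (auto simp: t)
  qed auto
  then show ?thesis by (simp add: flux_of_def)
qed

lemma Basis_space_time_state:
  assumes "b \<in> (Basis :: (real \<times> (real^'n) \<times> real) set)"
  obtains "b = (1, 0, 0)" | i where "b = (0, axis i 1, 0)" | "b = (0, 0, 1)"
  using assms by (auto simp: Basis_prod_def Basis_vec_def zero_prod_def)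

text \<open>
  The partial derivatives of the integral are again such integrals, or the integrand itself, and
  are continuous; so the flux is \<open>C\<^sup>1\<close>, although \<open>e\<close> is only continuous. Its \<open>u\<close>-derivative
  \<open>e u \<partial>\<^sub>u f\<close> inherits the mixed derivatives from \<open>\<partial>\<^sub>u f\<close>.
\<close>

lemma flux_of_F_class:
  fixes f :: "real \<times> (real^'n) \<times> real \<Rightarrow> real^'n"
  assumes I: "I = {0..} \<or> (\<exists>T>0. I = {0..<T})"
    and f: "f \<in> F_class I" and e: "continuous_on UNIV e"
  shows "flux_of (du f) e \<in> F_class I"
proof -
  let ?J = "closure I" and ?F = "flux_of (du f) e"
  let ?S = "?J \<times> (UNIV :: ((real^'n) \<times> real) set)"
  let ?at = "dt ?J (du f)" and ?ax = "\<lambda>i (t, x, u). dx i (\<lambda>y. du f (t, y, u)) x"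
  note J = time_interval[OF I]
  note cdu = F_class_du_continuous[OF f]
  have du_F: "du ?F (t, x, u) = cscale (e u) (du f (t, x, u))" if "t \<in> ?J" for t x u
    using flux_of_du[OF e cdu that] by (simp add: du_def[of ?F] vector_derivative_at)
  have "C_k_on 1 ?S ?F"
  proof (rule C_k_on_1_box)
    \<comment> \<open>only the time coordinate is restricted\<close>
    define Jb where "Jb b = (if b = (1, 0, 0) then ?J else UNIV)" for b :: "real \<times> (real^'n) \<times> real"
    have "(1, 0, 0) \<in> (Basis :: (real \<times> (real^'n) \<times> real) set)"
      by (auto simp: Basis_prod_def zero_prod_def)
    then show "?S = {z. \<forall>b\<in>Basis. z \<bullet> b \<in> Jb b}"
      by (force simp: Jb_def)
    show "convex (Jb b)" if "b \<in> Basis" for b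
      using J by (simp add: Jb_def)
    fix b :: "real \<times> (real^'n) \<times> real" assume "b \<in> Basis"
    then show "\<exists>D. continuous_on ?S D \<and> (\<forall>z\<in>?S.
      ((\<lambda>s. ?F (z + s *\<^sub>R b)) has_vector_derivative D z) (at 0 within {s. z \<bullet> b + s \<in> Jb b}))"
    proof (cases rule: Basis_space_time_state)
      case 1
      have "((\<lambda>s. ?F (t + s, x, u)) has_vector_derivative flux_of ?at e (t, x, u)) (at 0 within {s. t + s \<in> ?J})"
        if "t \<in> ?J" for t x u
      proof -
        have "((\<lambda>s. ?F (s, x, u)) has_vector_derivative flux_of ?at e (t, x, u)) (at (t + 0) within ?J)"
          using flux_of_dt[OF e cdu F_class_dt_du_continuous[OF f] J(2) that F_class_dt_du[OF f]] by simp
        then have "((\<lambda>s. ?F (s, x, u)) has_vector_derivative flux_of ?at e (t, x, u))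
            (at (t + 0) within (\<lambda>s. t + s) ` {s. t + s \<in> ?J})"
          by (rule has_vector_derivative_within_subset) auto
        moreover have "((\<lambda>s. t + s) has_vector_derivative 1) (at 0 within {s. t + s \<in> ?J})"
          by (auto intro!: derivative_eq_intros)
        ultimately show ?thesis
          using vector_diff_chain_within[of "\<lambda>s. t + s" 1 0] by (force simp: o_def)
      qed
      then show ?thesis
        using flux_of_continuous_on[OF e F_class_dt_du_continuous[OF f]]
        by (intro exI[of _ "flux_of ?at e"]) (auto simp: 1 Jb_def)
    next
      case (2 i)
      have c: "continuous_on ?S (?ax i)" using F_class_dx_du_continuous[OF f] .
      have "((\<lambda>s. ?F (t, x + s *\<^sub>R axis i 1, u)) has_vector_derivative flux_of (?ax i) e (t, x, u)) (at 0)"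
        if "t \<in> ?J" for t x u
        by (rule flux_of_dx[OF e cdu c that]) (simp add: F_class_dx_du[OF f that])
      then show ?thesis
        using flux_of_continuous_on[OF e c]
        by (intro exI[of _ "flux_of (?ax i) e"]) (auto simp: 2 Jb_def)
    next
      case 3
      have "((\<lambda>s. ?F (t, x, u + s)) has_vector_derivative cscale (e u) (du f (t, x, u))) (at 0)"
        if "t \<in> ?J" for t x u
      proof -
        have "((\<lambda>s. u + s) has_vector_derivative 1) (at 0)"
          by (auto intro!: derivative_eq_intros)
        from vector_diff_chain_at[OF this, of "\<lambda>w. ?F (t, x, w)"] flux_of_du[OF e cdu that, of x u]
        show ?thesis by (simp add: o_def)
      qed
      then show ?thesis
        using cscale_continuous_on[OF e cdu]
        by (intro exI[of _ "\<lambda>(t, x, u). cscale (e u) (du f (t, x, u))"]) (auto simp: 3 Jb_def)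
    qed
  qed
  moreover have dt_F: "((\<lambda>s. du ?F (s, x, u)) has_vector_derivative cscale (e u) (?at (t, x, u))) (at t within ?J)"
    if "t \<in> ?J" for t x u
  proof (rule has_vector_derivative_transform[OF that])
    show "((\<lambda>s. cscale (e u) (du f (s, x, u))) has_vector_derivative cscale (e u) (?at (t, x, u))) (at t within ?J)"
      by (rule bounded_linear.has_vector_derivative[OF cscale.bounded_linear_right F_class_dt_du[OF f that]])
  qed (simp add: du_F)
  then have "dt ?J (du ?F) (t, x, u) = cscale (e u) (?at (t, x, u))" if "t \<in> ?J" for t x u
    using J(6)[OF that] that by (simp add: dt_def[of ?J "du ?F"] vector_derivative_within)
  then have "continuous_on ?S (dt ?J (du ?F))"
    by (intro continuous_on_eq[OF cscale_continuous_on[OF e F_class_dt_du_continuous[OF f]]]) auto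
  moreover have dx_F: "((\<lambda>s. du ?F (t, x + s *\<^sub>R axis i 1, u)) has_vector_derivative cscale (e u) (?ax i (t, x, u))) (at 0)"
    if "t \<in> ?J" for t x u i
    using bounded_linear.has_vector_derivative[OF cscale.bounded_linear_right F_class_dx_du[OF f that, of x i u], of "e u"]
    by (simp add: du_F[OF that])
  then have "dx i (\<lambda>y. du ?F (t, y, u)) x = cscale (e u) (?ax i (t, x, u))" if "t \<in> ?J" for t x u i
    using that by (intro has_vector_derivative_dx) simp
  then have "continuous_on ?S (\<lambda>(t, x, u). dx i (\<lambda>y. du ?F (t, y, u)) x)" for i
    by (intro continuous_on_eq[OF cscale_continuous_on[OF e F_class_dx_du_continuous[OF f]]]) auto
  ultimately show ?thesis
    unfolding F_class_def
    using dt_F dx_F by (blast intro: has_vector_derivative_def[THEN iffD1, THEN differentiableI])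
qed

lemma entropy_flux_exists:
  fixes f :: "real \<times> (real^'n) \<times> real \<Rightarrow> real^'n"
  assumes I: "I = {0..} \<or> (\<exists>T>0. I = {0..<T})"
    and f: "f \<in> F_class I" and H: "continuous_on UNIV (\<lambda>w. vector_derivative H (at w))"
  shows "\<exists>F. entropy_flux I f H F"
proof -
  let ?F = "flux_of (du f) (\<lambda>w. vector_derivative H (at w))"
  have "du ?F (t, x, u) $ i = vector_derivative H (at u) * of_real (du f (t, x, u) $ i)"
    if "t \<in> closure I" for t x u i
    using flux_of_du[OF H F_class_du_continuous[OF f] that, of x u]
    by (simp add: du_def[of ?F] vector_derivative_at)
  then show ?thesis
    unfolding entropy_flux_def using flux_of_F_class[OF I f H] by blast
qed

lemma dx_component:
  fixes h :: "real^'n \<Rightarrow> ('b::real_normed_vector)^'m"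
  assumes "((\<lambda>s. h (x + s *\<^sub>R axis i 1)) has_vector_derivative d) (at 0)"
  shows "dx i (\<lambda>y. h y $ k) x = d $ k"
  by (rule has_vector_derivative_dx)
     (rule bounded_linear.has_vector_derivative[OF bounded_linear_vec_nth assms])

lemma divx_F_class:
  fixes \<zeta> :: "real \<times> (real^'n) \<times> real \<Rightarrow> ('b::real_normed_vector)^'n"
  assumes "\<zeta> \<in> F_class I" "t \<in> closure I"
  shows "divx \<zeta> (t, x, u) = (\<Sum>i\<in>UNIV. dx i (\<lambda>y. \<zeta> (t, y, u)) x $ i)"
  unfolding divx_def by (simp add: dx_component[OF F_class_dx[OF assms]])

lemma divx_continuous_on:
  fixes \<zeta> :: "real \<times> (real^'n) \<times> real \<Rightarrow> ('b::real_normed_vector)^'n"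
  assumes "\<zeta> \<in> F_class I"
  shows "continuous_on (closure I \<times> UNIV) (divx \<zeta>)"
proof -
  have "continuous_on (closure I \<times> UNIV) (\<lambda>z. \<Sum>i\<in>UNIV. (case z of (t, x, u) \<Rightarrow> dx i (\<lambda>y. \<zeta> (t, y, u)) x) $ i)"
    by (intro continuous_on_sum bounded_linear.continuous_on[OF bounded_linear_vec_nth] F_class_dx_continuous[OF assms])
  then show ?thesis
    by (rule continuous_on_eq) (auto simp: divx_F_class[OF assms])
qed

text \<open>
  The fundamental theorem of calculus in \<open>u\<close>. It applies to every entropy flux, so it describes in
  particular the one that the definition of the entropy production selects; two fluxes for the same
  entropy differ by a function of \<open>(t, x)\<close>.
\<close>

lemma entropy_flux_representation:
  fixes f :: "real \<times> (real^'n) \<times> real \<Rightarrow> real^'n"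
  assumes f: "f \<in> F_class I" and e: "continuous_on UNIV (\<lambda>w. vector_derivative H (at w))"
    and F: "entropy_flux I f H F" and t: "t \<in> closure I"
  defines "e \<equiv> \<lambda>w. vector_derivative H (at w)"
  shows "F (t, x, u) = F (t, x, 0) + flux_of (du f) e (t, x, u)"
    "divx F (t, x, u) = divx F (t, x, 0) +
      (\<Sum>i\<in>UNIV. flux_of (\<lambda>(t, x, u). dx i (\<lambda>y. du f (t, y, u)) x) e (t, x, u) $ i)"
proof -
  note e = e[folded e_def]
  have FF: "F \<in> F_class I" and duF: "du F (t, x, u) = cscale (e u) (du f (t, x, u))" for x u
    using F t by (auto simp: entropy_flux_def e_def vec_eq_iff)
  have 1: "F (t, x, u) = F (t, x, 0) + flux_of (du f) e (t, x, u)" for x u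
  proof -
    have "sint (\<lambda>w. cscale (e w) (du f (t, x, w))) u = F (t, x, u) - F (t, x, 0)"
    proof (rule sint_eq_antiderivative[of UNIV])
      show "((\<lambda>w. F (t, x, w)) has_vector_derivative cscale (e w) (du f (t, x, w))) (at w within UNIV)" for w
        using F_class_du[OF FF t, of x w] by (simp add: duF)
    qed auto
    then show ?thesis by (simp add: flux_of_def)
  qed
  show "F (t, x, u) = F (t, x, 0) + flux_of (du f) e (t, x, u)" by (rule 1)
  have "dx i (\<lambda>y. F (t, y, u)) x = dx i (\<lambda>y. F (t, y, 0)) x +
      flux_of (\<lambda>(t, x, u). dx i (\<lambda>y. du f (t, y, u)) x) e (t, x, u)" for i
  proof (rule has_vector_derivative_dx)
    have "((\<lambda>s. flux_of (du f) e (t, x + s *\<^sub>R axis i 1, u)) has_vector_derivative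
        flux_of (\<lambda>(t, x, u). dx i (\<lambda>y. du f (t, y, u)) x) e (t, x, u)) (at 0)"
      by (rule flux_of_dx[OF e F_class_du_continuous[OF f] F_class_dx_du_continuous[OF f] t])
         (simp add: F_class_dx_du[OF f t])
    from has_vector_derivative_add[OF F_class_dx[OF FF t, of x i 0] this]
    show "((\<lambda>s. F (t, x + s *\<^sub>R axis i 1, u)) has_vector_derivative dx i (\<lambda>y. F (t, y, 0)) x +
      flux_of (\<lambda>(t, x, u). dx i (\<lambda>y. du f (t, y, u)) x) e (t, x, u)) (at 0)"
      by (simp add: 1[of _ u])
  qed
  then show "divx F (t, x, u) = divx F (t, x, 0) +
      (\<Sum>i\<in>UNIV. flux_of (\<lambda>(t, x, u). dx i (\<lambda>y. du f (t, y, u)) x) e (t, x, u) $ i)"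
    by (simp add: divx_F_class[OF FF t] sum.distrib)
qed

section \<open>Integrals of bounded functions inserted into continuous ones\<close>

text \<open>
  The function \<open>u\<close> is only almost everywhere bounded, so the bound on \<open>h\<close> over the compact set
  \<open>K \<times> [-R, R]\<close> holds almost everywhere along the graph of \<open>u\<close>.
\<close>

lemma integrable_compact_superposition:
  fixes h :: "'a::euclidean_space \<times> real \<Rightarrow> complex"
  assumes S: "S \<in> sets borel" and K: "compact K" "K \<subseteq> S"
    and u: "u \<in> borel_measurable (lebesgue_on S)" "AE z in lebesgue_on S. \<bar>u z\<bar> \<le> R"
    and h: "continuous_on (S \<times> UNIV) h" "\<And>z w. z \<in> S - K \<Longrightarrow> h (z, w) = 0"
    and B: "\<And>z w. z \<in> K \<Longrightarrow> w \<in> {-R..R} \<Longrightarrow> norm (h (z, w)) \<le> B"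
  shows "integrable (lebesgue_on S) (\<lambda>z. h (z, u z))"
    "norm (LINT z|lebesgue_on S. h (z, u z)) \<le> measure lebesgue K * B"
proof -
  let ?M = "lebesgue_on S"
  have Sl: "S \<in> sets lebesgue" using S by simp
  have Kl: "K \<in> sets lebesgue" using K(1) by (simp add: lmeasurable_compact fmeasurableD)
  have ind: "integrable ?M (\<lambda>z. B * indicator K z :: real)" "(LINT z|?M. B * indicator K z) = measure lebesgue K * B"
  proof -
    have "emeasure ?M K = emeasure lebesgue K"
      using Sl K(2) by (simp add: emeasure_restrict_space)
    moreover have "emeasure lebesgue K < \<infinity>"
      using lmeasurable_compact[OF K(1)] unfolding fmeasurable_def infinity_ennreal_def by blast
    moreover have "K \<in> sets ?M" using Kl K(2) Sl by (simp add: sets_restrict_space_iff)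
    ultimately have int: "integrable ?M (indicator K :: _ \<Rightarrow> real)" and "measure ?M K = measure lebesgue K"
      using K(2) by (simp_all add: integrable_indicator_iff measure_def Int_absorb2)
    then show "integrable ?M (\<lambda>z. B * indicator K z :: real)" "(LINT z|?M. B * indicator K z) = measure lebesgue K * B"
      using K(2) by (simp_all add: Int_absorb2 mult.commute)
  qed
  have meas: "(\<lambda>z. h (z, u z)) \<in> borel_measurable ?M"
  proof -
    have "(\<lambda>p. indicator (S \<times> UNIV) p *\<^sub>R h p) \<in> borel_measurable borel"
      using S by (intro borel_measurable_continuous_on_indicator h(1)) (simp add: borel_Times)
    moreover have "(\<lambda>z. z) \<in> borel_measurable ?M"
      by (intro measurable_restrict_space1 measurable_completion) simp
    then have "(\<lambda>z. (z, u z)) \<in> borel_measurable ?M"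
      using u(1) by (rule borel_measurable_Pair)
    ultimately have "(\<lambda>z. indicator (S \<times> UNIV) (z, u z) *\<^sub>R h (z, u z)) \<in> borel_measurable ?M"
      by (rule measurable_compose_rev)
    then show ?thesis
      by (rule measurable_cong[THEN iffD1, rotated]) (simp add: space_restrict_space)
  qed
  have bound: "AE z in ?M. norm (h (z, u z)) \<le> B * indicator K z"
    using u(2) AE_space
  proof eventually_elim
    case (elim z)
    then have z: "z \<in> S" "u z \<in> {-R..R}" by (auto simp: space_restrict_space)
    show ?case
    proof (cases "z \<in> K")
      case True then show ?thesis using B[OF True z(2)] by simp
    next
      case False then show ?thesis using h(2) z(1) by simp
    qed
  qed
  show int: "integrable ?M (\<lambda>z. h (z, u z))"
    by (rule Bochner_Integration.integrable_bound[OF ind(1) meas]) (use bound in eventually_elim, simp)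
  have "norm (LINT z|?M. h (z, u z)) \<le> (LINT z|?M. norm (h (z, u z)))"
    by (rule integral_norm_bound)
  also have "\<dots> \<le> (LINT z|?M. B * indicator K z)"
    by (rule integral_mono_AE[OF integrable_norm[OF int] ind(1) bound])
  finally show "norm (LINT z|?M. h (z, u z)) \<le> measure lebesgue K * B" unfolding ind(2) .
qed

lemma compact_superposition_bounded:
  fixes h :: "'a::euclidean_space \<times> real \<Rightarrow> complex"
  assumes "compact K" "K \<subseteq> S" "continuous_on (S \<times> UNIV) h"
  obtains B where "B \<ge> 0" "\<And>z w. z \<in> K \<Longrightarrow> w \<in> {-R..R} \<Longrightarrow> norm (h (z, w)) \<le> B"
proof -
  have "compact (h ` (K \<times> {-R..R}))"
    using assms by (intro compact_continuous_image compact_Times compact_Icc continuous_on_subset[OF assms(3)]) auto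
  then obtain B where B: "\<And>y. y \<in> h ` (K \<times> {-R..R}) \<Longrightarrow> norm y \<le> B"
    using compact_imp_bounded bounded_iff by metis
  show ?thesis
  proof (rule that[of "\<bar>B\<bar>"])
    fix z w assume "z \<in> K" "w \<in> {-R..R}"
    then have "norm (h (z, w)) \<le> B" by (intro B) blast
    then show "norm (h (z, w)) \<le> \<bar>B\<bar>" by linarith
  qed simp
qed

text \<open>
  Integration along the graph of \<open>u\<close> turns an integrand \<open>A e\<close> that depends linearly and
  continuously on \<open>e\<close> into a functional of the kind studied above. It is used for the two ways in
  which the derivative of an entropy occurs in the production: pointwise and through a primitive.
\<close>

lemma superposition_functional:
  fixes A :: "(real \<Rightarrow> complex) \<Rightarrow> 'a::euclidean_space \<times> real \<Rightarrow> complex"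
  assumes S: "S \<in> sets borel" and K: "compact K" "K \<subseteq> S"
    and u: "u \<in> borel_measurable (lebesgue_on S)" "AE z in lebesgue_on S. \<bar>u z\<bar> \<le> R"
    and A: "\<And>e. continuous_on UNIV e \<Longrightarrow> continuous_on (S \<times> UNIV) (A e)"
    "\<And>e z w. continuous_on UNIV e \<Longrightarrow> z \<in> S - K \<Longrightarrow> A e (z, w) = 0"
    and add: "\<And>e1 e2 z w. continuous_on UNIV e1 \<Longrightarrow> continuous_on UNIV e2 \<Longrightarrow> z \<in> S \<Longrightarrow>
        A (\<lambda>v. e1 v + e2 v) (z, w) = A e1 (z, w) + A e2 (z, w)"
    and scale: "\<And>c e z w. continuous_on UNIV e \<Longrightarrow> z \<in> S \<Longrightarrow> A (\<lambda>v. c * e v) (z, w) = c * A e (z, w)"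
    and C: "C \<ge> 0" "\<And>e B z w. continuous_on UNIV e \<Longrightarrow> (\<And>w. w \<in> {-R..R} \<Longrightarrow> norm (e w) \<le> B) \<Longrightarrow>
        z \<in> K \<Longrightarrow> w \<in> {-R..R} \<Longrightarrow> norm (A e (z, w)) \<le> C * B"
  shows "C0_functional R (\<lambda>e. LINT z|lebesgue_on S. A e (z, u z))"
    "continuous_on UNIV e \<Longrightarrow> integrable (lebesgue_on S) (\<lambda>z. A e (z, u z))"
proof -
  have int: "integrable (lebesgue_on S) (\<lambda>z. A e (z, u z))" if e: "continuous_on UNIV e" for e
  proof -
    obtain B where B: "\<And>z w. z \<in> K \<Longrightarrow> w \<in> {-R..R} \<Longrightarrow> norm (A e (z, w)) \<le> B"
      using compact_superposition_bounded[OF K A(1)[OF e], of R] by metis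
    show ?thesis
      by (rule integrable_compact_superposition(1)[OF S K u A(1)[OF e] A(2)[OF e] B])
  qed
  show "continuous_on UNIV e \<Longrightarrow> integrable (lebesgue_on S) (\<lambda>z. A e (z, u z))" by (rule int)
  have space: "z \<in> S" if "z \<in> space (lebesgue_on S)" for z using that by (simp add: space_restrict_space)
  show "C0_functional R (\<lambda>e. LINT z|lebesgue_on S. A e (z, u z))"
  proof (rule C0_functionalI[where C = "measure lebesgue K * C"])
    fix e1 e2 :: "real \<Rightarrow> complex" assume e: "continuous_on UNIV e1" "continuous_on UNIV e2"
    have "(LINT z|lebesgue_on S. A (\<lambda>w. e1 w + e2 w) (z, u z)) =
        (LINT z|lebesgue_on S. A e1 (z, u z) + A e2 (z, u z))"
      by (rule Bochner_Integration.integral_cong) (auto simp: add[OF e] dest: space)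
    then show "(LINT z|lebesgue_on S. A (\<lambda>w. e1 w + e2 w) (z, u z)) =
        (LINT z|lebesgue_on S. A e1 (z, u z)) + (LINT z|lebesgue_on S. A e2 (z, u z))"
      by (simp add: int e)
  next
    fix c :: complex and e :: "real \<Rightarrow> complex" assume e: "continuous_on UNIV e"
    have "(LINT z|lebesgue_on S. A (\<lambda>w. c * e w) (z, u z)) = (LINT z|lebesgue_on S. c * A e (z, u z))"
      by (rule Bochner_Integration.integral_cong) (auto simp: scale[OF e] dest: space)
    then show "(LINT z|lebesgue_on S. A (\<lambda>w. c * e w) (z, u z)) = c * (LINT z|lebesgue_on S. A e (z, u z))"
      by simp
  next
    fix e :: "real \<Rightarrow> complex" and B
    assume e: "continuous_on UNIV e" "\<And>w. w \<in> {-R..R} \<Longrightarrow> norm (e w) \<le> B"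
    have "norm (LINT z|lebesgue_on S. A e (z, u z)) \<le> measure lebesgue K * (C * B)"
      by (rule integrable_compact_superposition(2)[OF S K u A(1)[OF e(1)] A(2)[OF e(1)] C(2)[OF e]])
    then show "norm (LINT z|lebesgue_on S. A e (z, u z)) \<le> measure lebesgue K * C * B"
      by (simp add: mult.assoc)
  qed (use C(1) in simp)
qed

lemma pointwise_functional:
  fixes b :: "'a::euclidean_space \<times> real \<Rightarrow> complex"
  assumes S: "S \<in> sets borel" and K: "compact K" "K \<subseteq> S"
    and u: "u \<in> borel_measurable (lebesgue_on S)" "AE z in lebesgue_on S. \<bar>u z\<bar> \<le> R"
    and b: "continuous_on (S \<times> UNIV) b" "\<And>z w. z \<in> S - K \<Longrightarrow> b (z, w) = 0"
  shows "C0_functional R (\<lambda>e. LINT z|lebesgue_on S. e (u z) * b (z, u z))"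
    "continuous_on UNIV e \<Longrightarrow> integrable (lebesgue_on S) (\<lambda>z. e (u z) * b (z, u z))"
proof -
  obtain C where C: "C \<ge> 0" "\<And>z w. z \<in> K \<Longrightarrow> w \<in> {-R..R} \<Longrightarrow> norm (b (z, w)) \<le> C"
    using compact_superposition_bounded[OF K b(1), of R] by metis
  have cont: "continuous_on (S \<times> UNIV) (\<lambda>p. e (snd p) * b p)" if "continuous_on UNIV e" for e
    by (intro continuous_intros b continuous_on_compose2[OF that]) auto
  have bound: "norm (e w * b (z, w)) \<le> C * B"
    if "\<And>w. w \<in> {-R..R} \<Longrightarrow> norm (e w) \<le> B" "z \<in> K" "w \<in> {-R..R}" for e B z w
    unfolding norm_mult mult.commute[of C]
    by (rule mult_mono[OF that(1)[OF that(3)] C(2)[OF that(2,3)]])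
       (use order_trans[OF norm_ge_zero that(1)[OF that(3)]] in auto)
  show "C0_functional R (\<lambda>e. LINT z|lebesgue_on S. e (u z) * b (z, u z))"
    using superposition_functional(1)[OF S K u, of "\<lambda>e p. e (snd p) * b p" C] b(2) cont C(1) bound
    by (simp add: distrib_right mult.assoc)
  show "continuous_on UNIV e \<Longrightarrow> integrable (lebesgue_on S) (\<lambda>z. e (u z) * b (z, u z))"
    using superposition_functional(2)[OF S K u, of "\<lambda>e p. e (snd p) * b p" C e] b(2) cont C(1) bound
    by (simp add: distrib_right mult.assoc)
qed

lemma primitive_functional:
  fixes b :: "'a::euclidean_space \<times> real \<Rightarrow> complex"
  assumes S: "S \<in> sets borel" and K: "compact K" "K \<subseteq> S"
    and u: "u \<in> borel_measurable (lebesgue_on S)" "AE z in lebesgue_on S. \<bar>u z\<bar> \<le> R"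
    and b: "continuous_on (S \<times> UNIV) b" "\<And>z w. z \<in> S - K \<Longrightarrow> b (z, w) = 0"
  shows "C0_functional R (\<lambda>e. LINT z|lebesgue_on S. sint (\<lambda>w. e w * b (z, w)) (u z))"
    "continuous_on UNIV e \<Longrightarrow> integrable (lebesgue_on S) (\<lambda>z. sint (\<lambda>w. e w * b (z, w)) (u z))"
proof -
  obtain C where C: "C \<ge> 0" "\<And>z w. z \<in> K \<Longrightarrow> w \<in> {-R..R} \<Longrightarrow> norm (b (z, w)) \<le> C"
    using compact_superposition_bounded[OF K b(1), of R] by metis
  let ?A = "\<lambda>e (z, u). sint (\<lambda>w. e w * b (z, w)) u"
  have contb: "continuous_on UNIV (\<lambda>w. e w * b (z, w))" if "continuous_on UNIV e" "z \<in> S" for e z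
    using that by (intro continuous_intros continuous_on_compose2[OF b(1)]) auto
  have cont: "continuous_on (S \<times> UNIV) (?A e)" if e: "continuous_on UNIV e" for e
  proof (rule sint_continuous_on)
    show "continuous_on (S \<times> UNIV) (\<lambda>(z, w). e w * b (z, w))"
      unfolding case_prod_beta'
      by (intro continuous_intros continuous_on_compose2[OF b(1)] continuous_on_compose2[OF e]) auto
  qed
  have zero: "?A e (z, w) = 0" if "z \<in> S - K" for e z w
    using b(2)[OF that] by (simp add: sint_def)
  have add: "?A (\<lambda>v. e1 v + e2 v) (z, w) = ?A e1 (z, w) + ?A e2 (z, w)"
    if "continuous_on UNIV e1" "continuous_on UNIV e2" "z \<in> S" for e1 e2 z w
    using sint_add[OF contb[OF that(1,3)] contb[OF that(2,3)]] by (simp add: distrib_right)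
  have scale: "?A (\<lambda>v. c * e v) (z, w) = c * ?A e (z, w)"
    if "continuous_on UNIV e" "z \<in> S" for c e z w
    using sint_bounded_linear[OF bounded_linear_mult_right contb[OF that], of c] by (simp add: mult.assoc)
  have bound: "norm (?A e (z, u)) \<le> (\<bar>R\<bar> * C) * B"
    if e: "continuous_on UNIV e" and B: "\<And>w. w \<in> {-R..R} \<Longrightarrow> norm (e w) \<le> B" and z: "z \<in> K" "u \<in> {-R..R}"
    for e B z u
  proof -
    have "norm (sint (\<lambda>w. e w * b (z, w)) u) \<le> R * (B * C)"
    proof (rule sint_bound[OF contb[OF e]])
      fix w assume w: "w \<in> {-R..R}"
      show "norm (e w * b (z, w)) \<le> B * C"
        unfolding norm_mult
        by (rule mult_mono[OF B[OF w] C(2)[OF z(1) w]])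
           (use order_trans[OF norm_ge_zero B[OF w]] in auto)
    qed (use z K in auto)
    moreover have "R \<ge> 0" using z by auto
    ultimately show ?thesis by (simp add: mult_ac)
  qed
  have RC: "\<bar>R\<bar> * C \<ge> 0" using C(1) by simp
  show "C0_functional R (\<lambda>e. LINT z|lebesgue_on S. sint (\<lambda>w. e w * b (z, w)) (u z))"
    using superposition_functional(1)[OF S K u, of ?A "\<bar>R\<bar> * C"] cont zero add scale RC bound
    by simp
  show "continuous_on UNIV e \<Longrightarrow> integrable (lebesgue_on S) (\<lambda>z. sint (\<lambda>w. e w * b (z, w)) (u z))"
    using superposition_functional(2)[OF S K u, of ?A "\<bar>R\<bar> * C" e] cont zero add scale RC bound
    by simp
qed

section \<open>Entropy production as a functional of the derivative of the entropy\<close>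

text \<open>
  At a boundary point of \<open>I\<close> the time derivative is one-sided. Derivatives vanish off the support
  because the function vanishes on a neighbourhood relative to the domain.
\<close>

lemma test_function_derivatives:
  fixes \<phi> :: "real \<times> (real^'n) \<Rightarrow> complex"
  assumes I: "I = {0..} \<or> (\<exists>T>0. I = {0..<T})" and \<phi>: "\<phi> \<in> Cc_k 1 (I \<times> UNIV)"
  obtains K where "compact K" "K \<subseteq> I \<times> UNIV"
    "continuous_on (I \<times> UNIV) \<phi>" "\<forall>z\<in>I \<times> UNIV - K. \<phi> z = 0"
    "continuous_on (I \<times> UNIV) (dt I \<phi>)" "\<forall>z\<in>I \<times> UNIV - K. dt I \<phi> z = 0"
    "\<forall>i. continuous_on (I \<times> UNIV) (\<lambda>z. dx i (\<lambda>y. \<phi> (fst z, y)) (snd z))"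
    "\<forall>i. \<forall>z\<in>I \<times> UNIV - K. dx i (\<lambda>y. \<phi> (fst z, y)) (snd z) = 0"
proof -
  let ?S = "I \<times> (UNIV :: (real^'n) set)"
  let ?K = "closure (support_on ?S \<phi>)"
  have C1: "C_k_on 1 ?S \<phi>" and K: "compact ?K" "?K \<subseteq> ?S"
    using \<phi> by (simp_all add: Cc_k_def del: One_nat_def)
  have zero: "\<phi> z = 0" if "z \<in> ?S - ?K" for z
    using that closure_subset[of "support_on ?S \<phi>"] by (auto simp: support_on_def)
  have near: "\<exists>d>0. \<forall>z'\<in>?S. dist z' z < d \<longrightarrow> \<phi> z' = 0" if "z \<in> ?S - ?K" for z
  proof -
    have "open (- ?K)" "z \<in> - ?K" using that by auto
    then obtain d where "d > 0" "ball z d \<subseteq> - ?K" using openE by blast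
    then show ?thesis using zero by (intro exI[of _ d]) (auto simp: dist_commute subset_iff)
  qed
  obtain \<phi>' where cont: "\<And>v. continuous_on ?S (\<lambda>z. \<phi>' z v)" and
    dir: "\<And>z v X. z \<in> ?S \<Longrightarrow> (\<And>s. s \<in> X \<Longrightarrow> z + s *\<^sub>R v \<in> ?S) \<Longrightarrow>
      ((\<lambda>s. \<phi> (z + s *\<^sub>R v)) has_vector_derivative \<phi>' z v) (at 0 within X)"
    using C_k_on_1_directional[OF C1] by metis
  have dt_eq: "dt I \<phi> (t, x) = \<phi>' (t, x) (1, 0)" if "t \<in> I" for t x
  proof -
    have "((\<lambda>s. \<phi> (t + s, x)) has_vector_derivative \<phi>' (t, x) (1, 0)) (at 0 within {s. t + s \<in> I})"
      using dir[of "(t, x)" "{s. t + s \<in> I}" "(1, 0)"] that by simp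
    then have "((\<lambda>s. \<phi> (s, x)) has_vector_derivative \<phi>' (t, x) (1, 0)) (at t within I)"
      by (rule has_vector_derivative_shift[of "\<lambda>s. \<phi> (s, x)"])
    then show ?thesis
      using time_interval(5)[OF I that] by (simp add: dt_def vector_derivative_within)
  qed
  have dx_eq: "dx i (\<lambda>y. \<phi> (t, y)) x = \<phi>' (t, x) (0, axis i 1)" if "t \<in> I" for t x i
    using dir[of "(t, x)" UNIV "(0, axis i 1)"] that by (intro has_vector_derivative_dx) simp
  show ?thesis
  proof (rule that[OF K continuous_on_C_k_1[OF C1]]; (intro allI ballI)?)
    show "\<phi> z = 0" if "z \<in> ?S - ?K" for z using that by (rule zero)
    show "continuous_on ?S (dt I \<phi>)"
      by (rule continuous_on_eq[OF cont[of "(1, 0)"]]) (auto simp: dt_eq)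
    show "continuous_on ?S (\<lambda>z. dx i (\<lambda>y. \<phi> (fst z, y)) (snd z))" for i
      by (rule continuous_on_eq[OF cont[of "(0, axis i 1)"]]) (auto simp: dx_eq)
    show "dt I \<phi> z = 0" if z: "z \<in> ?S - ?K" for z
    proof -
      obtain t x where tx: "z = (t, x)" "t \<in> I" using z by auto
      obtain d where d: "d > 0" "\<And>z'. z' \<in> ?S \<Longrightarrow> dist z' z < d \<Longrightarrow> \<phi> z' = 0"
        using near[OF z] by blast
      have "((\<lambda>s. 0) has_vector_derivative 0) (at t within I)" by simp
      then have "((\<lambda>s. \<phi> (s, x)) has_vector_derivative 0) (at t within I)"
        by (rule has_vector_derivative_transform_within[OF _ d(1) tx(2)])
           (use d(2) in \<open>auto simp: tx dist_Pair_Pair\<close>)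
      then show ?thesis
        using time_interval(5)[OF I tx(2)] by (simp add: tx dt_def vector_derivative_within)
    qed
    show "dx i (\<lambda>y. \<phi> (fst z, y)) (snd z) = 0" if z: "z \<in> ?S - ?K" for i z
    proof -
      obtain t x where tx: "z = (t, x)" "t \<in> I" using z by auto
      obtain d where d: "d > 0" "\<And>z'. z' \<in> ?S \<Longrightarrow> dist z' z < d \<Longrightarrow> \<phi> z' = 0"
        using near[OF z] by blast
      have "((\<lambda>s. 0) has_vector_derivative 0) (at (0::real))" by simp
      then have "((\<lambda>s. \<phi> (t, x + s *\<^sub>R axis i 1)) has_vector_derivative 0) (at 0)"
        by (rule has_vector_derivative_transform_within[OF _ d(1)])
           (use d(2) tx(2) in \<open>auto simp: tx dist_Pair_Pair dist_norm norm_axis_1\<close>)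
      then show ?thesis by (simp add: tx has_vector_derivative_dx)
    qed
  qed
qed

lemma continuous_on_space_time_state:
  fixes a :: "real \<times> (real^'n) \<times> real \<Rightarrow> 'b::topological_space"
  assumes "continuous_on (closure I \<times> UNIV) a"
  shows "continuous_on ((I \<times> UNIV) \<times> UNIV) (\<lambda>p. a (fst (fst p), snd (fst p), snd p))"
  using closure_subset[of I]
  by (intro continuous_on_compose2[OF assms] continuous_intros) auto

text \<open>
  The entropy, its flux and the divergence of the flux are their values at state \<open>0\<close> plus
  primitives in the state. The values at \<open>0\<close> make up \<open>c\<close>, which is therefore the same for both
  solutions and cancels in the difference of their entropy productions.
\<close>

lemma entropy_production_representation:
  fixes f :: "real \<times> (real^'n) \<times> real \<Rightarrow> real^'n"
  assumes I: "I = {0..} \<or> (\<exists>T>0. I = {0..<T})" and f: "f \<in> F_class I"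
    and g: "continuous_on (closure I \<times> UNIV) g" and \<phi>: "\<phi> \<in> Cc_k 1 (I \<times> UNIV)"
  shows "\<exists>c. \<forall>uo u R. uo \<in> borel_measurable lebesgue \<longrightarrow> (AE x in lebesgue. \<bar>uo x\<bar> \<le> R) \<longrightarrow>
     u \<in> borel_measurable (lebesgue_on (I \<times> UNIV)) \<longrightarrow> (AE z in lebesgue_on (I \<times> UNIV). \<bar>u z\<bar> \<le> R) \<longrightarrow>
     (\<exists>L. C0_functional R L \<and> (\<forall>H. C_k_on 1 UNIV H \<longrightarrow>
        entropy_production I f g uo u H \<phi> = c H + L (\<lambda>w. vector_derivative H (at w))))"
proof -
  let ?S = "I \<times> (UNIV :: (real^'n) set)"
  let ?M = "lebesgue_on ?S"
  obtain K where K: "compact K" "K \<subseteq> ?S"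
    and c\<phi>: "continuous_on ?S \<phi>" and z\<phi>: "\<forall>z\<in>?S - K. \<phi> z = 0"
    and ct: "continuous_on ?S (dt I \<phi>)" and zt: "\<forall>z\<in>?S - K. dt I \<phi> z = 0"
    and cx: "\<forall>i. continuous_on ?S (\<lambda>z. dx i (\<lambda>y. \<phi> (fst z, y)) (snd z))"
    and zx: "\<forall>i. \<forall>z\<in>?S - K. dx i (\<lambda>y. \<phi> (fst z, y)) (snd z) = 0"
    by (rule test_function_derivatives[OF I \<phi>]) (rule that)
  note z\<phi> = bspec[OF z\<phi>] and zt = bspec[OF zt] and cx = spec[OF cx] and zx = bspec[OF spec[OF zx]]
  have S: "?S \<in> sets borel" using time_interval(4)[OF I] by (intro borel_Times) auto
  have SJ: "fst z \<in> closure I" if "z \<in> ?S" for z using that closure_subset[of I] by auto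
  have space: "z \<in> ?S" if "z \<in> space ?M" for z using that by (simp add: space_restrict_space)
  define ax where "ax i = (\<lambda>(t, x, u). dx i (\<lambda>y. du f (t, y, u)) x)" for i
  have cax: "continuous_on (closure I \<times> UNIV) (ax i)" for i
    unfolding ax_def by (rule F_class_dx_du_continuous[OF f])
  note cdu = F_class_du_continuous[OF f]
  define pt where "pt = (\<lambda>p :: (real \<times> (real^'n)) \<times> real. (fst (fst p), snd (fst p), snd p))"
  \<comment> \<open>Coefficients, as functions of \<open>((t, x), w)\<close>, that multiply \<open>e w\<close>: \<open>b1\<close> and \<open>b3\<close> under the
    primitive in \<open>w\<close> (from the entropy with its flux, and from the divergence of the flux),
    \<open>b2\<close> and \<open>b4\<close> pointwise (from \<open>div\<^sub>x f\<close> and \<open>g\<close>), \<open>b0\<close> at the initial time.\<close>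
  define b1 where "b1 p = dt I \<phi> (fst p) +
      (\<Sum>i\<in>UNIV. of_real (du f (pt p) $ i) * dx i (\<lambda>y. \<phi> (fst (fst p), y)) (snd (fst p)))" for p
  define b2 where "b2 p = of_real (divx f (pt p)) * \<phi> (fst p)" for p
  define b3 where "b3 p = (\<Sum>i\<in>UNIV. of_real (ax i (pt p) $ i) * \<phi> (fst p))" for p
  define b4 where "b4 p = of_real (g (pt p)) * \<phi> (fst p)" for p
  define b0 where "b0 p = \<phi> (0, fst p)" for p :: "(real^'n) \<times> real"
  have fstc: "continuous_on (?S \<times> UNIV) (\<lambda>p. h (fst p))" if "continuous_on ?S h" for h :: "real \<times> (real^'n) \<Rightarrow> complex"
    by (rule continuous_on_compose2[OF that]) (auto intro!: continuous_intros)
  have cb1: "continuous_on (?S \<times> UNIV) b1"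
    unfolding b1_def pt_def
    by (intro continuous_intros fstc[OF ct] fstc[OF cx] continuous_on_space_time_state[OF cdu]
        bounded_linear.continuous_on[OF bounded_linear_vec_nth])
  have cb2: "continuous_on (?S \<times> UNIV) b2"
    unfolding b2_def pt_def
    by (intro continuous_intros fstc[OF c\<phi>] continuous_on_space_time_state[OF divx_continuous_on[OF f]])
  have cb3: "continuous_on (?S \<times> UNIV) b3"
    unfolding b3_def pt_def
    by (intro continuous_intros fstc[OF c\<phi>] continuous_on_space_time_state[OF cax]
        bounded_linear.continuous_on[OF bounded_linear_vec_nth])
  have cb4: "continuous_on (?S \<times> UNIV) b4"
    unfolding b4_def pt_def
    by (intro continuous_intros fstc[OF c\<phi>] continuous_on_space_time_state[OF g])
  have zb: "b1 (z, w) = 0" "b2 (z, w) = 0" "b3 (z, w) = 0" "b4 (z, w) = 0" if "z \<in> ?S - K" for z w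
    using z\<phi>[OF that] zt[OF that] zx[OF that] by (simp_all add: b1_def b2_def b3_def b4_def)
  \<comment> \<open>contains the support of the slice of \<open>\<phi>\<close> at time \<open>0\<close>\<close>
  define K0 where "K0 = snd ` K"
  have K0: "compact K0" "K0 \<subseteq> UNIV"
    using K(1) by (auto simp: K0_def intro!: compact_continuous_image continuous_intros)
  have cb0: "continuous_on (UNIV \<times> UNIV) b0"
    unfolding b0_def using time_interval(3)[OF I]
    by (intro continuous_on_compose2[OF c\<phi>] continuous_intros) auto
  have zb0: "b0 (x, w) = 0" if "x \<in> UNIV - K0" for x w
    using that time_interval(3)[OF I] z\<phi>[of "(0, x)"] by (force simp: b0_def K0_def)
  define F where "F H = (SOME F. entropy_flux I f H F)" for H
  \<comment> \<open>what remains of the integrands for \<open>e = 0\<close>: the entropy and its flux at state \<open>0\<close>\<close>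
  define c1 where "c1 H z = H 0 * dt I \<phi> z + dot_gradx (F H (fst z, snd z, 0)) \<phi> z" for H z
  define c3 where "c3 H z = divx (F H) (fst z, snd z, 0) * \<phi> z" for H z
  define c0 where "c0 H x = H 0 * \<phi> (0, x)" for H :: "real \<Rightarrow> complex" and x
  define c where "c H = (LINT z|?M. c1 H z) + (LINT z|?M. c3 H z) + (LINT x|lebesgue. c0 H x)" for H
  have "\<exists>L. C0_functional R L \<and> (\<forall>H. C_k_on 1 UNIV H \<longrightarrow>
        entropy_production I f g uo u H \<phi> = c H + L (\<lambda>w. vector_derivative H (at w)))"
    if uo: "uo \<in> borel_measurable lebesgue" "AE x in lebesgue. \<bar>uo x\<bar> \<le> R"
      and u: "u \<in> borel_measurable ?M" "AE z in ?M. \<bar>u z\<bar> \<le> R" for uo u R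
  proof -
    have uo': "uo \<in> borel_measurable (lebesgue_on UNIV)" "AE x in lebesgue_on UNIV. \<bar>uo x\<bar> \<le> R"
      using uo by (simp_all only: lebesgue_on_UNIV_eq)
    have UB: "(UNIV :: (real^'n) set) \<in> sets borel" by simp
    define L where "L e = (LINT z|?M. sint (\<lambda>w. e w * b1 (z, w)) (u z)) +
      - (LINT z|?M. e (u z) * b2 (z, u z)) + (LINT z|?M. sint (\<lambda>w. e w * b3 (z, w)) (u z)) +
      (LINT z|?M. e (u z) * b4 (z, u z)) + (LINT x|lebesgue_on UNIV. sint (\<lambda>w. e w * b0 (x, w)) (uo x))" for e
    have "C0_functional R L"
      unfolding L_def
      by (intro C0_functional_plus_functional C0_functional_uminus_functional
          primitive_functional(1)[OF S K u cb1 zb(1)] pointwise_functional(1)[OF S K u cb2 zb(2)]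
          primitive_functional(1)[OF S K u cb3 zb(3)] pointwise_functional(1)[OF S K u cb4 zb(4)]
          primitive_functional(1)[OF UB K0 uo' cb0 zb0])
    moreover have "entropy_production I f g uo u H \<phi> = c H + L (\<lambda>w. vector_derivative H (at w))"
      if H: "C_k_on 1 UNIV H" for H
    proof -
      define e where "e = (\<lambda>w. vector_derivative H (at w))"
      have H': "(H has_vector_derivative e w) (at w)" for w
        using C_k_on_Suc_real_deriv(1)[of 0 H] H by (simp add: e_def)
      have e: "continuous_on UNIV e"
        using C_k_on_Suc_real_deriv(2)[of 0 H] H by (simp add: e_def)
      have flux: "entropy_flux I f H (F H)"
        unfolding F_def using someI_ex[OF entropy_flux_exists[OF I f e[unfolded e_def]]] .
      note rep = entropy_flux_representation[OF f e[unfolded e_def] flux, folded e_def ax_def]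
      have FF: "F H \<in> F_class I" using flux by (simp add: entropy_flux_def)
      have H_eq: "H w = H 0 + sint e w" for w
        using sint_eq_antiderivative[of UNIV w H e] H' by simp
      have ae: "continuous_on UNIV (\<lambda>w. cscale (e w) (a (t, x, w)))"
        if "continuous_on (closure I \<times> UNIV) a" "(t, x) \<in> ?S" for a :: "real \<times> (real^'n) \<times> real \<Rightarrow> real^'n" and t x
        using cscale_continuous_on_u[OF e that(1)] that(2) SJ[of "(t, x)"] by simp
      have comp: "sint (\<lambda>w. e w * (of_real (a (t, x, w) $ i) * k)) v = flux_of a e (t, x, v) $ i * k"
        if "continuous_on (closure I \<times> UNIV) a" "(t, x) \<in> ?S"
        for a :: "real \<times> (real^'n) \<times> real \<Rightarrow> real^'n" and t x i k v
      proof -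
        have "bounded_linear (\<lambda>y. y $ i * k)"
          by (intro bounded_linear_compose[OF bounded_linear_mult_left bounded_linear_vec_nth])
        from sint_bounded_linear[OF this ae[OF that], of v] show ?thesis
          by (simp add: flux_of_def mult.assoc)
      qed
      have cont_comp: "continuous_on UNIV (\<lambda>w. e w * (of_real (a (t, x, w) $ i) * k))"
        if "continuous_on (closure I \<times> UNIV) a" "(t, x) \<in> ?S"
        for a :: "real \<times> (real^'n) \<times> real \<Rightarrow> real^'n" and t x i k
      proof -
        have "continuous_on UNIV (\<lambda>w. cscale (e w) (a (t, x, w)) $ i * k)"
          by (intro continuous_intros bounded_linear.continuous_on[OF bounded_linear_vec_nth] ae[OF that])
        then show ?thesis by (simp add: mult.assoc)
      qed
      have s1: "H (u z) * dt I \<phi> z + dot_gradx (F H (fst z, snd z, u z)) \<phi> z =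
          c1 H z + sint (\<lambda>w. e w * b1 (z, w)) (u z)" if z: "z \<in> ?S" for z
      proof -
        obtain t x where tx: "z = (t, x)" "(t, x) \<in> ?S" "t \<in> closure I" using z SJ[OF z] by (cases z) auto
        have "sint (\<lambda>w. e w * b1 (z, w)) (u z) =
            sint (\<lambda>w. e w * dt I \<phi> (t, x) + (\<Sum>i\<in>UNIV. e w * (of_real (du f (t, x, w) $ i) * dx i (\<lambda>y. \<phi> (t, y)) x))) (u z)"
          by (simp add: b1_def pt_def tx(1) distrib_left sum_distrib_left)
        also have "\<dots> = sint (\<lambda>w. e w * dt I \<phi> (t, x)) (u z) +
            (\<Sum>i\<in>UNIV. sint (\<lambda>w. e w * (of_real (du f (t, x, w) $ i) * dx i (\<lambda>y. \<phi> (t, y)) x)) (u z))"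
          by (simp add: sint_add continuous_on_mult_right[OF e] continuous_on_sum sint_sum cont_comp[OF cdu tx(2)])
        also have "sint (\<lambda>w. e w * dt I \<phi> (t, x)) (u z) = sint e (u z) * dt I \<phi> (t, x)"
          by (rule sint_bounded_linear[OF bounded_linear_mult_left e])
        finally have "sint (\<lambda>w. e w * b1 (z, w)) (u z) = sint e (u z) * dt I \<phi> (t, x) +
            (\<Sum>i\<in>UNIV. flux_of (du f) e (t, x, u z) $ i * dx i (\<lambda>y. \<phi> (t, y)) x)"
          by (simp only: comp[OF cdu tx(2)])
        then show ?thesis
          using rep(1)[OF tx(3), of x "u z"]
          by (simp add: c1_def dot_gradx_def tx(1) H_eq[of "u (t, x)"] distrib_right sum.distrib)
      qed
      have s3: "divx (F H) (fst z, snd z, u z) * \<phi> z = c3 H z + sint (\<lambda>w. e w * b3 (z, w)) (u z)"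
        if z: "z \<in> ?S" for z
      proof -
        obtain t x where tx: "z = (t, x)" "(t, x) \<in> ?S" "t \<in> closure I" using z SJ[OF z] by (cases z) auto
        have "sint (\<lambda>w. e w * b3 (z, w)) (u z) =
            (\<Sum>i\<in>UNIV. sint (\<lambda>w. e w * (of_real (ax i (t, x, w) $ i) * \<phi> (t, x))) (u z))"
          using cont_comp[OF cax tx(2)] by (simp add: b3_def pt_def tx(1) sum_distrib_left sint_sum)
        also have "\<dots> = (\<Sum>i\<in>UNIV. flux_of (ax i) e (t, x, u z) $ i * \<phi> (t, x))"
          by (simp only: comp[OF cax tx(2)])
        finally show ?thesis
          using rep(2)[OF tx(3), of x "u z"]
          by (simp add: c3_def tx(1) distrib_right sum_distrib_right)
      qed
      have s0: "H (uo x) * \<phi> (0, x) = c0 H x + sint (\<lambda>w. e w * b0 (x, w)) (uo x)" for x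
        using sint_bounded_linear[OF bounded_linear_mult_left e, of "\<phi> (0, x)" "uo x"]
        by (simp add: c0_def b0_def H_eq[of "uo x"] distrib_right)
      have const_int: "integrable ?M h" if "continuous_on ?S h" "\<And>z. z \<in> ?S - K \<Longrightarrow> h z = 0" for h :: "real \<times> (real^'n) \<Rightarrow> complex"
        using pointwise_functional(2)[OF S K u, of "\<lambda>p. h (fst p)" "\<lambda>w. 1"] fstc[OF that(1)] that(2) by simp
      have slice: "continuous_on ?S (\<lambda>z. a (fst z, snd z, 0))" if "continuous_on (closure I \<times> UNIV) a"
        for a :: "real \<times> (real^'n) \<times> real \<Rightarrow> 'x::topological_space"
        using closure_subset[of I] by (intro continuous_on_compose2[OF that] continuous_intros) auto
      have c1_eq: "c1 H z = H 0 * dt I \<phi> z +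
          (\<Sum>i\<in>UNIV. F H (fst z, snd z, 0) $ i * dx i (\<lambda>y. \<phi> (fst z, y)) (snd z))" for z
        by (simp add: c1_def dot_gradx_def case_prod_beta')
      have i1: "integrable ?M (c1 H)"
      proof (rule const_int)
        show "continuous_on ?S (c1 H)"
          unfolding c1_eq
          by (intro continuous_intros ct cx bounded_linear.continuous_on[OF bounded_linear_vec_nth]
              slice F_class_continuous[OF FF])
      qed (simp add: c1_eq zt zx)
      have i3: "integrable ?M (c3 H)"
      proof (rule const_int)
        show "continuous_on ?S (c3 H)"
          unfolding c3_def by (intro continuous_intros c\<phi> slice divx_continuous_on[OF FF])
      qed (simp add: c3_def z\<phi>)
      have i0: "integrable lebesgue (c0 H)"
      proof -
        have "continuous_on (UNIV \<times> UNIV) (\<lambda>p :: (real^'n) \<times> real. H 0 * b0 p)"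
          by (intro continuous_intros cb0)
        then show ?thesis
          using pointwise_functional(2)[OF UB K0 uo', of "\<lambda>p. H 0 * b0 p" "\<lambda>w. 1"] zb0
          by (simp add: lebesgue_on_UNIV_eq c0_def[abs_def] b0_def)
      qed
      have t1: "(LINT (t, x)|?M. H (u (t, x)) * dt I \<phi> (t, x) + dot_gradx (F H (t, x, u (t, x))) \<phi> (t, x)) =
          (LINT z|?M. c1 H z) + (LINT z|?M. sint (\<lambda>w. e w * b1 (z, w)) (u z))"
      proof -
        have "(LINT (t, x)|?M. H (u (t, x)) * dt I \<phi> (t, x) + dot_gradx (F H (t, x, u (t, x))) \<phi> (t, x)) =
            (LINT z|?M. c1 H z + sint (\<lambda>w. e w * b1 (z, w)) (u z))"
          by (rule Bochner_Integration.integral_cong) (use s1 in \<open>auto dest!: space\<close>)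
        then show ?thesis
          using primitive_functional(2)[OF S K u cb1 zb(1) e] i1 by simp
      qed
      have t2: "(LINT (t, x)|?M. e (u (t, x)) * of_real (divx f (t, x, u (t, x))) * \<phi> (t, x)) =
          (LINT z|?M. e (u z) * b2 (z, u z))"
        by (rule Bochner_Integration.integral_cong) (auto simp: b2_def pt_def)
      have t3: "(LINT (t, x)|?M. divx (F H) (t, x, u (t, x)) * \<phi> (t, x)) =
          (LINT z|?M. c3 H z) + (LINT z|?M. sint (\<lambda>w. e w * b3 (z, w)) (u z))"
      proof -
        have "(LINT (t, x)|?M. divx (F H) (t, x, u (t, x)) * \<phi> (t, x)) =
            (LINT z|?M. c3 H z + sint (\<lambda>w. e w * b3 (z, w)) (u z))"
          by (rule Bochner_Integration.integral_cong) (use s3 in \<open>auto dest!: space\<close>)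
        then show ?thesis
          using primitive_functional(2)[OF S K u cb3 zb(3) e] i3 by simp
      qed
      have t4: "(LINT (t, x)|?M. e (u (t, x)) * of_real (g (t, x, u (t, x))) * \<phi> (t, x)) =
          (LINT z|?M. e (u z) * b4 (z, u z))"
        by (rule Bochner_Integration.integral_cong) (auto simp: b4_def pt_def)
      have t0: "(LINT x|lebesgue. H (uo x) * \<phi> (0, x)) =
          (LINT x|lebesgue. c0 H x) + (LINT x|lebesgue_on UNIV. sint (\<lambda>w. e w * b0 (x, w)) (uo x))"
        using primitive_functional(2)[OF UB K0 uo' cb0 zb0 e] i0
        by (simp add: s0 lebesgue_on_UNIV_eq)
      show ?thesis
        unfolding entropy_production_def Let_def F_def[symmetric] e_def[symmetric] t1 t2 t3 t4 t0
        by (simp add: c_def L_def)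
    qed
    ultimately show ?thesis by blast
  qed
  then show ?thesis by (intro exI[of _ c]) blast
qed

section \<open>Functionals annihilating all translates of one entropy\<close>

text \<open>
  One bound for all four functions, so that both solutions give functionals on the same interval.
\<close>

lemma common_L_inf_bound:
  assumes "h1 \<in> L_inf UNIV" "h2 \<in> L_inf UNIV" "k1 \<in> L_inf S" "k2 \<in> L_inf S"
  obtains R where "AE x in lebesgue. \<bar>h1 x\<bar> \<le> R" "AE x in lebesgue. \<bar>h2 x\<bar> \<le> R"
    "AE z in lebesgue_on S. \<bar>k1 z\<bar> \<le> R" "AE z in lebesgue_on S. \<bar>k2 z\<bar> \<le> R"
proof -
  obtain C1 C2 C3 C4 where C: "AE x in lebesgue. \<bar>h1 x\<bar> \<le> C1" "AE x in lebesgue. \<bar>h2 x\<bar> \<le> C2"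
    "AE z in lebesgue_on S. \<bar>k1 z\<bar> \<le> C3" "AE z in lebesgue_on S. \<bar>k2 z\<bar> \<le> C4"
    using assms unfolding L_inf_def lebesgue_on_UNIV_eq by blast
  show ?thesis
    by (rule that[of "max (max C1 C2) (max C3 C4)"]; rule eventually_mono, rule C, auto)
qed

lemma C_k_on_2_real_deriv:
  fixes E :: "real \<Rightarrow> real"
  assumes "C_k_on 2 UNIV E"
  shows "(E has_real_derivative deriv E w) (at w)"
    "(deriv E has_real_derivative deriv (deriv E) w) (at w)"
    "continuous_on UNIV (deriv E)" "continuous_on UNIV (deriv (deriv E))"
proof -
  have E: "C_k_on (Suc (Suc 0)) UNIV E" using assms by (simp add: numeral_2_eq_2)
  have 1: "vector_derivative E (at w) = deriv E w" for w
    using C_k_on_Suc_real_deriv(1)[OF E, of w]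
    by (simp add: DERIV_imp_deriv flip: has_real_derivative_iff_has_vector_derivative)
  have E': "C_k_on (Suc 0) UNIV (deriv E)"
    using C_k_on_Suc_real_deriv(2)[OF E] by (simp only: 1)
  have 2: "vector_derivative (deriv E) (at w) = deriv (deriv E) w" for w
    using C_k_on_Suc_real_deriv(1)[OF E', of w]
    by (simp add: DERIV_imp_deriv flip: has_real_derivative_iff_has_vector_derivative)
  show "(E has_real_derivative deriv E w) (at w)"
    using C_k_on_Suc_real_deriv(1)[OF E, of w]
    by (simp only: 1 has_real_derivative_iff_has_vector_derivative)
  show "(deriv E has_real_derivative deriv (deriv E) w) (at w)"
    using C_k_on_Suc_real_deriv(1)[OF E', of w]
    by (simp only: 2 has_real_derivative_iff_has_vector_derivative)
  show "continuous_on UNIV (deriv E)"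
    using C_k_on_real_SucD[OF E'] by simp
  show "continuous_on UNIV (deriv (deriv E))"
    using C_k_on_Suc_real_deriv(2)[OF E'] by (simp only: 2 C_k_on.simps)
qed

text \<open>
  The passage from \<open>E'\<close> to \<open>E''\<close> is differentiation in the translation parameter; then the symbol
  of \<open>L\<close> vanishes on the spectral support of \<open>E''\<close>, which has a cluster point.
\<close>

lemma translates_annihilated_imp_zero:
  fixes E :: "real \<Rightarrow> real"
  assumes E: "C_k_on 2 UNIV E" and \<Lambda>: "represents_tempered (deriv (deriv E)) \<Lambda>"
    and acc: "\<exists>\<xi>. \<xi> islimpt distr_support (fourier_distr \<Lambda>)"
    and L: "C0_functional R L" and ann: "\<And>k. L (\<lambda>w. of_real (deriv E (w - k))) = 0"
    and e: "continuous_on UNIV e"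
  shows "L e = 0"
proof -
  note dE = C_k_on_2_real_deriv[OF E]
  have ann2: "L (\<lambda>w. of_real (deriv (deriv E) (y + w))) = 0" for y
  proof -
    have "((\<lambda>y. L (\<lambda>w. of_real (deriv E (y + w)))) has_vector_derivative
        L (\<lambda>w. of_real (deriv (deriv E) (y + w)))) (at y within UNIV)"
    proof (rule C0_functional_has_vector_derivative[OF L])
      show "continuous_on UNIV (\<lambda>w. complex_of_real (deriv E (y + w)))" for y
        by (intro continuous_intros continuous_on_compose2[OF dE(3)]) auto
      show "((\<lambda>y. complex_of_real (deriv E (y + w))) has_vector_derivative
          of_real (deriv (deriv E) (y + w))) (at y within UNIV)" for y w
        using has_vector_derivative_of_real[OF DERIV_shift[THEN iffD1, OF dE(2)[of "y + w"]]]
        by simp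
      show "continuous_on (UNIV \<times> UNIV) (\<lambda>(y, w). complex_of_real (deriv (deriv E) (y + w)))"
        unfolding case_prod_beta'
        by (intro continuous_intros continuous_on_compose2[OF dE(4)]) auto
    qed auto
    moreover have "L (\<lambda>w. of_real (deriv E (y + w))) = 0" for y
      using ann[of "- y"] by (simp add: add.commute)
    ultimately have "((\<lambda>y. 0) has_vector_derivative L (\<lambda>w. of_real (deriv (deriv E) (y + w)))) (at y)"
      by simp
    moreover have "((\<lambda>y. 0) has_vector_derivative (0::complex)) (at y)" by simp
    ultimately show ?thesis by (rule vector_derivative_unique_at)
  qed
  obtain \<xi> where "\<xi> islimpt distr_support (fourier_distr \<Lambda>)" using acc by blast
  then have "\<xi> islimpt {\<xi>. L (\<lambda>w. cis (\<xi> * w)) = 0}"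
    using symbol_zero_on_support[OF L dE(4) ann2 \<Lambda>] by (elim islimpt_subset) blast
  then show ?thesis by (rule C0_functional_vanishes[OF L _ e])
qed

section \<open>Equality of the entropy productions\<close>

theorem theorem2p27:
  fixes I :: "real set"
    and f :: "real \<times> (real^'n) \<times> real \<Rightarrow> real^'n"
    and g :: "real \<times> (real^'n) \<times> real \<Rightarrow> real"
    and E :: "real \<Rightarrow> real"
    and \<Lambda> :: "(real \<Rightarrow> complex) \<Rightarrow> complex"
    and u\<^sub>o v\<^sub>o :: "real^'n \<Rightarrow> real"
    and u v :: "real \<times> (real^'n) \<Rightarrow> real"
  assumes "I = {0..} \<or> (\<exists>T>0. I = {0..<T})"
    and "f \<in> F_class I"
    and "continuous_on (closure I \<times> UNIV) g"
    and "C_k_on 2 UNIV E"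
    and "represents_tempered (deriv (deriv E)) \<Lambda>"
    and "\<exists>\<xi>. \<xi> islimpt distr_support (fourier_distr \<Lambda>)"
    and "u\<^sub>o \<in> L_inf UNIV" and "v\<^sub>o \<in> L_inf UNIV"
    and "u \<in> L_inf (I \<times> UNIV)" and "v \<in> L_inf (I \<times> UNIV)"
    and "distributional_solution I f g u\<^sub>o u"
    and "distributional_solution I f g v\<^sub>o v"
    and "\<forall>k. \<forall>\<phi>\<in>test_functions (I \<times> UNIV).
           entropy_production I f g u\<^sub>o u (\<lambda>w. of_real (E (w - k))) \<phi> =
           entropy_production I f g v\<^sub>o v (\<lambda>w. of_real (E (w - k))) \<phi>"
  shows "\<forall>H :: real \<Rightarrow> complex. C_k_on 1 UNIV H \<longrightarrow>
           (\<forall>\<phi>\<in>test_functions (I \<times> UNIV).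
              entropy_production I f g u\<^sub>o u H \<phi> = entropy_production I f g v\<^sub>o v H \<phi>)"
proof (intro allI impI ballI)
  fix H :: "real \<Rightarrow> complex" and \<phi> :: "real \<times> (real^'n) \<Rightarrow> complex"
  assume H: "C_k_on 1 UNIV H" and \<phi>: "\<phi> \<in> test_functions (I \<times> UNIV)"
  have \<phi>1: "\<phi> \<in> Cc_k 1 (I \<times> UNIV)" using \<phi> by (simp add: test_functions_def del: One_nat_def)
  have meas: "u\<^sub>o \<in> borel_measurable lebesgue" "v\<^sub>o \<in> borel_measurable lebesgue"
    "u \<in> borel_measurable (lebesgue_on (I \<times> UNIV))" "v \<in> borel_measurable (lebesgue_on (I \<times> UNIV))"
    using assms(7-10) by (simp_all only: L_inf_def lebesgue_on_UNIV_eq mem_Collect_eq)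
  obtain R where R: "AE x in lebesgue. \<bar>u\<^sub>o x\<bar> \<le> R" "AE x in lebesgue. \<bar>v\<^sub>o x\<bar> \<le> R"
    "AE z in lebesgue_on (I \<times> UNIV). \<bar>u z\<bar> \<le> R" "AE z in lebesgue_on (I \<times> UNIV). \<bar>v z\<bar> \<le> R"
    by (rule common_L_inf_bound[OF assms(7-10)])
  obtain c where c: "\<forall>uo u R. uo \<in> borel_measurable lebesgue \<longrightarrow> (AE x in lebesgue. \<bar>uo x\<bar> \<le> R) \<longrightarrow>
     u \<in> borel_measurable (lebesgue_on (I \<times> UNIV)) \<longrightarrow> (AE z in lebesgue_on (I \<times> UNIV). \<bar>u z\<bar> \<le> R) \<longrightarrow>
     (\<exists>L. C0_functional R L \<and> (\<forall>H. C_k_on 1 UNIV H \<longrightarrow>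
        entropy_production I f g uo u H \<phi> = c H + L (\<lambda>w. vector_derivative H (at w))))"
    using entropy_production_representation[OF assms(1-3) \<phi>1] by (elim exE)
  obtain Lu where Lu: "C0_functional R Lu" "\<And>H. C_k_on 1 UNIV H \<Longrightarrow>
      entropy_production I f g u\<^sub>o u H \<phi> = c H + Lu (\<lambda>w. vector_derivative H (at w))"
    using c[rule_format, OF meas(1) R(1) meas(3) R(3)] by metis
  obtain Lv where Lv: "C0_functional R Lv" "\<And>H. C_k_on 1 UNIV H \<Longrightarrow>
      entropy_production I f g v\<^sub>o v H \<phi> = c H + Lv (\<lambda>w. vector_derivative H (at w))"
    using c[rule_format, OF meas(2) R(2) meas(4) R(4)] by metis
  \<comment> \<open>the difference of the two productions as a functional of the derivative of the entropy\<close>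
  define L where "L e = Lu e + - Lv e" for e
  have L: "C0_functional R L"
    unfolding L_def by (intro C0_functional_plus_functional C0_functional_uminus_functional Lu Lv)
  note dE = C_k_on_2_real_deriv[OF assms(4)]
  have "L (\<lambda>w. of_real (deriv E (w - k))) = 0" for k
  proof -
    let ?H = "\<lambda>w. complex_of_real (E (w - k))"
    have der: "(?H has_vector_derivative of_real (deriv E (w - k))) (at w)" for w
      using has_vector_derivative_of_real[OF DERIV_shift[THEN iffD1, OF dE(1)[of "w + - k"]]] by simp
    have "continuous_on UNIV (\<lambda>w. complex_of_real (deriv E (w - k)))"
      by (intro continuous_intros continuous_on_compose2[OF dE(3)]) auto
    then have "C_k_on 0 UNIV (\<lambda>w. complex_of_real (deriv E (w - k)))" by simp
    from C_k_on_Suc_realI[OF der this] have H1: "C_k_on 1 UNIV ?H" by (simp only: One_nat_def)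
    have "(\<lambda>w. vector_derivative ?H (at w)) = (\<lambda>w. of_real (deriv E (w - k)))"
      using vector_derivative_at[OF der] by blast
    then show ?thesis
      using assms(13) \<phi> Lu(2)[OF H1] Lv(2)[OF H1] by (simp add: L_def)
  qed
  from translates_annihilated_imp_zero[OF assms(4-6) L this]
  have "L (\<lambda>w. vector_derivative H (at w)) = 0"
    using C_k_on_Suc_real_deriv(2)[of 0 H] H by simp
  then show "entropy_production I f g u\<^sub>o u H \<phi> = entropy_production I f g v\<^sub>o v H \<phi>"
    using Lu(2)[OF H] Lv(2)[OF H] by (simp add: L_def)
qed

end
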